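(* (Bochner representation) For $0<\alpha<2$, $u\in\mathcal S(\mathbb R^d)$ and $x\in\mathbb R^d$, $$(-\Delta_k)^{\alpha/2}u(x)=\frac1{|\Gamma(-\frac\alpha2)|}\int_0^\infty\big[u(x)-e^{-t\Delta_k}u(x)\big]\frac{dt}{t^{1+\alpha/2}} .$$
   Context: Let $d\ge 1$, let $\mathcal R\subset\mathbb R^d\setminus\{0\}$ be a reduced root system with reflections $\sigma_v(x)=x-2\frac{\langle x,v\rangle}{|v|^2}v$, $v\in\mathcal R$, let $G$ be the finite group generated by them, let $k:\mathcal R\to[0,\infty)$ be $G$-invariant, and let $\mathcal R_+$ be a positive subsystem. Dunkl operators: $T_jf(x)=\partial_jf(x)+\sum_{v\in\mathcal R_+}k(v)\langle v,e_j\rangle\frac{f(x)-f(\sigma_v(x))}{\langle v,x\rangle}$; $\Delta_k=\sum_{j=1}^dT_j^2$. Weight: $w_k(x)=\prod_{v\in\mathcal R_+}|\langle x,v\rangle|^{2k(v)}$. For $z\in\mathbb C^d$ the Dunkl kernel $\mathcal E_k(z,\cdot)$ is the unique analytic solution on $\mathbb R^d$ of $T_jf=z_jf$ ($1\le j\le d$), $f(0)=1$. Put $c_k=\int_{\mathbb R^d}e^{-|x|^2/2}w_k(x)\,dx$. Dunkl transform: $\mathcal F_kf(\xi)=\frac1{c_k}\int_{\mathbb R^d}f(x)\mathcal E_k(-i\xi,x)w_k(x)\,dx$, an automorphism of $\mathcal S(\mathbb R^d)$ with inverse $\mathcal F_k^{-1}g(x)=\frac1{c_k}\int_{\mathbb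 R^d}g(\xi)\mathcal E_k(ix,\xi)w_k(\xi)\,d\xi$. For $u\in\mathcal S(\mathbb R^d)$, $(-\Delta_k)^{\alpha/2}u=\mathcal F_k^{-1}\big(|\xi|^\alpha\mathcal F_ku(\xi)\big)$. The heat semigroup (in the paper's notation, with this sign) is $e^{-t\Delta_k}f(x)=\mathcal F_k^{-1}\big(e^{-t|\xi|^2}\mathcal F_kf(\xi)\big)(x)$, $t\ge 0$. *)

theory Defs
  imports "HOL-Analysis.Analysis"
begin

section \<open>Root systems\<close>

definition reflect_along :: "real ^ 'n \<Rightarrow> real ^ 'n \<Rightarrow> real ^ 'n" where
  "reflect_along v x = x - (2 * (x \<bullet> v) / (norm v)\<^sup>2) *\<^sub>R v"

text \<open>No integrality condition, and no condition that the roots span the space.\<close>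

definition reduced_root_system :: "(real ^ 'n) set \<Rightarrow> bool" where
  "reduced_root_system R \<longleftrightarrow>
     finite R \<and> 0 \<notin> R \<and>
     (\<forall>v\<in>R. R \<inter> range (\<lambda>c. c *\<^sub>R v) = {v, - v}) \<and>
     (\<forall>v\<in>R. reflect_along v ` R = R)"

definition positive_subsystem :: "(real ^ 'n) set \<Rightarrow> (real ^ 'n) set \<Rightarrow> bool" where
  "positive_subsystem R Rp \<longleftrightarrow>
     (\<exists>b. (\<forall>v\<in>R. v \<bullet> b \<noteq> 0) \<and> Rp = {v \<in> R. v \<bullet> b > 0})"

text \<open>Reflections are involutions, so closing under composition with them already gives a group.\<close>

inductive_set reflection_group :: "(real ^ 'n) set \<Rightarrow> (real ^ 'n \<Rightarrow> real ^ 'n) set"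
  for R :: "(real ^ 'n) set" where
  id: "id \<in> reflection_group R"
| refl: "g \<in> reflection_group R \<Longrightarrow> v \<in> R \<Longrightarrow> reflect_along v \<circ> g \<in> reflection_group R"

definition multiplicity_function :: "(real ^ 'n) set \<Rightarrow> (real ^ 'n \<Rightarrow> real) \<Rightarrow> bool" where
  "multiplicity_function R k \<longleftrightarrow>
     (\<forall>v\<in>R. k v \<ge> 0) \<and> (\<forall>g\<in>reflection_group R. \<forall>v\<in>R. k (g v) = k v)"

section \<open>Function spaces\<close>

definition dir_deriv :: "real ^ 'n \<Rightarrow> (real ^ 'n \<Rightarrow> complex) \<Rightarrow> real ^ 'n \<Rightarrow> complex" where
  "dir_deriv v f x = vector_derivative (\<lambda>t. f (x + t *\<^sub>R v)) (at 0)"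

abbreviation partial_deriv :: "'n \<Rightarrow> (real ^ 'n \<Rightarrow> complex) \<Rightarrow> real ^ 'n \<Rightarrow> complex" where
  "partial_deriv j \<equiv> dir_deriv (axis j 1)"

text \<open>A function all of whose iterated partial derivatives exist and are (Frechet) differentiable
  everywhere is smooth; a list of directions encodes an iterated partial derivative.\<close>

definition schwartz_space :: "(real ^ 'n \<Rightarrow> complex) set" where
  "schwartz_space =
     {f. \<forall>js. (\<forall>x. foldr partial_deriv js f differentiable (at x)) \<and>
              (\<forall>m::nat. bounded (range (\<lambda>x. norm x ^ m *\<^sub>R foldr partial_deriv js f x)))}"

text \<open>Around every point the function is given by a convergent power series, indexed by
  multi-indices \<open>m :: 'n \<Rightarrow> nat\<close>.\<close>

definition real_analytic :: "(real ^ 'n \<Rightarrow> complex) \<Rightarrow> bool" where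
  "real_analytic f \<longleftrightarrow>
     (\<forall>x. \<exists>r>0. \<exists>a. \<forall>y\<in>ball x r.
        ((\<lambda>m. a m * of_real (\<Prod>i\<in>UNIV. (y $ i - x $ i) ^ m i)) has_sum f y) UNIV)"

section \<open>Dunkl operators and the Dunkl kernel\<close>

text \<open>\<open>(f x - f (reflect_along v x)) / (v \<bullet> x)\<close>. For continuously differentiable \<open>f\<close> the singularity on the
  hyperplane \<open>v \<bullet> x = 0\<close> is removable: since
  \<open>x - reflect_along v x = (2 * (v \<bullet> x) / (norm v)\<^sup>2) *\<^sub>R v\<close>, the
  continuous extension has the value given in the second case. (Division by zero would give 0.)\<close>

definition dunkl_quotient :: "real ^ 'n \<Rightarrow> (real ^ 'n \<Rightarrow> complex) \<Rightarrow> real ^ 'n \<Rightarrow> complex" where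
  "dunkl_quotient v f x =
     (if v \<bullet> x \<noteq> 0 then (f x - f (reflect_along v x)) / of_real (v \<bullet> x)
      else of_real (2 / (norm v)\<^sup>2) * dir_deriv v f x)"

definition dunkl_operator ::
  "(real ^ 'n) set \<Rightarrow> (real ^ 'n \<Rightarrow> real) \<Rightarrow> 'n \<Rightarrow> (real ^ 'n \<Rightarrow> complex) \<Rightarrow> real ^ 'n \<Rightarrow> complex"
  where
  "dunkl_operator Rp k j f x =
     partial_deriv j f x + (\<Sum>v\<in>Rp. of_real (k v * (v \<bullet> axis j 1)) * dunkl_quotient v f x)"

definition dunkl_kernel ::
  "(real ^ 'n) set \<Rightarrow> (real ^ 'n \<Rightarrow> real) \<Rightarrow> complex ^ 'n \<Rightarrow> real ^ 'n \<Rightarrow> complex" where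
  "dunkl_kernel Rp k z =
     (THE f. real_analytic f \<and> (\<forall>j x. dunkl_operator Rp k j f x = z $ j * f x) \<and> f 0 = 1)"

section \<open>Dunkl transform, fractional Dunkl Laplacian, heat semigroup\<close>

text \<open>The case distinction is needed because \<open>0 powr 0 = 0\<close>.\<close>

definition dunkl_weight :: "(real ^ 'n) set \<Rightarrow> (real ^ 'n \<Rightarrow> real) \<Rightarrow> real ^ 'n \<Rightarrow> real" where
  "dunkl_weight Rp k x = (\<Prod>v\<in>Rp. if k v = 0 then 1 else \<bar>x \<bullet> v\<bar> powr (2 * k v))"

definition dunkl_const :: "(real ^ 'n) set \<Rightarrow> (real ^ 'n \<Rightarrow> real) \<Rightarrow> real" where
  "dunkl_const Rp k = (LINT x|lborel. exp (- (norm x)\<^sup>2 / 2) * dunkl_weight Rp k x)"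

definition imag_vec :: "real ^ 'n \<Rightarrow> complex ^ 'n" where
  "imag_vec x = (\<chi> j. \<i> * of_real (x $ j))"

definition dunkl_transform ::
  "(real ^ 'n) set \<Rightarrow> (real ^ 'n \<Rightarrow> real) \<Rightarrow> (real ^ 'n \<Rightarrow> complex) \<Rightarrow> real ^ 'n \<Rightarrow> complex" where
  "dunkl_transform Rp k f \<xi> =
     (1 / of_real (dunkl_const Rp k)) *
     (LINT x|lborel. f x * dunkl_kernel Rp k (- imag_vec \<xi>) x * of_real (dunkl_weight Rp k x))"

definition inv_dunkl_transform ::
  "(real ^ 'n) set \<Rightarrow> (real ^ 'n \<Rightarrow> real) \<Rightarrow> (real ^ 'n \<Rightarrow> complex) \<Rightarrow> real ^ 'n \<Rightarrow> complex" where
  "inv_dunkl_transform Rp k g x =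
     (1 / of_real (dunkl_const Rp k)) *
     (LINT \<xi>|lborel. g \<xi> * dunkl_kernel Rp k (imag_vec x) \<xi> * of_real (dunkl_weight Rp k \<xi>))"

text \<open>\<open>(-\<Delta>\<^sub>k)\<close> to the power \<open>\<alpha>/2\<close>.\<close>

definition frac_dunkl_laplacian ::
  "(real ^ 'n) set \<Rightarrow> (real ^ 'n \<Rightarrow> real) \<Rightarrow> real \<Rightarrow> (real ^ 'n \<Rightarrow> complex) \<Rightarrow> real ^ 'n \<Rightarrow> complex"
  where
  "frac_dunkl_laplacian Rp k \<alpha> u =
     inv_dunkl_transform Rp k (\<lambda>\<xi>. of_real (norm \<xi> powr \<alpha>) * dunkl_transform Rp k u \<xi>)"

text \<open>The heat semigroup at time \<open>t\<close>, generated by \<open>\<Delta>\<^sub>k\<close>.\<close>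

definition dunkl_heat ::
  "(real ^ 'n) set \<Rightarrow> (real ^ 'n \<Rightarrow> real) \<Rightarrow> real \<Rightarrow> (real ^ 'n \<Rightarrow> complex) \<Rightarrow> real ^ 'n \<Rightarrow> complex"
  where
  "dunkl_heat Rp k t f =
     inv_dunkl_transform Rp k (\<lambda>\<xi>. of_real (exp (- t * (norm \<xi>)\<^sup>2)) * dunkl_transform Rp k f \<xi>)"

end

theory Submission
  imports Defs
begin

text \<open>By Fubini the claim reduces to the scalar identity
  \<open>\<lambda>\<^sup>a = |\<Gamma>(-a)|\<^sup>-\<^sup>1 \<integral> (1 - e\<^sup>-\<^sup>t\<^sup>\<lambda>) t\<^sup>-\<^sup>1\<^sup>-\<^sup>a dt\<close> for \<open>a = \<alpha>/2\<close>, \<open>\<lambda> = |\<xi>|\<^sup>2\<close>, once the inversion theorem and the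
  rapid decay of the Dunkl transform of a Schwartz function are known.
  The kernel \<open>E(\<i>y, x) = \<Sum>\<^sub>n E\<^sub>n\<close> is constructed from the recursion
  \<open>(n + \<Sum>\<^sub>v k\<^sub>v (1 - \<sigma>\<^sub>v)) E\<^sub>n = \<i> \<langle>x, y\<rangle> E\<^sub>n\<^sub>-\<^sub>1\<close>; for \<open>k \<ge> 0\<close> the operator on the left is invertible, and the
  maximum principle on orbits gives symmetry, equivariance and the eigenvalue equations. An energy
  estimate along rays, summed over the reflection group, gives uniqueness, boundedness and a Lipschitz
  bound of the kernel. Decay of the transform follows from antisymmetry of the Dunkl operators, inversion
  from Hadamard's lemma and the fact that the Gaussian is its own transform.\<close>

section \<open>Reflections and the reflection group\<close>

text \<open>The recursion for the homogeneous components is Euler's identity. In the radial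
  direction the denominators of the difference quotients cancel, so the Dunkl operator with
  direction \<open>x\<close> at the point \<open>x\<close> acts on a function homogeneous of degree
  \<open>n\<close> as \<open>n + \<Sum>\<^sub>v k\<^sub>v (1 - \<sigma>\<^sub>v)\<close>, and the
  eigenvalue equation prescribes the result through the component of degree \<open>n - 1\<close>.
  This fixes the components; the real task is to recover the equations in all directions from the
  radial one. The obstacle in the estimates is uniformity in the spectral parameter: the series
  alone only yields growth like exp (|x| |y|). For an imaginary parameter the eigenvalue term is
  orthogonal to the solution in the real inner product of the complex plane, so it adds nothing to
  the energy and bounds independent of \<open>y\<close> follow. The other obstacle is the reflecting
  hyperplanes, where the quotients change their definition and the weight can lose
  differentiability. A segment integral deals with the former, a regularised weight with the
  latter.\<close>

lemma reflect_along_linear [simp]: "linear (reflect_along v)"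
  unfolding reflect_along_def
  by (intro linearI) (simp_all add: inner_add_left algebra_simps add_divide_distrib)

lemma reflect_along_bounded_linear: "bounded_linear (reflect_along v)"
  by (simp add: linear_conv_bounded_linear[symmetric])

lemma reflect_along_0 [simp]: "reflect_along v 0 = 0"
  by (simp add: reflect_along_def)

lemma reflect_along_scaleR: "reflect_along v (c *\<^sub>R x) = c *\<^sub>R reflect_along v x"
  by (simp add: linear_cmul)

lemma reflect_along_minus: "reflect_along v (- x) = - reflect_along v x"
  by (simp add: linear_neg)

lemma reflect_along_uminus [simp]: "reflect_along (- v) = reflect_along v"
  by (rule ext) (simp add: reflect_along_def)

lemma inner_reflect_along_self: "v \<bullet> reflect_along v x = - (v \<bullet> x)"
  by (cases "v = 0") (auto simp: reflect_along_def inner_diff_right power2_norm_eq_inner inner_commute)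

lemma reflect_along_involution [simp]: "reflect_along v (reflect_along v x) = x"
proof (cases "v = 0")
  case True
  then show ?thesis by (simp add: reflect_along_def)
next
  case False
  have "reflect_along v x \<bullet> v = - (x \<bullet> v)"
    by (metis inner_reflect_along_self inner_commute)
  then show ?thesis
    by (subst reflect_along_def) (simp add: reflect_along_def algebra_simps)
qed

lemma inner_reflect_along: "reflect_along v x \<bullet> reflect_along v y = x \<bullet> y"
proof (cases "v = 0")
  case True
  then show ?thesis by (simp add: reflect_along_def)
next
  case False
  then have nz: "v \<bullet> v \<noteq> 0" by simp
  define a where "a = 2 * (x \<bullet> v) / (v \<bullet> v)"
  define b where "b = 2 * (y \<bullet> v) / (v \<bullet> v)"
  have "reflect_along v x \<bullet> reflect_along v y = x \<bullet> y - b * (x \<bullet> v) - a * (y \<bullet> v) + a * (b * (v \<bullet> v))"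
    unfolding reflect_along_def power2_norm_eq_inner a_def[symmetric] b_def[symmetric]
      inner_diff_left inner_diff_right inner_scaleR_left inner_scaleR_right
    by (simp only: inner_commute[of v y]) (simp add: field_simps)
  also have "b * (v \<bullet> v) = 2 * (y \<bullet> v)"
    using nz by (simp add: b_def)
  also have "b * (x \<bullet> v) = a * (y \<bullet> v)"
    by (simp add: a_def b_def)
  finally show ?thesis by (simp add: algebra_simps)
qed

lemma inner_reflect_along_commute: "reflect_along v x \<bullet> y = x \<bullet> reflect_along v y"
  by (metis inner_reflect_along reflect_along_involution)

lemma norm_reflect_along [simp]: "norm (reflect_along v x) = norm x"
  by (simp add: norm_eq_sqrt_inner inner_reflect_along)

lemma reflect_along_orthogonal: "v \<bullet> x = 0 \<Longrightarrow> reflect_along v x = x"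
  by (simp add: reflect_along_def inner_commute)

lemma reflect_along_self: "reflect_along v v = - v"
  by (cases "v = 0") (auto simp: reflect_along_def power2_norm_eq_inner algebra_simps scaleR_2)

text \<open>In operator form \<sigma>_u \<sigma>_v = \<sigma>_w \<sigma>_u with w = \<sigma>_u v,
  because \<sigma>_u is a linear isometry. This rule makes sums over the roots equivariant.\<close>

lemma reflect_along_conjugate:
  "reflect_along u (reflect_along v x) = reflect_along (reflect_along u v) (reflect_along u x)"
proof -
  have "reflect_along u (reflect_along v x) =
      reflect_along u x - (2 * (x \<bullet> v) / (norm v)\<^sup>2) *\<^sub>R reflect_along u v"
    by (simp add: reflect_along_def[of v] linear_diff linear_cmul)
  then show ?thesis
    by (simp add: reflect_along_def[of "reflect_along u v"] inner_reflect_along)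
qed

lemma reflection_group_linear: "g \<in> reflection_group R \<Longrightarrow> linear g"
proof (induction rule: reflection_group.induct)
  case id
  show ?case by (rule linear_id)
next
  case (refl g v)
  show ?case by (rule linear_compose[OF refl(3) reflect_along_linear])
qed

lemma reflection_group_norm: "g \<in> reflection_group R \<Longrightarrow> norm (g x) = norm x"
  by (induction rule: reflection_group.induct) auto

lemma reflection_group_comp_reflect:
  "g \<in> reflection_group R \<Longrightarrow> v \<in> R \<Longrightarrow> g \<circ> reflect_along v \<in> reflection_group R"
proof (induction rule: reflection_group.induct)
  case id
  then show ?case
    using reflection_group.refl[OF reflection_group.id, of v R] by simp
next
  case (refl g u)
  then show ?case
    using reflection_group.refl[of "g \<circ> reflect_along v" R u] by (metis comp_assoc)
qed

lemma reflection_group_fixes: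
  "g \<in> reflection_group R \<Longrightarrow> (\<And>v. v \<in> R \<Longrightarrow> v \<bullet> x = 0) \<Longrightarrow> g x = x"
  by (induction rule: reflection_group.induct) (auto simp: reflect_along_orthogonal)

lemma reflection_group_maps:
  assumes "\<And>v. v \<in> R \<Longrightarrow> reflect_along v ` R = R"
  shows "g \<in> reflection_group R \<Longrightarrow> w \<in> R \<Longrightarrow> g w \<in> R"
  by (induction rule: reflection_group.induct) (use assms in auto)

text \<open>Every group element is the identity on the orthogonal complement of the span of
  \<open>R\<close>. Agreement on \<open>R\<close> therefore extends by linearity to the span and
  then to the whole space.\<close>

lemma reflection_group_eqI:
  assumes g: "g \<in> reflection_group R" and h: "h \<in> reflection_group R"
    and eq: "\<And>v. v \<in> R \<Longrightarrow> g v = h v"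
  shows "g = h"
proof
  fix x
  obtain y z where yz: "y \<in> span R" "\<And>w. w \<in> span R \<Longrightarrow> orthogonal z w" "x = y + z"
    using orthogonal_subspace_decomp_exists[of R x] by metis
  have z: "g z = z" "h z = z"
    using yz(2) by (auto intro!: reflection_group_fixes[OF g] reflection_group_fixes[OF h]
        simp: orthogonal_def span_base inner_commute)
  have "g y = h y"
    using linear_eq_on_span[OF reflection_group_linear[OF g] reflection_group_linear[OF h] eq yz(1)]
    by blast
  then show "g x = h x"
    using z yz(3) by (simp add: linear_add reflection_group_linear[OF g] reflection_group_linear[OF h])
qed

text \<open>Restriction to \<open>R\<close> embeds the group into the finite set of maps from
  \<open>R\<close> to itself.\<close>

lemma finite_reflection_group:
  assumes fin: "finite R" and maps: "\<And>v. v \<in> R \<Longrightarrow> reflect_along v ` R = R"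
  shows "finite (reflection_group R)"
proof -
  have "inj_on (\<lambda>g. restrict g R) (reflection_group R)"
  proof (rule inj_onI)
    fix g h assume gh: "g \<in> reflection_group R" "h \<in> reflection_group R"
      and eq: "restrict g R = restrict h R"
    show "g = h"
      by (rule reflection_group_eqI[OF gh]) (metis eq restrict_apply)
  qed
  moreover have "(\<lambda>g. restrict g R) ` reflection_group R \<subseteq> R \<rightarrow>\<^sub>E R"
    using reflection_group_maps[OF maps] by auto
  ultimately show ?thesis
    using finite_PiE[OF fin, of "\<lambda>_. R"] fin by (metis finite_imageD finite_subset)
qed

section \<open>Root system data and reindexing of sums over roots and group elements\<close>

locale dunkl =
  fixes R Rp :: "(real ^ 'n) set" and k :: "real ^ 'n \<Rightarrow> real"
  assumes root_system: "reduced_root_system R"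
    and pos: "positive_subsystem R Rp"
    and mult: "multiplicity_function R k"
begin

abbreviation "G \<equiv> reflection_group R"

definition \<gamma> :: real where "\<gamma> = (\<Sum>v\<in>Rp. k v)"

lemma finite_R: "finite R" and zero_notin_R: "0 \<notin> R"
  and reflect_image: "v \<in> R \<Longrightarrow> reflect_along v ` R = R"
  using root_system by (auto simp: reduced_root_system_def)

lemma uminus_in_R: "v \<in> R \<Longrightarrow> - v \<in> R"
  using root_system unfolding reduced_root_system_def by blast

lemma reflect_in_R: "u \<in> R \<Longrightarrow> v \<in> R \<Longrightarrow> reflect_along u v \<in> R"
  using reflect_image by blast

lemma Rp_subset: "Rp \<subseteq> R"
  using pos by (auto simp: positive_subsystem_def)

lemma finite_Rp: "finite Rp"
  using Rp_subset finite_R finite_subset by blast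

lemma Rp_in_R: "v \<in> Rp \<Longrightarrow> v \<in> R"
  using Rp_subset by blast

lemma Rp_nonzero: "v \<in> Rp \<Longrightarrow> v \<noteq> 0"
  using Rp_subset zero_notin_R by blast

lemma Rp_cases: "v \<in> R \<Longrightarrow> (v \<in> Rp) \<noteq> (- v \<in> Rp)"
  using pos uminus_in_R unfolding positive_subsystem_def
  by (smt (verit, ccfv_threshold) inner_minus_left mem_Collect_eq)

lemma finite_G: "finite G"
  by (rule finite_reflection_group[OF finite_R reflect_image])

lemma id_in_G: "id \<in> G"
  by (rule reflection_group.id)

lemma card_G: "card G \<ge> 1"
  using finite_G id_in_G by (metis One_nat_def Suc_leI card_gt_0_iff empty_iff)

lemma k_nonneg: "v \<in> R \<Longrightarrow> k v \<ge> 0"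
  using mult by (auto simp: multiplicity_function_def)

lemma k_reflect: "u \<in> R \<Longrightarrow> v \<in> R \<Longrightarrow> k (reflect_along u v) = k v"
  using mult reflection_group.refl[OF reflection_group.id, of u R]
  by (auto simp: multiplicity_function_def)

lemma k_uminus: "v \<in> R \<Longrightarrow> k (- v) = k v"
  using k_reflect[of v v] by (simp add: reflect_along_self)

lemma k_Rp: "v \<in> Rp \<Longrightarrow> k v \<ge> 0"
  by (simp add: k_nonneg Rp_in_R)

lemma \<gamma>_nonneg: "\<gamma> \<ge> 0"
  unfolding \<gamma>_def by (intro sum_nonneg k_Rp)

text \<open>A reflection can move a positive root out of \<open>Rp\<close>, but only up to sign:
  choosing the positive one of two opposite roots gives a permutation of \<open>Rp\<close> that
  preserves \<open>k\<close>. An even summand does not see the sign.\<close>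

lemma sum_Rp_reflect:
  fixes F :: "real ^ 'n \<Rightarrow> 'b::real_vector"
  assumes u: "u \<in> R" and even: "\<And>v. v \<in> R \<Longrightarrow> F (- v) = F v"
  shows "(\<Sum>v\<in>Rp. k v *\<^sub>R F (reflect_along u v)) = (\<Sum>v\<in>Rp. k v *\<^sub>R F v)"
proof -
  define p where "p v = (if reflect_along u v \<in> Rp then reflect_along u v else - reflect_along u v)" for v
  have p_in: "p v \<in> Rp" if "v \<in> Rp" for v
    using that Rp_cases[OF reflect_in_R[OF u Rp_in_R[OF that]]] by (auto simp: p_def)
  have p_p: "p (p v) = v" if v: "v \<in> Rp" for v
    using v Rp_cases[OF Rp_in_R[OF v]] by (auto simp: p_def reflect_along_minus)
  have bij: "bij_betw p Rp Rp"
    by (rule bij_betwI[where g = p]) (use p_in p_p in auto)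
  have "(\<Sum>v\<in>Rp. k v *\<^sub>R F v) = (\<Sum>v\<in>Rp. k (p v) *\<^sub>R F (p v))"
    using sum.reindex_bij_betw[OF bij, of "\<lambda>v. k v *\<^sub>R F v"] by simp
  also have "\<dots> = (\<Sum>v\<in>Rp. k v *\<^sub>R F (reflect_along u v))"
  proof (rule sum.cong[OF HOL.refl])
    fix v assume "v \<in> Rp"
    then have v: "v \<in> R" "reflect_along u v \<in> R" using u by (auto simp: Rp_in_R reflect_in_R)
    show "k (p v) *\<^sub>R F (p v) = k v *\<^sub>R F (reflect_along u v)"
      using u v even k_uminus by (auto simp: p_def k_reflect)
  qed
  finally show ?thesis ..
qed

lemma sum_G_comp_reflect:
  assumes v: "v \<in> R"
  shows "(\<Sum>g\<in>G. F (g \<circ> reflect_along v)) = (\<Sum>g\<in>G. F g)"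
proof -
  have "g \<circ> reflect_along v \<circ> reflect_along v = g" for g :: "real ^ 'n \<Rightarrow> real ^ 'n"
    by (simp add: fun_eq_iff)
  then have "bij_betw (\<lambda>g. g \<circ> reflect_along v) G G"
    using reflection_group_comp_reflect[OF _ v]
    by (intro bij_betwI[where g = "\<lambda>g. g \<circ> reflect_along v"]) (auto simp only: Pi_iff)
  then show ?thesis by (rule sum.reindex_bij_betw)
qed

lemma sum_G_reflect_comp:
  assumes v: "v \<in> R"
  shows "(\<Sum>g\<in>G. F (reflect_along v \<circ> g)) = (\<Sum>g\<in>G. F g)"
proof -
  have "reflect_along v \<circ> (reflect_along v \<circ> g) = g" for g :: "real ^ 'n \<Rightarrow> real ^ 'n"
    by (simp add: fun_eq_iff)
  then have "bij_betw (\<lambda>g. reflect_along v \<circ> g) G G"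
    using reflection_group.refl[OF _ v]
    by (intro bij_betwI[where g = "\<lambda>g. reflect_along v \<circ> g"]) (auto simp only: Pi_iff)
  then show ?thesis by (rule sum.reindex_bij_betw)
qed


section \<open>Homogeneous components of the Dunkl kernel\<close>

text \<open>At an element where \<psi> attains its maximum M the right-hand side is at most \<gamma>
  M, so s M \<le> 0. In the applications \<psi> is the norm of an error term along an orbit, which
  is thereby forced to vanish.\<close>

lemma G_max_principle:
  fixes \<psi> :: "(real ^ 'n \<Rightarrow> real ^ 'n) \<Rightarrow> real" and s :: real
  assumes s: "s > 0"
    and le: "\<And>g. g \<in> G \<Longrightarrow> (s + \<gamma>) * \<psi> g \<le> (\<Sum>v\<in>Rp. k v * \<psi> (reflect_along v \<circ> g))"
    and g: "g \<in> G"
  shows "\<psi> g \<le> 0"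
proof -
  define M where "M = Max (\<psi> ` G)"
  have M: "\<psi> g \<le> M" if "g \<in> G" for g
    using that finite_G by (auto simp: M_def)
  have "M \<in> \<psi> ` G"
    unfolding M_def using finite_G id_in_G by (intro Max_in) auto
  then obtain h where h: "h \<in> G" "\<psi> h = M" by auto
  have "(s + \<gamma>) * M \<le> (\<Sum>v\<in>Rp. k v * \<psi> (reflect_along v \<circ> h))"
    using le[OF h(1)] h(2) by simp
  also have "\<dots> \<le> (\<Sum>v\<in>Rp. k v * M)"
    by (intro sum_mono mult_left_mono M k_Rp reflection_group.refl h Rp_in_R)
  also have "\<dots> = \<gamma> * M"
    by (simp add: \<gamma>_def sum_distrib_right)
  finally have "s * M \<le> 0" by (simp add: algebra_simps)
  then have "M \<le> 0" using s by (simp add: mult_le_0_iff)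
  with M[OF g] show ?thesis by simp
qed

text \<open>This is injectivity of s + \<Sum> k_v (1 - \<sigma>_v). As the multiplicities are
  nonnegative, the triangle inequality turns the equation into the inequality of the maximum
  principle for the norm of \<phi> on the orbit of \<open>x\<close>.\<close>

lemma G_averaging_unique:
  fixes \<phi> :: "real ^ 'n \<Rightarrow> complex" and s :: real
  assumes s: "s > 0"
    and eq: "\<And>x. of_real (s + \<gamma>) * \<phi> x = (\<Sum>v\<in>Rp. of_real (k v) * \<phi> (reflect_along v x))"
  shows "\<phi> x = 0"
proof -
  have "norm (\<phi> (id x)) \<le> 0"
  proof (rule G_max_principle[OF s _ id_in_G, where \<psi> = "\<lambda>g. norm (\<phi> (g x))"])
    fix g assume "g \<in> G"
    have "(s + \<gamma>) * norm (\<phi> (g x)) = norm (of_real (s + \<gamma>) * \<phi> (g x))"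
      using s \<gamma>_nonneg by (simp add: norm_mult del: of_real_add)
    also have "\<dots> = norm (\<Sum>v\<in>Rp. of_real (k v) * \<phi> (reflect_along v (g x)))"
      by (simp only: eq)
    also have "\<dots> \<le> (\<Sum>v\<in>Rp. norm (of_real (k v) * \<phi> (reflect_along v (g x))))"
      by (rule norm_sum)
    also have "\<dots> = (\<Sum>v\<in>Rp. k v * norm (\<phi> ((reflect_along v \<circ> g) x)))"
      by (intro sum.cong) (auto simp: norm_mult k_Rp)
    finally show "(s + \<gamma>) * norm (\<phi> (g x)) \<le> (\<Sum>v\<in>Rp. k v * norm (\<phi> ((reflect_along v \<circ> g) x)))" .
  qed
  then show ?thesis by simp
qed

text \<open>\<open>walk m g\<close> is the coefficient of \<open>g\<close> in \<open>(\<Sum>\<^sub>v k\<^sub>v \<sigma>\<^sub>v)\<^sup>m\<close>.\<close>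

primrec walk :: "nat \<Rightarrow> (real ^ 'n \<Rightarrow> real ^ 'n) \<Rightarrow> real" where
  "walk 0 g = (if g = id then 1 else 0)"
| "walk (Suc m) g = (\<Sum>v\<in>Rp. k v * walk m (g \<circ> reflect_along v))"

lemma walk_nonneg: "walk m g \<ge> 0"
  by (induction m arbitrary: g) (auto intro!: sum_nonneg mult_nonneg_nonneg k_Rp)

text \<open>One step multiplies the total mass by \<gamma>, since right translation by a reflection
  permutes \<open>G\<close>. Hence the Neumann series below is dominated by a geometric series of
  ratio \<gamma> / (n + \<gamma>) < 1.\<close>

lemma sum_walk: "(\<Sum>g\<in>G. walk m g) = \<gamma> ^ m"
proof (induction m)
  case 0
  then show ?case using finite_G id_in_G by simp
next
  case (Suc m)
  have "(\<Sum>g\<in>G. walk (Suc m) g) = (\<Sum>v\<in>Rp. k v * (\<Sum>g\<in>G. walk m (g \<circ> reflect_along v)))"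
    by (simp add: sum.swap[of _ Rp G] sum_distrib_left)
  also have "\<dots> = (\<Sum>v\<in>Rp. k v * \<gamma> ^ m)"
    by (intro sum.cong) (auto simp: sum_G_comp_reflect Rp_in_R Suc)
  finally show ?case by (simp add: \<gamma>_def sum_distrib_right)
qed

lemma walk_le: "g \<in> G \<Longrightarrow> walk m g \<le> \<gamma> ^ m"
  using member_le_sum[of g G "walk m"] finite_G walk_nonneg by (simp add: sum_walk)

text \<open>The coefficients of the inverse of \<open>n + \<Sum>\<^sub>v k\<^sub>v (1 - \<sigma>\<^sub>v)\<close> in the group algebra, by Neumann series.\<close>

definition resolvent :: "nat \<Rightarrow> (real ^ 'n \<Rightarrow> real ^ 'n) \<Rightarrow> real" where
  "resolvent n g = (\<Sum>m. walk m g / (real n + \<gamma>) ^ Suc m)"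

lemma summable_resolvent:
  assumes n: "n > 0" and g: "g \<in> G"
  shows "summable (\<lambda>m. walk m g / (real n + \<gamma>) ^ Suc m)"
proof (rule summable_comparison_test')
  have pos: "real n + \<gamma> > 0" using n \<gamma>_nonneg by simp
  then have "norm (\<gamma> / (real n + \<gamma>)) < 1" using \<gamma>_nonneg n by simp
  then show "summable (\<lambda>m. (1 / (real n + \<gamma>)) * (\<gamma> / (real n + \<gamma>)) ^ m)"
    by (intro summable_mult summable_geometric)
  fix m
  show "norm (walk m g / (real n + \<gamma>) ^ Suc m) \<le> (1 / (real n + \<gamma>)) * (\<gamma> / (real n + \<gamma>)) ^ m"
    using pos walk_le[OF g, of m] walk_nonneg[of m g]
    by (simp add: power_divide divide_right_mono)
qed

lemma resolvent_nonneg: "n > 0 \<Longrightarrow> g \<in> G \<Longrightarrow> resolvent n g \<ge> 0"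
  unfolding resolvent_def using \<gamma>_nonneg
  by (intro suminf_nonneg summable_resolvent divide_nonneg_nonneg walk_nonneg zero_le_power) auto

text \<open>Multiplication by n + \<gamma> lowers the exponent in the Neumann series by one: the
  term m = 0 then yields the identity element, and the remaining terms are one further step of the
  walk.\<close>

lemma resolvent_eq:
  assumes n: "n > 0" and g: "g \<in> G"
  shows "(real n + \<gamma>) * resolvent n g =
    (if g = id then 1 else 0) + (\<Sum>v\<in>Rp. k v * resolvent n (g \<circ> reflect_along v))"
proof -
  define c where "c = real n + \<gamma>"
  have c: "c > 0" using n \<gamma>_nonneg by (simp add: c_def)
  have sm: "summable (\<lambda>m. walk m h / c ^ Suc m)" if "h \<in> G" for h
    using summable_resolvent[OF n that] by (simp add: c_def)
  have gv: "g \<circ> reflect_along v \<in> G" if "v \<in> Rp" for v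
    by (rule reflection_group_comp_reflect[OF g Rp_in_R[OF that]])
  have "c * resolvent n g = (\<Sum>m. c * (walk m g / c ^ Suc m))"
    unfolding resolvent_def c_def[symmetric] using sm[OF g] by (rule suminf_mult[symmetric])
  also have "(\<lambda>m. c * (walk m g / c ^ Suc m)) = (\<lambda>m. walk m g / c ^ m)"
    using c by (simp add: fun_eq_iff)
  also have "suminf \<dots> = walk 0 g + (\<Sum>m. walk (Suc m) g / c ^ Suc m)"
  proof -
    have "summable (\<lambda>m. walk m g / c ^ m)"
      using summable_mult[OF sm[OF g], of c] c by simp
    from suminf_split_head[OF this] show ?thesis by simp
  qed
  also have "(\<Sum>m. walk (Suc m) g / c ^ Suc m) =
      (\<Sum>m. \<Sum>v\<in>Rp. k v * (walk m (g \<circ> reflect_along v) / c ^ Suc m))"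
    by (simp add: sum_divide_distrib)
  also have "\<dots> = (\<Sum>v\<in>Rp. \<Sum>m. k v * (walk m (g \<circ> reflect_along v) / c ^ Suc m))"
    by (intro suminf_sum summable_mult sm gv)
  also have "\<dots> = (\<Sum>v\<in>Rp. k v * resolvent n (g \<circ> reflect_along v))"
    unfolding resolvent_def c_def[symmetric] using sm[OF gv]
    by (intro sum.cong HOL.refl suminf_mult) auto
  finally show ?thesis by (simp add: c_def)
qed

text \<open>Summing \<open>resolvent_eq\<close> over the group makes the reflections act trivially
  and leaves n C = 1. The exact value 1 / n is what produces the factorial in the bounds for the
  kernel terms.\<close>

lemma sum_resolvent:
  assumes n: "n > 0"
  shows "(\<Sum>g\<in>G. resolvent n g) = 1 / real n"
proof -
  define C where "C = (\<Sum>g\<in>G. resolvent n g)"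
  have "(real n + \<gamma>) * C = (\<Sum>g\<in>G. (if g = id then 1 else 0) + (\<Sum>v\<in>Rp. k v * resolvent n (g \<circ> reflect_along v)))"
    by (simp add: C_def sum_distrib_left resolvent_eq[OF n])
  also have "\<dots> = 1 + (\<Sum>v\<in>Rp. k v * (\<Sum>g\<in>G. resolvent n (g \<circ> reflect_along v)))"
    using finite_G id_in_G by (simp add: sum.distrib sum.swap[of _ Rp G] sum_distrib_left)
  also have "(\<Sum>v\<in>Rp. k v * (\<Sum>g\<in>G. resolvent n (g \<circ> reflect_along v))) = (\<Sum>v\<in>Rp. k v * C)"
    by (intro sum.cong) (auto simp: sum_G_comp_reflect Rp_in_R C_def)
  also have "\<dots> = \<gamma> * C" by (simp add: \<gamma>_def sum_distrib_right)
  finally have "real n * C = 1" by (simp add: algebra_simps)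
  then show ?thesis using n by (simp add: C_def[symmetric] field_simps)
qed

text \<open>The existence counterpart of \<open>G_averaging_unique\<close>: averaging
  \<open>F\<close> over the orbit with the resolvent coefficients solves the equation with
  right-hand side \<open>F\<close>.\<close>

lemma resolvent_inverts:
  fixes F :: "real ^ 'n \<Rightarrow> complex"
  assumes n: "n > 0"
  defines "E \<equiv> \<lambda>x. \<Sum>g\<in>G. of_real (resolvent n g) * F (g x)"
  shows "of_real (real n + \<gamma>) * E x = F x + (\<Sum>v\<in>Rp. of_real (k v) * E (reflect_along v x))"
proof -
  have "of_real (real n + \<gamma>) * E x = (\<Sum>g\<in>G. of_real ((real n + \<gamma>) * resolvent n g) * F (g x))"
    unfolding E_def by (simp only: sum_distrib_left of_real_mult mult.assoc)
  also have "\<dots> = (\<Sum>g\<in>G. (if g = id then F x else 0) +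
      (\<Sum>v\<in>Rp. of_real (k v) * (of_real (resolvent n (g \<circ> reflect_along v)) * F (g x))))"
    by (intro sum.cong HOL.refl, simp only: resolvent_eq[OF n])
      (simp add: distrib_right sum_distrib_right mult.assoc)
  also have "\<dots> = F x + (\<Sum>v\<in>Rp. of_real (k v) *
      (\<Sum>g\<in>G. of_real (resolvent n (g \<circ> reflect_along v)) * F (g x)))"
    using finite_G id_in_G by (simp add: sum.distrib sum.swap[of _ Rp G] sum_distrib_left)
  also have "(\<Sum>v\<in>Rp. of_real (k v) *
      (\<Sum>g\<in>G. of_real (resolvent n (g \<circ> reflect_along v)) * F (g x)))
     = (\<Sum>v\<in>Rp. of_real (k v) * E (reflect_along v x))"
  proof (intro sum.cong HOL.refl)
    fix v assume "v \<in> Rp"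
    then show "of_real (k v) * (\<Sum>g\<in>G. of_real (resolvent n (g \<circ> reflect_along v)) * F (g x)) =
        of_real (k v) * E (reflect_along v x)"
      using sum_G_comp_reflect[of v "\<lambda>g. of_real (resolvent n g) * F (g (reflect_along v x))"]
      by (simp add: E_def Rp_in_R)
  qed
  finally show ?thesis .
qed

primrec kernel_term :: "nat \<Rightarrow> real ^ 'n \<Rightarrow> real ^ 'n \<Rightarrow> complex" where
  "kernel_term 0 y x = 1"
| "kernel_term (Suc n) y x =
     (\<Sum>g\<in>G. of_real (resolvent (Suc n) g) * (\<i> * of_real (y \<bullet> g x) * kernel_term n y (g x)))"

lemma kernel_term_rec:
  "of_real (real (Suc n) + \<gamma>) * kernel_term (Suc n) y x =
     \<i> * of_real (y \<bullet> x) * kernel_term n y x +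
     (\<Sum>v\<in>Rp. of_real (k v) * kernel_term (Suc n) y (reflect_along v x))"
  using resolvent_inverts[of "Suc n" "\<lambda>x. \<i> * of_real (y \<bullet> x) * kernel_term n y x" x]
  by simp

lemma kernel_term_unique:
  assumes "\<And>x. of_real (real (Suc n) + \<gamma>) * f x =
     \<i> * of_real (y \<bullet> x) * kernel_term n y x + (\<Sum>v\<in>Rp. of_real (k v) * f (reflect_along v x))"
  shows "f x = kernel_term (Suc n) y x"
proof -
  have "f x - kernel_term (Suc n) y x = 0"
  proof (rule G_averaging_unique[where s = "real (Suc n)"])
    fix x
    show "of_real (real (Suc n) + \<gamma>) * (f x - kernel_term (Suc n) y x) = (\<Sum>v\<in>Rp. of_real (k v) *
      (f (reflect_along v x) - kernel_term (Suc n) y (reflect_along v x)))"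
      unfolding right_diff_distrib assms kernel_term_rec sum_subtractf by simp
  qed simp
  then show ?thesis by simp
qed

text \<open>As a function of \<open>x\<close>, the left side solves the recursion of
  \<open>kernel_term n y\<close>: the source term is invariant by induction, and the sum over the
  roots by \<open>sum_Rp_reflect\<close>. Uniqueness of the solution does the rest.\<close>

lemma kernel_term_reflect:
  assumes u: "u \<in> R"
  shows "kernel_term n (reflect_along u y) (reflect_along u x) = kernel_term n y x"
proof (induction n arbitrary: x)
  case (Suc n)
  show ?case
  proof (rule kernel_term_unique[where f = "\<lambda>x. kernel_term (Suc n) (reflect_along u y) (reflect_along u x)"])
    fix x
    have "(\<Sum>v\<in>Rp. of_real (k v) * kernel_term (Suc n) (reflect_along u y) (reflect_along v (reflect_along u x)))
       = (\<Sum>v\<in>Rp. k v *\<^sub>R (\<lambda>v. kernel_term (Suc n) (reflect_along u y)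
            (reflect_along v (reflect_along u x))) v)"
      by (simp add: scaleR_conv_of_real)
    also have "\<dots> = (\<Sum>v\<in>Rp. k v *\<^sub>R (\<lambda>v. kernel_term (Suc n) (reflect_along u y)
            (reflect_along v (reflect_along u x))) (reflect_along u v))"
      by (rule sum_Rp_reflect[OF u, symmetric]) simp
    finally show "of_real (real (Suc n) + \<gamma>) * kernel_term (Suc n) (reflect_along u y) (reflect_along u x) =
       \<i> * of_real (y \<bullet> x) * kernel_term n y x +
       (\<Sum>v\<in>Rp. of_real (k v) * kernel_term (Suc n) (reflect_along u y) (reflect_along u (reflect_along v x)))"
      unfolding kernel_term_rec[of n _ "reflect_along u x"]
      by (simp only: Suc inner_reflect_along reflect_along_conjugate[of u] scaleR_conv_of_real)
  qed
qed simp

text \<open>The recursion is an equation in the second argument. Equivariance carries each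
  reflection from one argument to the other, so the function with swapped arguments solves the same
  equation.\<close>

lemma kernel_term_commute: "kernel_term n x y = kernel_term n y x"
proof (induction n arbitrary: x y)
  case (Suc n)
  show ?case
  proof (rule kernel_term_unique[where f = "\<lambda>x. kernel_term (Suc n) x y"])
    fix x
    have "kernel_term (Suc n) x (reflect_along v y) = kernel_term (Suc n) (reflect_along v x) y"
      if "v \<in> Rp" for v
      using kernel_term_reflect[OF Rp_in_R[OF that], of "Suc n" "reflect_along v x" y] by simp
    then show "of_real (real (Suc n) + \<gamma>) * kernel_term (Suc n) x y =
       \<i> * of_real (y \<bullet> x) * kernel_term n y x +
       (\<Sum>v\<in>Rp. of_real (k v) * kernel_term (Suc n) (reflect_along v x) y)"
      unfolding kernel_term_rec[of n x y] by (simp add: Suc inner_commute)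
  qed
qed simp

lemma kernel_term_uminus: "kernel_term n (- y) x = kernel_term n y (- x)"
proof (induction n arbitrary: x)
  case (Suc n)
  show ?case
    unfolding kernel_term.simps
  proof (rule sum.cong[OF HOL.refl])
    fix g assume "g \<in> G"
    then have "g (- x) = - g x" by (rule linear_neg[OF reflection_group_linear])
    then show "of_real (resolvent (Suc n) g) * (\<i> * of_real (- y \<bullet> g x) * kernel_term n (- y) (g x)) =
        of_real (resolvent (Suc n) g) * (\<i> * of_real (y \<bullet> g (- x)) * kernel_term n y (g (- x)))"
      by (simp add: Suc)
  qed
qed simp

text \<open>The coefficients \<open>resolvent (Suc n)\<close> are nonnegative with total mass 1 / (n
  + 1), so each degree costs one Cauchy-Schwarz factor divided by n + 1.\<close>

lemma norm_kernel_term: "norm (kernel_term n y x) \<le> (norm x * norm y) ^ n / fact n"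
proof (induction n arbitrary: x)
  case (Suc n)
  let ?b = "norm x * norm y * ((norm x * norm y) ^ n / fact n)"
  have "norm (kernel_term (Suc n) y x) \<le> (\<Sum>g\<in>G. resolvent (Suc n) g * ?b)"
    unfolding kernel_term.simps
  proof (rule sum_norm_le)
    fix g assume g: "g \<in> G"
    have "\<bar>y \<bullet> g x\<bar> \<le> norm x * norm y"
      using Cauchy_Schwarz_ineq2[of y "g x"] by (simp add: reflection_group_norm[OF g] mult.commute)
    moreover have "norm (kernel_term n y (g x)) \<le> (norm x * norm y) ^ n / fact n"
      using Suc[of "g x"] by (simp add: reflection_group_norm[OF g])
    ultimately have "\<bar>y \<bullet> g x\<bar> * norm (kernel_term n y (g x)) \<le> ?b"
      by (intro mult_mono) auto
    then show "norm (of_real (resolvent (Suc n) g) * (\<i> * of_real (y \<bullet> g x) * kernel_term n y (g x)))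
        \<le> resolvent (Suc n) g * ?b"
      using resolvent_nonneg[OF _ g, of "Suc n"]
      by (simp add: norm_mult mult_left_mono del: times_divide_eq_right)
  qed
  also have "\<dots> = ?b / real (Suc n)"
    by (simp only: sum_distrib_right[symmetric] sum_resolvent[OF zero_less_Suc]) simp
  finally show ?case by (simp add: field_simps)
qed simp

end

section \<open>Dunkl operators and the eigenvalue equations\<close>

text \<open>Derivative bounds with summable constants make the differentiated series converge
  uniformly on \<open>S\<close>, as in the Weierstrass M-test.\<close>

lemma has_derivative_suminf:
  fixes f :: "nat \<Rightarrow> 'a::real_normed_vector \<Rightarrow> 'b::banach"
  assumes S: "open S" "convex S"
    and der: "\<And>n x. x \<in> S \<Longrightarrow> (f n has_derivative f' n x) (at x)"
    and bd: "\<And>n x h. x \<in> S \<Longrightarrow> norm (f' n x h) \<le> B n * norm h"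
    and B: "summable B" and x: "x \<in> S"
    and sm: "\<And>x. x \<in> S \<Longrightarrow> summable (\<lambda>n. f n x)"
  shows "((\<lambda>x. \<Sum>n. f n x) has_derivative (\<lambda>h. \<Sum>n. f' n x h)) (at x)"
proof -
  have sm': "summable (\<lambda>n. norm (f' n y h))" if "y \<in> S" for y h
    by (rule summable_comparison_test'[OF summable_mult2[OF B, of "norm h"]]) (use bd[OF that] in auto)
  have "\<exists>g. \<forall>y\<in>S. (\<lambda>n. f n y) sums g y \<and> (g has_derivative (\<lambda>h. \<Sum>n. f' n y h)) (at y within S)"
  proof (rule has_derivative_series[OF S(2), where f' = f' and x = x and l = "\<Sum>n. f n x"])
    show "(f n has_derivative f' n y) (at y within S)" if "y \<in> S" for n y
      using der[OF that] has_derivative_at_withinI by blast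
    fix e :: real assume e: "e > 0"
    obtain N where N: "\<And>n. n \<ge> N \<Longrightarrow> norm (\<Sum>i. B (i + n)) < e"
      using suminf_exist_split[OF e B] by auto
    show "\<forall>\<^sub>F n in sequentially. \<forall>y\<in>S. \<forall>h. norm ((\<Sum>i<n. f' i y h) - (\<Sum>n. f' n y h)) \<le> e * norm h"
      unfolding eventually_sequentially
    proof (intro exI allI impI ballI)
      fix n y h assume n: "N \<le> n" and y: "y \<in> S"
      have "norm ((\<Sum>i<n. f' i y h) - (\<Sum>n. f' n y h)) = norm (\<Sum>i. f' (i + n) y h)"
        using suminf_minus_initial_segment[OF summable_norm_cancel[OF sm'[OF y, of h]], of n]
        by (simp add: norm_minus_commute)
      also have "\<dots> \<le> (\<Sum>i. norm (f' (i + n) y h))"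
        by (rule summable_norm) (use summable_ignore_initial_segment[OF sm'[OF y]] in blast)
      also have "\<dots> \<le> (\<Sum>i. B (i + n) * norm h)"
        by (intro suminf_le bd y summable_mult2 summable_ignore_initial_segment[OF B]
          summable_ignore_initial_segment[OF sm'[OF y]])
      also have "\<dots> = (\<Sum>i. B (i + n)) * norm h"
        by (rule suminf_mult2[symmetric]) (rule summable_ignore_initial_segment[OF B])
      also have "\<dots> \<le> e * norm h"
        using N[OF n] by (intro mult_right_mono) auto
      finally show "norm ((\<Sum>i<n. f' i y h) - (\<Sum>n. f' n y h)) \<le> e * norm h" .
    qed
  qed (use x sm summable_sums in auto)
  then obtain g where g: "\<And>y. y \<in> S \<Longrightarrow> (\<lambda>n. f n y) sums g y"
      "(g has_derivative (\<lambda>h. \<Sum>n. f' n x h)) (at x)"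
    using x at_within_open[OF x S(1)] by fastforce
  show ?thesis
    by (rule has_derivative_transform_within_open[OF g(2) S(1) x]) (use g(1) sums_unique in blast)
qed

lemma dir_deriv_eq:
  assumes "(f has_derivative f') (at x)"
  shows "dir_deriv v f x = f' v"
proof -
  have "((\<lambda>t. f (x + t *\<^sub>R v)) has_derivative (\<lambda>t. f' (t *\<^sub>R v))) (at 0)"
    using assms by (auto intro!: derivative_eq_intros has_derivative_compose[where f = "\<lambda>t. x + t *\<^sub>R v" and g = f])
  then have "((\<lambda>t. f (x + t *\<^sub>R v)) has_vector_derivative f' v) (at 0)"
    using has_derivative_linear[OF assms]
    by (simp add: has_vector_derivative_def linear_cmul)
  then show ?thesis
    unfolding dir_deriv_def by (rule vector_derivative_at)
qed

lemma has_derivative_dir_deriv: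
  "f differentiable (at x) \<Longrightarrow> (f has_derivative (\<lambda>v. dir_deriv v f x)) (at x)"
  by (metis (no_types, lifting) differentiable_def dir_deriv_eq ext)

lemma bounded_linear_dir_deriv:
  "f differentiable (at x) \<Longrightarrow> bounded_linear (\<lambda>v. dir_deriv v f x)"
  using has_derivative_dir_deriv has_derivative_bounded_linear by blast

lemma linear_dir_deriv:
  "f differentiable (at x) \<Longrightarrow> linear (\<lambda>v. dir_deriv v f x)"
  by (simp add: bounded_linear.linear bounded_linear_dir_deriv)

lemma linear_axis_expansion:
  fixes f :: "real ^ 'n \<Rightarrow> complex"
  assumes f: "linear f"
  shows "f v = (\<Sum>j\<in>UNIV. of_real (v $ j) * f (axis j 1))"
proof -
  have "f v = f (\<Sum>j\<in>UNIV. v $ j *\<^sub>R axis j 1)"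
    using basis_expansion[of v] by (simp add: scalar_mult_eq_scaleR)
  also have "\<dots> = (\<Sum>j\<in>UNIV. v $ j *\<^sub>R f (axis j 1))"
    by (simp only: linear_sum[OF f] linear_cmul[OF f])
  finally show ?thesis by (simp only: scaleR_conv_of_real[where 'a = complex])
qed

lemma dir_deriv_comp_linear:
  assumes L: "bounded_linear L" and f: "f differentiable (at (L x))"
  shows "dir_deriv v (\<lambda>x. f (L x)) x = dir_deriv (L v) f (L x)"
  by (rule dir_deriv_eq)
    (rule has_derivative_compose[OF bounded_linear_imp_has_derivative[OF L] has_derivative_dir_deriv[OF f]])

lemma dunkl_quotient_cmult:
  "f differentiable (at x) \<Longrightarrow> dunkl_quotient v (\<lambda>x. c * f x) x = c * dunkl_quotient v f x"
  unfolding dunkl_quotient_def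
  by (subst dir_deriv_eq[OF has_derivative_mult_right[OF has_derivative_dir_deriv]])
    (auto simp: right_diff_distrib diff_divide_distrib)

lemma dunkl_quotient_add:
  "f differentiable (at x) \<Longrightarrow> g differentiable (at x) \<Longrightarrow>
    dunkl_quotient v (\<lambda>x. f x + g x) x = dunkl_quotient v f x + dunkl_quotient v g x"
  unfolding dunkl_quotient_def
  by (subst dir_deriv_eq[OF has_derivative_add[OF has_derivative_dir_deriv has_derivative_dir_deriv]])
    (auto simp: diff_divide_distrib add_divide_distrib ring_distribs)

lemma dunkl_quotient_uminus:
  assumes "f differentiable (at x)"
  shows "dunkl_quotient (- v) f x = - dunkl_quotient v f x"
  using linear_neg[OF linear_dir_deriv[OF assms], of v]
  by (simp add: dunkl_quotient_def)

lemma dunkl_quotient_reflect: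
  assumes f: "f differentiable (at (reflect_along u x))"
  shows "dunkl_quotient v (\<lambda>x. f (reflect_along u x)) x =
    dunkl_quotient (reflect_along u v) f (reflect_along u x)"
  unfolding dunkl_quotient_def dir_deriv_comp_linear[OF reflect_along_bounded_linear f]
  by (simp add: inner_reflect_along reflect_along_conjugate[of u v x])

text \<open>A twisted product rule: in one of the two terms the second factor is taken at the
  reflected point. On the hyperplane the reflection fixes \<open>x\<close> and the classical product
  rule remains.\<close>

lemma dunkl_quotient_mult:
  assumes l: "l differentiable (at x)" and f: "f differentiable (at x)"
  shows "dunkl_quotient v (\<lambda>x. l x * f x) x =
    l x * dunkl_quotient v f x + dunkl_quotient v l x * f (reflect_along v x)"
proof (cases "v \<bullet> x = 0")
  case True
  have "dir_deriv v (\<lambda>x. l x * f x) x = l x * dir_deriv v f x + dir_deriv v l x * f x"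
    by (rule dir_deriv_eq[OF has_derivative_mult[OF has_derivative_dir_deriv[OF l] has_derivative_dir_deriv[OF f]]])
  with True show ?thesis
    by (simp add: dunkl_quotient_def reflect_along_orthogonal distrib_left mult_ac)
next
  case False
  then show ?thesis by (simp add: dunkl_quotient_def field_simps)
qed

lemma dunkl_quotient_linear:
  assumes "v \<noteq> 0"
  shows "dunkl_quotient v (\<lambda>x. of_real (y \<bullet> x)) x = of_real (2 * (v \<bullet> y) / (norm v)\<^sup>2)"
proof (cases "v \<bullet> x = 0")
  case True
  have "dir_deriv v (\<lambda>x. of_real (y \<bullet> x)) x = of_real (y \<bullet> v)"
    by (rule dir_deriv_eq) (auto intro!: derivative_eq_intros)
  with True show ?thesis
    by (simp add: dunkl_quotient_def inner_commute)
next
  case False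
  have "y \<bullet> x - y \<bullet> reflect_along v x = 2 * (v \<bullet> x) / (norm v)\<^sup>2 * (y \<bullet> v)"
    by (simp add: reflect_along_def inner_diff_right inner_commute)
  then have "(of_real (y \<bullet> x) - of_real (y \<bullet> reflect_along v x) :: complex) = of_real (2 * (v \<bullet> x) / (norm v)\<^sup>2 * (y \<bullet> v))"
    by (metis of_real_diff)
  with False show ?thesis
    by (simp add: dunkl_quotient_def inner_commute)
qed

context dunkl
begin

definition T :: "real ^ 'n \<Rightarrow> (real ^ 'n \<Rightarrow> complex) \<Rightarrow> real ^ 'n \<Rightarrow> complex" where
  "T a f x = dir_deriv a f x + (\<Sum>v\<in>Rp. of_real (k v * (v \<bullet> a)) * dunkl_quotient v f x)"

lemma dunkl_operator_eq_T: "dunkl_operator Rp k j = T (axis j 1)"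
  by (simp add: fun_eq_iff dunkl_operator_def T_def)

lemma linear_T: 
  assumes "f differentiable (at x)"
  shows "linear (\<lambda>a. T a f x)"
proof -
  have "linear (\<lambda>a. \<Sum>v\<in>Rp. of_real (k v * (v \<bullet> a)) * dunkl_quotient v f x)"
    by (intro linearI) (simp_all add: inner_add_right ring_distribs sum.distrib scaleR_conv_of_real[where 'a = complex] sum_distrib_left mult_ac)
  with linear_dir_deriv[OF assms] show ?thesis
    unfolding T_def by (rule linear_compose_add)
qed

lemma T_cmult: "f differentiable (at x) \<Longrightarrow> T a (\<lambda>x. c * f x) x = c * T a f x"
  unfolding T_def
  by (subst dir_deriv_eq[OF has_derivative_mult_right[OF has_derivative_dir_deriv]])
    (auto simp: dunkl_quotient_cmult ring_distribs sum_distrib_left mult_ac)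

lemma T_add: "f differentiable (at x) \<Longrightarrow> g differentiable (at x) \<Longrightarrow>
    T a (\<lambda>x. f x + g x) x = T a f x + T a g x"
  unfolding T_def
  by (subst dir_deriv_eq[OF has_derivative_add[OF has_derivative_dir_deriv has_derivative_dir_deriv]])
    (auto simp: dunkl_quotient_add ring_distribs sum.distrib)

lemma T_const: "T a (\<lambda>x. c) x = 0"
proof -
  have "dir_deriv v (\<lambda>x. c) x = 0" for v
    by (rule dir_deriv_eq) (rule has_derivative_const)
  then show ?thesis
    by (auto simp: T_def dunkl_quotient_def intro!: sum.neutral)
qed

lemma T_diff: "f differentiable (at x) \<Longrightarrow> g differentiable (at x) \<Longrightarrow>
    T a (\<lambda>x. f x - g x) x = T a f x - T a g x"
  using T_add[of f x "\<lambda>x. (- 1) * g x" a] T_cmult[of g x a "- 1"] by simp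

lemma T_sum:
  assumes "finite A" "\<And>i. i \<in> A \<Longrightarrow> f i differentiable (at x)"
  shows "T a (\<lambda>x. \<Sum>i\<in>A. f i x) x = (\<Sum>i\<in>A. T a (f i) x)"
  using assms
proof (induction A rule: finite_induct)
  case empty
  then show ?case by (simp add: T_const)
next
  case (insert i A)
  then show ?case
    by (simp add: T_add differentiable_sum)
qed

text \<open>The coefficient and the quotient are both odd in the root, so their product is even and
  the sum over \<open>Rp\<close> may be reindexed by the reflection.\<close>

lemma T_reflect:
  assumes u: "u \<in> R" and f: "f differentiable (at (reflect_along u x))"
  shows "T a (\<lambda>x. f (reflect_along u x)) x = T (reflect_along u a) f (reflect_along u x)"
proof -
  let ?F = "\<lambda>w. of_real (w \<bullet> reflect_along u a) * dunkl_quotient w f (reflect_along u x)"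
  have "(\<Sum>v\<in>Rp. of_real (k v * (v \<bullet> a)) * dunkl_quotient v (\<lambda>x. f (reflect_along u x)) x)
     = (\<Sum>v\<in>Rp. k v *\<^sub>R ?F (reflect_along u v))"
    by (simp add: dunkl_quotient_reflect[OF f] inner_reflect_along scaleR_conv_of_real[where 'a = complex] mult.assoc)
  also have "\<dots> = (\<Sum>v\<in>Rp. k v *\<^sub>R ?F v)"
    by (rule sum_Rp_reflect[OF u]) (simp add: dunkl_quotient_uminus[OF f])
  finally show ?thesis
    unfolding T_def by (simp add: dir_deriv_comp_linear[OF reflect_along_bounded_linear f] scaleR_conv_of_real[where 'a = complex] mult.assoc)
qed

text \<open>The commutator of a Dunkl operator with multiplication by a linear form is not a scalar:
  the twisted product rule adds one reflection for each root.\<close>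

lemma T_linear_mult:
  assumes f: "f differentiable (at x)"
  shows "T a (\<lambda>x. of_real (y \<bullet> x) * f x) x = of_real (y \<bullet> a) * f x + of_real (y \<bullet> x) * T a f x +
    (\<Sum>v\<in>Rp. of_real (k v * (2 * (v \<bullet> a) * (v \<bullet> y) / (norm v)\<^sup>2)) * f (reflect_along v x))"
proof -
  have l: "((\<lambda>x. of_real (y \<bullet> x) :: complex) has_derivative (\<lambda>h. of_real (y \<bullet> h))) (at x)"
    by (auto intro!: derivative_eq_intros)
  then have l': "(\<lambda>x. of_real (y \<bullet> x) :: complex) differentiable (at x)"
    by (auto simp: differentiable_def)
  have "dir_deriv a (\<lambda>x. of_real (y \<bullet> x) * f x) x = of_real (y \<bullet> x) * dir_deriv a f x + of_real (y \<bullet> a) * f x"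
    by (rule dir_deriv_eq[OF has_derivative_mult[OF l has_derivative_dir_deriv[OF f]]])
  moreover have "of_real (k v * (v \<bullet> a)) * dunkl_quotient v (\<lambda>x. of_real (y \<bullet> x) * f x) x =
      of_real (y \<bullet> x) * (of_real (k v * (v \<bullet> a)) * dunkl_quotient v f x) +
      of_real (k v * (2 * (v \<bullet> a) * (v \<bullet> y) / (norm v)\<^sup>2)) * f (reflect_along v x)" if "v \<in> Rp" for v
    unfolding dunkl_quotient_mult[OF l' f] dunkl_quotient_linear[OF Rp_nonzero[OF that]]
    by (simp add: algebra_simps)
  ultimately show ?thesis
    by (simp add: T_def sum.distrib sum_distrib_left ring_distribs)
qed

text \<open>In the direction \<open>x\<close> the factor \<open>v \<bullet> x\<close> of the
  coefficient cancels the denominator of the quotient; on the hyperplane both sides of this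
  cancellation are zero.\<close>

lemma T_radial:
  assumes "f differentiable (at x)"
  shows "T x f x = dir_deriv x f x + (\<Sum>v\<in>Rp. of_real (k v) * (f x - f (reflect_along v x)))"
proof -
  have "of_real (v \<bullet> x) * dunkl_quotient v f x = f x - f (reflect_along v x)" for v
    by (auto simp: dunkl_quotient_def reflect_along_orthogonal)
  then show ?thesis by (simp add: T_def mult.assoc)
qed

lemma bounded_linear_G: "g \<in> G \<Longrightarrow> bounded_linear g"
  using reflection_group_linear linear_conv_bounded_linear by blast

lemma kernel_term_has_derivative_step:
  assumes "\<And>x. kernel_term n y differentiable (at x)"
  shows "(kernel_term (Suc n) y has_derivative (\<lambda>a. \<Sum>g\<in>G. of_real (resolvent (Suc n) g) *
      (\<i> * of_real (y \<bullet> g x) * dir_deriv (g a) (kernel_term n y) (g x)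
        + \<i> * of_real (y \<bullet> g a) * kernel_term n y (g x)))) (at x)"
proof -
  have eq: "kernel_term (Suc n) y = (\<lambda>x. \<Sum>g\<in>G. of_real (resolvent (Suc n) g) * (\<i> * of_real (y \<bullet> g x) * kernel_term n y (g x)))"
    by (simp add: fun_eq_iff)
  show ?thesis
    unfolding eq
  proof (rule has_derivative_sum)
    fix g assume g: "g \<in> G"
    have g': "(g has_derivative g) (at x)"
      by (rule bounded_linear_imp_has_derivative[OF bounded_linear_G[OF g]])
    have 1: "((\<lambda>x. kernel_term n y (g x)) has_derivative (\<lambda>a. dir_deriv (g a) (kernel_term n y) (g x))) (at x)"
      by (rule has_derivative_compose[OF g' has_derivative_dir_deriv[OF assms]])
    have 2: "((\<lambda>x. \<i> * of_real (y \<bullet> g x)) has_derivative (\<lambda>a. \<i> * of_real (y \<bullet> g a))) (at x)"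
      by (intro has_derivative_mult_right has_derivative_of_real has_derivative_inner_right g')
    show "((\<lambda>x. of_real (resolvent (Suc n) g) * (\<i> * of_real (y \<bullet> g x) * kernel_term n y (g x)))
       has_derivative (\<lambda>a. of_real (resolvent (Suc n) g) *
      (\<i> * of_real (y \<bullet> g x) * dir_deriv (g a) (kernel_term n y) (g x)
        + \<i> * of_real (y \<bullet> g a) * kernel_term n y (g x)))) (at x)"
      by (rule has_derivative_mult_right[OF has_derivative_mult[OF 2 1]])
  qed
qed

lemma differentiable_kernel_term: "kernel_term n y differentiable (at x)"
proof (induction n arbitrary: x)
  case 0
  have "kernel_term 0 y = (\<lambda>x. 1)" by (simp add: fun_eq_iff)
  then show ?case by simp
next
  case (Suc n)
  show ?case
    using kernel_term_has_derivative_step[OF Suc] unfolding differentiable_def by blast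
qed

text \<open>The majorant is |a| |y| times the derivative of z^n / n! at z = |x| |y|. In degree 0 the
  factor \<open>real n\<close> is zero, so the truncated exponent n - 1 does no harm.\<close>

lemma norm_dir_deriv_kernel_term:
  "norm (dir_deriv a (kernel_term n y) x) \<le> norm a * norm y * (real n * (norm x * norm y) ^ (n - 1) / fact n)"
proof (induction n arbitrary: x a)
  case 0
  have "kernel_term 0 y = (\<lambda>x. 1)" by (simp add: fun_eq_iff)
  then have "dir_deriv a (kernel_term 0 y) x = 0"
    by (metis dir_deriv_eq has_derivative_const)
  then show ?case by (simp del: kernel_term.simps)
next
  case (Suc n)
  define z where "z = norm x * norm y"
  let ?b = "norm a * norm y * (real (Suc n) * z ^ n / fact n)"
  let ?d = "\<lambda>g. of_real (resolvent (Suc n) g) * (\<i> * of_real (y \<bullet> g x) * dir_deriv (g a) (kernel_term n y) (g x)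
      + \<i> * of_real (y \<bullet> g a) * kernel_term n y (g x))"
  have "dir_deriv a (kernel_term (Suc n) y) x = (\<Sum>g\<in>G. ?d g)"
    by (rule dir_deriv_eq[OF kernel_term_has_derivative_step[OF differentiable_kernel_term]])
  also have "norm \<dots> \<le> (\<Sum>g\<in>G. resolvent (Suc n) g * ?b)"
  proof (rule sum_norm_le)
    fix g assume g: "g \<in> G"
    note ng = reflection_group_norm[OF g]
    have 1: "\<bar>y \<bullet> g x\<bar> \<le> z" "\<bar>y \<bullet> g a\<bar> \<le> norm a * norm y"
      using Cauchy_Schwarz_ineq2[of y "g x"] Cauchy_Schwarz_ineq2[of y "g a"]
      by (simp_all add: ng z_def mult.commute)
    have 2: "norm (kernel_term n y (g x)) \<le> z ^ n / fact n"
      using norm_kernel_term[of n y "g x"] by (simp add: ng z_def)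
    have 3: "norm (dir_deriv (g a) (kernel_term n y) (g x)) \<le> norm a * norm y * (real n * z ^ (n - 1) / fact n)"
      using Suc[of "g a" "g x"] by (simp add: ng z_def)
    have z: "z \<ge> 0" by (simp add: z_def)
    have "norm (\<i> * of_real (y \<bullet> g x) * dir_deriv (g a) (kernel_term n y) (g x)
      + \<i> * of_real (y \<bullet> g a) * kernel_term n y (g x))
      \<le> \<bar>y \<bullet> g x\<bar> * norm (dir_deriv (g a) (kernel_term n y) (g x)) + \<bar>y \<bullet> g a\<bar> * norm (kernel_term n y (g x))"
      by (rule norm_triangle_le) (simp add: norm_mult)
    also have "\<dots> \<le> z * (norm a * norm y * (real n * z ^ (n - 1) / fact n)) + norm a * norm y * (z ^ n / fact n)"
      by (intro add_mono mult_mono 1 2 3 z) auto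
    also have "z * (norm a * norm y * (real n * z ^ (n - 1) / fact n)) = norm a * norm y * (real n * z ^ n / fact n)"
      by (cases n) (auto simp: algebra_simps)
    also have "\<dots> + norm a * norm y * (z ^ n / fact n) = ?b"
      by (simp add: algebra_simps add_divide_distrib)
    finally show "norm (?d g) \<le> resolvent (Suc n) g * ?b"
      using resolvent_nonneg[OF _ g, of "Suc n"]
      by (simp only: norm_mult norm_of_real) (simp add: mult_left_mono del: times_divide_eq_right)
  qed
  also have "\<dots> = ?b / real (Suc n)"
    by (simp only: sum_distrib_right[symmetric] sum_resolvent[OF zero_less_Suc]) simp
  also have "\<dots> = norm a * norm y * (real (Suc n) * z ^ (Suc n - 1) / fact (Suc n))"
    by (simp add: field_simps)
  finally show ?case by (simp only: z_def)
qed

text \<open>By equivariance of the Dunkl operators, \<open>D\<^sub>a = T\<^sub>a E\<^sub>n\<^sub>+\<^sub>1 - \<i> \<langle>y, a\<rangle> E\<^sub>n\<close> satisfies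
  \<open>(n + 1 + \<gamma>) D\<^sub>a(x) = \<Sum>\<^sub>v k\<^sub>v D\<^sub>\<sigma>\<^sub>a(\<sigma> x)\<close> with \<open>\<sigma> = \<sigma>\<^sub>v\<close>, so it vanishes by the maximum principle.
  Commutativity of the Dunkl operators is not needed.\<close>

lemma T_kernel_term_step:
  assumes H: "\<And>a x. \<i> * of_real (y \<bullet> x) * T a (kernel_term n y) x =
      \<i> * of_real (y \<bullet> a) * (of_real (real n + \<gamma>) * kernel_term n y x
        - (\<Sum>v\<in>Rp. of_real (k v) * kernel_term n y (reflect_along v x)))"
  shows "T a (kernel_term (Suc n) y) x = \<i> * of_real (y \<bullet> a) * kernel_term n y x"
proof -
  define e0 where "e0 = kernel_term n y"
  define e1 where "e1 = kernel_term (Suc n) y"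
  define s :: real where "s = real (Suc n) + \<gamma>"
  define D where "D a x = T a e1 x - \<i> * of_real (y \<bullet> a) * e0 x" for a x
  have diff: "e0 differentiable (at x)" "e1 differentiable (at x)" for x
    unfolding e0_def e1_def by (rule differentiable_kernel_term)+
  have diff_l: "(\<lambda>x. of_real (y \<bullet> x) * e0 x) differentiable (at x)" for x
    using has_derivative_mult[OF has_derivative_of_real[OF has_derivative_inner_right[OF has_derivative_ident]]
        has_derivative_dir_deriv[OF diff(1)]]
    unfolding differentiable_def by blast
  have diff_il: "(\<lambda>x. \<i> * (of_real (y \<bullet> x) * e0 x)) differentiable (at x)" for x
    using has_derivative_mult_right[OF has_derivative_dir_deriv[OF diff_l]]
    unfolding differentiable_def by blast
  have diff_r: "(\<lambda>x. e1 (reflect_along v x)) differentiable (at x)" for v x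
    using has_derivative_compose[OF bounded_linear_imp_has_derivative[OF reflect_along_bounded_linear]
        has_derivative_dir_deriv[OF diff(2)]]
    unfolding differentiable_def by blast
  have diff_kr: "(\<lambda>x. of_real (k v) * e1 (reflect_along v x)) differentiable (at x)" for v x
    using has_derivative_mult_right[OF has_derivative_dir_deriv[OF diff_r]]
    unfolding differentiable_def by blast
  have rec: "(\<lambda>x. of_real s * e1 x) = (\<lambda>x. \<i> * (of_real (y \<bullet> x) * e0 x) +
      (\<Sum>v\<in>Rp. of_real (k v) * e1 (reflect_along v x)))"
    unfolding s_def e0_def e1_def using kernel_term_rec[of n y] by (simp only: mult.assoc)
  have T_rec: "of_real s * T a e1 x = \<i> * (of_real (y \<bullet> a) * e0 x + of_real (y \<bullet> x) * T a e0 x +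
      (\<Sum>v\<in>Rp. of_real (k v * (2 * (v \<bullet> a) * (v \<bullet> y) / (norm v)\<^sup>2)) * e0 (reflect_along v x)))
      + (\<Sum>v\<in>Rp. of_real (k v) * T (reflect_along v a) e1 (reflect_along v x))" for a x
  proof -
    have "of_real s * T a e1 x = T a (\<lambda>x. of_real s * e1 x) x"
      by (rule T_cmult[OF diff(2), symmetric])
    also have "\<dots> = T a (\<lambda>x. \<i> * (of_real (y \<bullet> x) * e0 x)) x
        + (\<Sum>v\<in>Rp. T a (\<lambda>x. of_real (k v) * e1 (reflect_along v x)) x)"
      unfolding rec
      by (subst T_add[OF diff_il differentiable_sum], use finite_Rp diff_kr in blast, use diff_kr in blast)
        (simp only: T_sum[OF finite_Rp diff_kr])
    also have "(\<Sum>v\<in>Rp. T a (\<lambda>x. of_real (k v) * e1 (reflect_along v x)) x) =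
        (\<Sum>v\<in>Rp. of_real (k v) * T (reflect_along v a) e1 (reflect_along v x))"
      by (intro sum.cong HOL.refl) (simp add: T_cmult diff_r T_reflect diff Rp_in_R)
    finally show ?thesis
      by (simp only: T_cmult[OF diff_l] T_linear_mult[OF diff(1)])
  qed
  have D_eq: "of_real s * D a x = (\<Sum>v\<in>Rp. of_real (k v) * D (reflect_along v a) (reflect_along v x))" for a x
  proof -
    \<comment> \<open>The reflection shifts <y, a> by exactly the coefficient \<open>q\<close> of
      the commutator, so these terms match the commutator terms in \<open>T_rec\<close>.\<close>
    have split: "of_real (k v) * D (reflect_along v a) (reflect_along v x) =
       of_real (k v) * T (reflect_along v a) e1 (reflect_along v x)
       + \<i> * (of_real (k v * (2 * (v \<bullet> a) * (v \<bullet> y) / (norm v)\<^sup>2)) * e0 (reflect_along v x))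
       - \<i> * of_real (y \<bullet> a) * (of_real (k v) * e0 (reflect_along v x))" for v
    proof -
      define q where "q = 2 * (v \<bullet> a) * (v \<bullet> y) / (norm v)\<^sup>2"
      have "y \<bullet> reflect_along v a = y \<bullet> a - q"
        by (simp add: reflect_along_def inner_diff_right inner_commute q_def)
      then show ?thesis
        unfolding D_def q_def[symmetric] by (simp only: of_real_diff of_real_mult) (simp add: algebra_simps)
    qed
    \<comment> \<open>The hypothesis removes the derivative of \<open>e0\<close>. With s = n + 1 +
      \<gamma> the remaining multiples of \<open>e0 x\<close> then cancel.\<close>
    have H': "\<i> * (of_real (y \<bullet> x) * T a e0 x) = \<i> * of_real (y \<bullet> a) * (of_real (real n + \<gamma>) * e0 x)
        - \<i> * of_real (y \<bullet> a) * (\<Sum>v\<in>Rp. of_real (k v) * e0 (reflect_along v x))"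
      using H[of x a] by (simp only: e0_def right_diff_distrib mult.assoc)
    show ?thesis
      unfolding split sum.distrib sum_subtractf
      unfolding D_def right_diff_distrib T_rec distrib_left H' sum_distrib_left[symmetric]
      by (simp add: s_def algebra_simps)
  qed
  have s: "s > 0" using \<gamma>_nonneg by (simp add: s_def)
  have "norm (D (id a) (id x)) \<le> 0"
  proof (rule G_max_principle[OF _ _ id_in_G, where \<psi> = "\<lambda>g. norm (D (g a) (g x))" and s = "real (Suc n)"])
    fix g assume "g \<in> G"
    have "(real (Suc n) + \<gamma>) * norm (D (g a) (g x)) = norm (of_real s * D (g a) (g x))"
      using s by (simp add: norm_mult) (simp add: s_def)
    also have "\<dots> \<le> (\<Sum>v\<in>Rp. norm (of_real (k v) * D (reflect_along v (g a)) (reflect_along v (g x))))"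
      unfolding D_eq by (rule norm_sum)
    also have "\<dots> = (\<Sum>v\<in>Rp. k v * norm (D ((reflect_along v \<circ> g) a) ((reflect_along v \<circ> g) x)))"
      by (intro sum.cong) (auto simp: norm_mult k_Rp)
    finally show "(real (Suc n) + \<gamma>) * norm (D (g a) (g x)) \<le>
        (\<Sum>v\<in>Rp. k v * norm (D ((reflect_along v \<circ> g) a) ((reflect_along v \<circ> g) x)))" .
  qed simp
  then show ?thesis by (simp add: D_def e0_def e1_def)
qed

lemma T_kernel_term_0: "T a (kernel_term 0 y) x = 0"
proof -
  have "kernel_term 0 y = (\<lambda>x. 1)" by (simp add: fun_eq_iff)
  then show ?thesis using T_const by metis
qed

lemma T_kernel_term: "T a (kernel_term (Suc n) y) x = \<i> * of_real (y \<bullet> a) * kernel_term n y x"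
proof (induction n arbitrary: a x)
  case 0
  \<comment> \<open>In degree 0 both sides of the hypothesis vanish: Dunkl operators annihilate
    constants, and \<gamma> is the sum of the multiplicities.\<close>
  show ?case
    by (rule T_kernel_term_step) (simp add: T_kernel_term_0 \<gamma>_def del: kernel_term.simps, simp)
next
  case (Suc n)
  \<comment> \<open>By induction the left side of the hypothesis is i<y, x> times i<y, a> times the
    term of degree n; dividing out i<y, a> leaves the radial recursion.\<close>
  show ?case
    by (rule T_kernel_term_step) (simp only: Suc kernel_term_rec, simp)
qed

section \<open>The Dunkl kernel as a convergent series\<close>

definition kernel :: "real ^ 'n \<Rightarrow> real ^ 'n \<Rightarrow> complex" where
  "kernel y x = (\<Sum>n. kernel_term n y x)"

lemma summable_norm_kernel_term: "summable (\<lambda>n. norm (kernel_term n y x))"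
  by (rule summable_comparison_test'[OF summable_exp_generic[of "norm x * norm y"]])
    (simp add: norm_kernel_term[unfolded divide_inverse] mult.commute[of "inverse _"])

lemma summable_kernel_term: "summable (\<lambda>n. kernel_term n y x)"
  by (rule summable_norm_cancel[OF summable_norm_kernel_term])

lemma kernel_commute: "kernel x y = kernel y x"
  by (simp add: kernel_def kernel_term_commute[of _ x y])

lemma kernel_uminus: "kernel (- y) x = kernel y (- x)"
  by (simp add: kernel_def kernel_term_uminus)

lemma kernel_term_at_0: "kernel_term n y 0 = (if n = 0 then 1 else 0)"
  using norm_kernel_term[of n y 0] by (cases n) auto

lemma kernel_0 [simp]: "kernel y 0 = 1"
  using suminf_finite[of "{0}" "\<lambda>n. kernel_term n y 0"] by (simp add: kernel_def kernel_term_at_0 del: kernel_term.simps)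

lemma kernel_0' [simp]: "kernel 0 x = 1"
  using kernel_commute[of 0 x] by simp

text \<open>The termwise gradient bounds are uniform on the ball of radius |x| + 1 about the origin,
  where they add up to an exponential series.\<close>

lemma kernel_has_derivative:
  "(kernel y has_derivative (\<lambda>a. \<Sum>n. dir_deriv a (kernel_term n y) x)) (at x)"
proof -
  define r where "r = norm x + 1"
  define B where "B n = norm y * (real n * (r * norm y) ^ (n - 1) / fact n)" for n
  have "((\<lambda>x. \<Sum>n. kernel_term n y x) has_derivative (\<lambda>a. \<Sum>n. dir_deriv a (kernel_term n y) x)) (at x)"
  proof (rule has_derivative_suminf[where S = "ball 0 r" and B = B])
    show "(kernel_term n y has_derivative (\<lambda>a. dir_deriv a (kernel_term n y) x)) (at x)" for n x
      by (rule has_derivative_dir_deriv[OF differentiable_kernel_term])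
    show "norm (dir_deriv a (kernel_term n y) x) \<le> B n * norm a" if "x \<in> ball 0 r" for n x a
    proof -
      have "(norm x * norm y) ^ (n - 1) \<le> (r * norm y) ^ (n - 1)"
        using that by (intro power_mono mult_right_mono) auto
      then have "norm a * norm y * (real n * (norm x * norm y) ^ (n - 1) / fact n) \<le>
          norm a * norm y * (real n * (r * norm y) ^ (n - 1) / fact n)"
        by (intro mult_left_mono divide_right_mono) auto
      with norm_dir_deriv_kernel_term[of a n y x] show ?thesis
        by (simp add: B_def mult_ac)
    qed
    have "summable (\<lambda>n. norm y * ((r * norm y) ^ n /\<^sub>R fact n))"
      by (intro summable_mult summable_exp_generic)
    also have "(\<lambda>n. norm y * ((r * norm y) ^ n /\<^sub>R fact n)) = (\<lambda>n. B (Suc n))"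
    proof
      fix n
      have "real (Suc n) * z / fact (Suc n) = z / fact n" for z :: real
        unfolding fact_Suc by simp
      then show "norm y * ((r * norm y) ^ n /\<^sub>R fact n) = B (Suc n)"
        unfolding B_def by (simp add: divide_inverse mult.commute)
    qed
    finally show "summable B" by (subst (asm) summable_Suc_iff)
  qed (auto simp: r_def summable_kernel_term)
  then show ?thesis by (simp add: kernel_def[abs_def])
qed

lemma differentiable_kernel: "kernel y differentiable (at x)"
  using kernel_has_derivative unfolding differentiable_def by blast

lemma dir_deriv_kernel: "(\<lambda>n. dir_deriv a (kernel_term n y) x) sums dir_deriv a (kernel y) x"
proof -
  have "summable (\<lambda>n. dir_deriv a (kernel_term n y) x)"
  proof (rule summable_norm_cancel, subst summable_Suc_iff[symmetric], rule summable_comparison_test')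
    show "summable (\<lambda>n. norm a * norm y * ((norm x * norm y) ^ n /\<^sub>R fact n))"
      by (intro summable_mult summable_exp_generic)
    fix n
    have "real (Suc n) * z / fact (Suc n) = z / fact n" for z :: real
      unfolding fact_Suc by simp
    note this [simp]
    show "norm (norm (dir_deriv a (kernel_term (Suc n) y) x)) \<le> norm a * norm y * ((norm x * norm y) ^ n /\<^sub>R fact n)"
      using norm_dir_deriv_kernel_term[of a "Suc n" y x]
      by (simp add: scaleR_conv_of_real[where 'a = real] divide_inverse_commute[symmetric]
          del: kernel_term.simps of_nat_Suc fact_Suc)
  qed
  then show ?thesis
    using dir_deriv_eq[OF kernel_has_derivative, of a y x] by (simp add: summable_sums)
qed

text \<open>The term of degree 0 is annihilated and every other one is sent to a multiple of its
  predecessor, so a shift of the summation index reproduces the kernel.\<close>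

lemma T_kernel: "T a (kernel y) x = \<i> * of_real (y \<bullet> a) * kernel y x"
proof -
  have sums_k: "(\<lambda>n. kernel_term n y x) sums kernel y x" for x
    unfolding kernel_def by (rule summable_sums[OF summable_kernel_term])
  have "(\<lambda>n. dunkl_quotient v (kernel_term n y) x) sums dunkl_quotient v (kernel y) x" for v
    unfolding dunkl_quotient_def
    by (cases "v \<bullet> x = 0") (auto intro!: sums_mult dir_deriv_kernel sums_divide sums_diff sums_k simp del: kernel_term.simps)
  then have "(\<lambda>n. T a (kernel_term n y) x) sums T a (kernel y) x"
    unfolding T_def by (intro sums_add dir_deriv_kernel sums_sum sums_mult)
  then have "(\<lambda>n. T a (kernel_term (Suc n) y) x) sums T a (kernel y) x"
    by (subst sums_Suc_iff) (simp add: T_kernel_term_0 del: kernel_term.simps)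
  moreover have "(\<lambda>n. T a (kernel_term (Suc n) y) x) sums (\<i> * of_real (y \<bullet> a) * kernel y x)"
    unfolding T_kernel_term by (intro sums_mult sums_k)
  ultimately show ?thesis by (rule sums_unique2)
qed

end

section \<open>Real analyticity\<close>

definition monomial :: "('n \<Rightarrow> nat) \<Rightarrow> real ^ 'n \<Rightarrow> real" where
  "monomial m h = (\<Prod>i\<in>UNIV. (h $ i) ^ m i)"

lemma abs_monomial_le:
  assumes "\<And>i. \<bar>h $ i\<bar> \<le> t"
  shows "\<bar>monomial m h\<bar> \<le> t ^ (\<Sum>i\<in>UNIV. m i)"
proof -
  have "\<bar>monomial m h\<bar> = (\<Prod>i\<in>UNIV. \<bar>h $ i\<bar> ^ m i)"
    by (simp add: monomial_def abs_prod power_abs)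
  also have "\<dots> \<le> (\<Prod>i\<in>UNIV. t ^ m i)"
    using assms by (intro prod_mono) (auto intro: power_mono)
  finally show ?thesis by (simp add: power_sum)
qed

lemma monomial_const: "monomial m (\<chi> i. t) = t ^ (\<Sum>i\<in>UNIV. m i)"
  by (simp add: monomial_def power_sum)

lemma monomial_diff: "monomial m (y - x) = (\<Prod>i\<in>UNIV. (y $ i - x $ i) ^ m i)"
  by (simp add: monomial_def)

lemma monomial_0 [simp]: "monomial (\<lambda>_. 0) h = 1"
  by (simp add: monomial_def)

lemma monomial_Suc: "monomial (m(i := Suc (m i))) h = h $ i * monomial m h"
proof -
  have "(\<Prod>j\<in>UNIV - {i}. (h $ j) ^ (m(i := Suc (m i))) j) = (\<Prod>j\<in>UNIV - {i}. (h $ j) ^ m j)"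
    by (rule prod.cong) auto
  then show ?thesis
    by (simp add: monomial_def prod.remove[of UNIV i])
qed

lemma differentiable_monomial: "(\<lambda>x. complex_of_real (monomial m (x - x0))) differentiable (at x)"
proof -
  have "((\<lambda>x. monomial m (x - x0)) has_derivative (\<lambda>d. \<Sum>i\<in>UNIV. (real (m i) * (((x - x0) $ i) ^ (m i - 1)) * d $ i) *
      (\<Prod>j\<in>UNIV - {i}. ((x - x0) $ j) ^ m j))) (at x)"
    unfolding monomial_def
    by (rule has_derivative_eq_rhs, rule has_derivative_prod)
      (auto intro!: derivative_eq_intros bounded_linear_imp_has_derivative bounded_linear_vec_nth simp: mult_ac)
  then show ?thesis
    unfolding differentiable_def using has_derivative_of_real by blast
qed

lemma finite_multi_index_bounded: "finite {m :: 'n::finite \<Rightarrow> nat. (\<Sum>i\<in>UNIV. m i) \<le> N}"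
proof (rule finite_subset)
  show "{m :: 'n \<Rightarrow> nat. (\<Sum>i\<in>UNIV. m i) \<le> N} \<subseteq> PiE UNIV (\<lambda>_. {..N})"
  proof clarify
    fix m :: "'n \<Rightarrow> nat" assume "(\<Sum>i\<in>UNIV. m i) \<le> N"
    then have "m i \<le> N" for i
      using member_le_sum[of i UNIV m] by auto
    then show "m \<in> PiE UNIV (\<lambda>_. {..N})" by auto
  qed
  show "finite (PiE (UNIV :: 'n set) (\<lambda>_. {..N}))"
    by (intro finite_PiE) auto
qed

lemma has_sum_norm_le:
  fixes f :: "'a \<Rightarrow> complex"
  assumes f: "(f has_sum s) A" and g: "g summable_on A" and le: "\<And>x. x \<in> A \<Longrightarrow> norm (f x) \<le> g x"
  shows "norm s \<le> infsum g A"
proof -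
  have "(\<lambda>x. norm (f x)) summable_on A"
    using has_sum_imp_summable[OF f] by (simp add: summable_on_iff_abs_summable_on_complex)
  then have "((\<lambda>x. norm (f x)) has_sum infsum (\<lambda>x. norm (f x)) A) A" by simp
  from norm_has_sum_bound[OF this f] infsum_mono[OF \<open>(\<lambda>x. norm (f x)) summable_on A\<close> g le]
  show ?thesis by auto
qed

text \<open>Only the terms of degree at most one contribute to the derivative at the centre, so no
  term-by-term differentiation is needed.\<close>

lemma real_analytic_differentiable:
  fixes f :: "real ^ 'n \<Rightarrow> complex"
  assumes "real_analytic f"
  shows "f differentiable (at x)"
proof -
  obtain r a where r: "r > 0" and a: "\<And>y. y \<in> ball x r \<Longrightarrow>
      ((\<lambda>m. a m * of_real (monomial m (y - x))) has_sum f y) UNIV"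
    using assms unfolding real_analytic_def monomial_diff by blast
  let ?deg = "\<lambda>m :: 'n \<Rightarrow> nat. \<Sum>i\<in>UNIV. m i"
  \<comment> \<open>The corner x + (\<rho>, ..., \<rho>) of the cube has to lie in the ball. Its
    distance from \<open>x\<close> is at most the number of coordinates times \<rho>, here r /
    2.\<close>
  define \<rho> where "\<rho> = r / (2 * real CARD('n))"
  have card: "real CARD('n) \<ge> 1" using zero_less_card_finite[where 'a = 'n] by linarith
  have \<rho>: "\<rho> > 0" using r by (simp add: \<rho>_def)
  define A where "A m = norm (a m) * \<rho> ^ ?deg m" for m
  have "norm (\<chi> i. \<rho> :: real ^ 'n) \<le> (\<Sum>i\<in>(UNIV::'n set). \<bar>\<rho>\<bar>)"
    using norm_le_l1_cart[of "\<chi> i. \<rho> :: real ^ 'n"] by simp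
  also have "\<dots> < r" using r \<rho> card by (simp add: \<rho>_def)
  finally have "x + (\<chi> i. \<rho>) \<in> ball x r" by (simp add: dist_norm)
  \<comment> \<open>Summability in the complex plane is absolute, so convergence at this single
    corner controls the coefficients of all degrees.\<close>
  from has_sum_imp_summable[OF a[OF this]] have "(\<lambda>m. norm (a m * of_real (monomial m (x + (\<chi> i. \<rho>) - x)))) summable_on UNIV"
    by (rule iffD1[OF summable_on_iff_abs_summable_on_complex])
  then have A: "A summable_on UNIV"
    using \<rho> by (simp add: A_def[abs_def] norm_mult norm_power monomial_const)
  define S where "S = {m :: 'n \<Rightarrow> nat. ?deg m \<le> 1}"
  have S: "finite S" unfolding S_def by (rule finite_multi_index_bounded)
  define Q where "Q y = (\<Sum>m\<in>S. a m * of_real (monomial m (y - x)))" for y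
  have Q: "Q differentiable (at x)"
    unfolding Q_def[abs_def]
    by (intro differentiable_sum S ballI differentiable_mult differentiable_const differentiable_monomial)
  define K where "K = infsum A UNIV / \<rho>\<^sup>2"
  have A0: "A m \<ge> 0" for m using \<rho> by (simp add: A_def)
  have bound: "norm (f y - Q y) \<le> K * (norm (y - x))\<^sup>2" if y: "norm (y - x) < \<rho>" for y
  proof -
    define t where "t = norm (y - x) / \<rho>"
    have t: "0 \<le> t" "t \<le> 1" using y \<rho> by (auto simp: t_def)
    have "r * 1 < r * (2 * real CARD('n))" using r card by (intro mult_strict_left_mono) linarith+
    then have "\<rho> < r" unfolding \<rho>_def using card by (subst pos_divide_less_eq) linarith+
    then have "y \<in> ball x r" using y by (simp add: dist_norm norm_minus_commute)
    from has_sum_Diff[OF a[OF this] has_sum_finite[OF S]]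
    have hs: "((\<lambda>m. a m * of_real (monomial m (y - x))) has_sum (f y - Q y)) (UNIV - S)"
      by (simp add: Q_def)
    have "norm (f y - Q y) \<le> infsum (\<lambda>m. A m * t\<^sup>2) (UNIV - S)"
    proof (rule has_sum_norm_le[OF hs])
      show "(\<lambda>m. A m * t\<^sup>2) summable_on (UNIV - S)"
        by (intro summable_on_cmult_left summable_on_subset_banach[OF A]) auto
      \<comment> \<open>Outside \<open>S\<close> the degree is at least 2, and t \<le> 1 then yields
        the factor t^2 that makes the remainder of second order.\<close>
      fix m assume "m \<in> UNIV - S"
      then have m: "2 \<le> ?deg m" by (simp add: S_def)
      have "\<bar>monomial m (y - x)\<bar> \<le> (\<rho> * t) ^ ?deg m"
        using \<rho> component_le_norm_cart[of "y - x"] by (intro abs_monomial_le) (simp add: t_def)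
      also have "\<dots> \<le> \<rho> ^ ?deg m * t\<^sup>2"
        using t \<rho> power_decreasing[OF m t] by (simp add: power_mult_distrib)
      finally show "norm (a m * of_real (monomial m (y - x))) \<le> A m * t\<^sup>2"
        by (simp add: norm_mult A_def mult.assoc mult_left_mono)
    qed
    also have "\<dots> \<le> infsum (\<lambda>m. A m * t\<^sup>2) UNIV"
      using A0 t by (intro infsum_mono_neutral summable_on_cmult_left summable_on_subset_banach[OF A]) auto
    also have "\<dots> = K * (norm (y - x))\<^sup>2"
      unfolding infsum_cmult_left' by (simp add: K_def t_def power_divide)
    finally show ?thesis .
  qed
  have "((\<lambda>y. f y - Q y) has_derivative (\<lambda>_. 0)) (at x)"
    unfolding has_derivative_iff_norm
  proof (intro conjI)
    have x0: "f x - Q x = 0" using bound[of x] \<rho> by simp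
    show "((\<lambda>y. norm (f y - Q y - (f x - Q x) - 0) / norm (y - x)) \<longlongrightarrow> 0) (at x)"
    proof (rule Lim_null_comparison)
      show "((\<lambda>y. K * norm (y - x)) \<longlongrightarrow> 0) (at x)"
        by (intro tendsto_eq_intros) auto
      have "norm (norm (f y - Q y - (f x - Q x) - 0) / norm (y - x)) \<le> K * norm (y - x)"
        if "y \<in> ball x \<rho>" "y \<noteq> x" for y
      proof -
        have "norm (y - x) < \<rho>" using that by (simp add: dist_norm norm_minus_commute)
        with bound[of y] that show ?thesis
          by (simp add: x0 divide_le_eq power2_eq_square mult.assoc)
      qed
      then show "\<forall>\<^sub>F y in at x. norm (norm (f y - Q y - (f x - Q x) - 0) / norm (y - x)) \<le> K * norm (y - x)"
        using \<rho> by (auto simp: eventually_at dist_commute intro!: exI[of _ \<rho>])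
    qed
  qed auto
  then have "(\<lambda>y. (f y - Q y) + Q y) differentiable (at x)"
    using Q by (intro differentiable_add) (auto simp: differentiable_def)
  then show ?thesis by simp
qed

text \<open>The bound \<open>M\<close> on the \<open>\<ell>\<^sup>1\<close>-norm of the coefficients is what makes the notion stable under
  absolutely convergent series of functions.\<close>

definition polydisc_series :: "real ^ 'n \<Rightarrow> (real ^ 'n \<Rightarrow> complex) \<Rightarrow> real \<Rightarrow> bool" where
  "polydisc_series x0 f M \<longleftrightarrow> (\<exists>a. (\<forall>F. finite F \<longrightarrow> (\<Sum>m\<in>F. norm (a m)) \<le> M) \<and>
     (\<forall>h. (\<forall>i. \<bar>h $ i\<bar> \<le> 1) \<longrightarrow>
       ((\<lambda>m. a m * of_real (monomial m h)) has_sum f (x0 + h)) UNIV))"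

lemma polydisc_seriesE:
  assumes "polydisc_series x0 f M"
  obtains a where "\<And>F. finite F \<Longrightarrow> (\<Sum>m\<in>F. norm (a m)) \<le> M"
    "\<And>h. (\<And>i. \<bar>h $ i\<bar> \<le> 1) \<Longrightarrow> ((\<lambda>m. a m * of_real (monomial m h)) has_sum f (x0 + h)) UNIV"
  using assms unfolding polydisc_series_def by blast

lemma polydisc_series_mono: "polydisc_series x0 f M \<Longrightarrow> M \<le> N \<Longrightarrow> polydisc_series x0 f N"
  unfolding polydisc_series_def by (meson order_trans)

lemma polydisc_series_const: "polydisc_series x0 (\<lambda>x. c) (norm c)"
  unfolding polydisc_series_def
proof (intro exI[of _ "\<lambda>m. if m = (\<lambda>_. 0) then c else 0"] conjI allI impI)
  fix F :: "('n \<Rightarrow> nat) set" assume "finite F"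
  then show "(\<Sum>m\<in>F. norm (if m = (\<lambda>_. 0) then c else 0)) \<le> norm c"
    by (simp add: if_distrib[of norm] sum.delta cong: if_cong)
next
  fix h :: "real ^ 'n"
  show "((\<lambda>m. (if m = (\<lambda>_. 0) then c else 0) * of_real (monomial m h)) has_sum c) UNIV"
    by (rule has_sum_finite_neutralI[where B = "{\<lambda>_. 0}"]) auto
qed

lemma polydisc_series_add:
  fixes f g :: "real ^ 'n \<Rightarrow> complex"
  assumes "polydisc_series x0 f M" "polydisc_series x0 g N"
  shows "polydisc_series x0 (\<lambda>x. f x + g x) (M + N)"
proof -
  obtain a where a: "\<And>F. finite F \<Longrightarrow> (\<Sum>m\<in>F. norm (a m)) \<le> M"
    "\<And>h. (\<And>i. \<bar>h $ i\<bar> \<le> 1) \<Longrightarrow> ((\<lambda>m. a m * of_real (monomial m h)) has_sum f (x0 + h)) UNIV"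
    using polydisc_seriesE[OF assms(1)] by blast
  obtain b where b: "\<And>F. finite F \<Longrightarrow> (\<Sum>m\<in>F. norm (b m)) \<le> N"
    "\<And>h. (\<And>i. \<bar>h $ i\<bar> \<le> 1) \<Longrightarrow> ((\<lambda>m. b m * of_real (monomial m h)) has_sum g (x0 + h)) UNIV"
    using polydisc_seriesE[OF assms(2)] by blast
  show ?thesis
    unfolding polydisc_series_def
  proof (intro exI[of _ "\<lambda>m. a m + b m"] conjI allI impI)
    fix F :: "('n \<Rightarrow> nat) set" assume F: "finite F"
    have "(\<Sum>m\<in>F. norm (a m + b m)) \<le> (\<Sum>m\<in>F. norm (a m)) + (\<Sum>m\<in>F. norm (b m))"
      by (simp add: sum.distrib[symmetric] sum_mono norm_triangle_ineq)
    with a(1)[OF F] b(1)[OF F] show "(\<Sum>m\<in>F. norm (a m + b m)) \<le> M + N" by simp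
  next
    fix h :: "real ^ 'n" assume "\<forall>i. \<bar>h $ i\<bar> \<le> 1"
    then show "((\<lambda>m. (a m + b m) * of_real (monomial m h)) has_sum f (x0 + h) + g (x0 + h)) UNIV"
      unfolding distrib_right by (intro has_sum_add a b) auto
  qed
qed

lemma polydisc_series_cmult:
  fixes f :: "real ^ 'n \<Rightarrow> complex"
  assumes "polydisc_series x0 f M"
  shows "polydisc_series x0 (\<lambda>x. c * f x) (norm c * M)"
proof -
  obtain a where a: "\<And>F. finite F \<Longrightarrow> (\<Sum>m\<in>F. norm (a m)) \<le> M"
    "\<And>h. (\<And>i. \<bar>h $ i\<bar> \<le> 1) \<Longrightarrow> ((\<lambda>m. a m * of_real (monomial m h)) has_sum f (x0 + h)) UNIV"
    using polydisc_seriesE[OF assms(1)] by blast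
  show ?thesis
    unfolding polydisc_series_def
  proof (intro exI[of _ "\<lambda>m. c * a m"] conjI allI impI)
    fix F :: "('n \<Rightarrow> nat) set" assume F: "finite F"
    show "(\<Sum>m\<in>F. norm (c * a m)) \<le> norm c * M"
      using a(1)[OF F] by (simp add: norm_mult sum_distrib_left[symmetric] mult_left_mono)
  next
    fix h :: "real ^ 'n" assume "\<forall>i. \<bar>h $ i\<bar> \<le> 1"
    then show "((\<lambda>m. c * a m * of_real (monomial m h)) has_sum c * f (x0 + h)) UNIV"
      unfolding mult.assoc by (intro has_sum_cmult_right a) auto
  qed
qed

lemma polydisc_series_sum:
  assumes "finite A" "\<And>i. i \<in> A \<Longrightarrow> polydisc_series x0 (f i) (M i)"
  shows "polydisc_series x0 (\<lambda>x. \<Sum>i\<in>A. f i x) (\<Sum>i\<in>A. M i)"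
  using assms
proof (induction A rule: finite_induct)
  case empty
  then show ?case using polydisc_series_const[of x0 0] by simp
next
  case (insert i A)
  then show ?case by (simp add: polydisc_series_add)
qed

text \<open>Multiplication by a centred coordinate raises one exponent. This shift of multi-indices
  is injective, so the coefficient sums keep the bound \<open>M\<close>.\<close>

lemma polydisc_series_coordinate:
  fixes f :: "real ^ 'n \<Rightarrow> complex"
  assumes "polydisc_series x0 f M"
  shows "polydisc_series x0 (\<lambda>x. of_real ((x - x0) $ i) * f x) M"
proof -
  obtain a where a: "\<And>F. finite F \<Longrightarrow> (\<Sum>m\<in>F. norm (a m)) \<le> M"
    "\<And>h. (\<And>i. \<bar>h $ i\<bar> \<le> 1) \<Longrightarrow> ((\<lambda>m. a m * of_real (monomial m h)) has_sum f (x0 + h)) UNIV"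
    using polydisc_seriesE[OF assms(1)] by blast
  define up where "up m = m(i := Suc (m i))" for m :: "'n \<Rightarrow> nat"
  define dn where "dn m = m(i := m i - 1)" for m :: "'n \<Rightarrow> nat"
  \<comment> \<open>Indices with exponent 0 at \<open>i\<close> are outside the range of the shift
    and must get coefficient 0; the truncated subtraction in \<open>dn\<close> alone would assign
    them a wrong one.\<close>
  define b where "b m = (if m i = 0 then 0 else a (dn m))" for m
  have dn_up: "dn (up m) = m" and b_up: "b (up m) = a m" for m
    by (auto simp: up_def dn_def b_def)
  have inj: "inj up" by (rule inj_on_inverseI[where g = dn]) (rule dn_up)
  have range_up: "b m = 0" if "m \<notin> range up" for m
  proof (rule ccontr)
    assume "b m \<noteq> 0"
    then have "m = up (dn m)" by (auto simp: b_def up_def dn_def fun_eq_iff split: if_splits)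
    with that show False by blast
  qed
  show ?thesis
    unfolding polydisc_series_def
  proof (intro exI[of _ b] conjI allI impI)
    fix F :: "('n \<Rightarrow> nat) set" assume F: "finite F"
    have "(\<Sum>m\<in>F. norm (b m)) = (\<Sum>m\<in>F \<inter> range up. norm (b m))"
      using F range_up by (intro sum.mono_neutral_right) auto
    also have "F \<inter> range up = up ` (up -` F)" by auto
    also have "(\<Sum>m\<in>up ` (up -` F). norm (b m)) = (\<Sum>m\<in>up -` F. norm (a m))"
      by (subst sum.reindex[OF inj_on_subset[OF inj]]) (auto simp: b_up)
    also have "\<dots> \<le> M" by (rule a(1)[OF finite_vimageI[OF F inj]])
    finally show "(\<Sum>m\<in>F. norm (b m)) \<le> M" .
  next
    fix h :: "real ^ 'n" assume h: "\<forall>i. \<bar>h $ i\<bar> \<le> 1"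
    have "((\<lambda>m. of_real (h $ i) * (a m * of_real (monomial m h))) has_sum of_real (h $ i) * f (x0 + h)) UNIV"
      using h by (intro has_sum_cmult_right a) auto
    also have "(\<lambda>m. of_real (h $ i) * (a m * of_real (monomial m h))) = (\<lambda>m. b m * of_real (monomial m h)) \<circ> up"
      by (auto simp: fun_eq_iff b_up) (auto simp: up_def monomial_Suc)
    finally have "((\<lambda>m. b m * of_real (monomial m h)) has_sum of_real (h $ i) * f (x0 + h)) (range up)"
      by (subst has_sum_reindex[OF inj])
    then show "((\<lambda>m. b m * of_real (monomial m h)) has_sum of_real ((x0 + h - x0) $ i) * f (x0 + h)) UNIV"
      by (subst has_sum_cong_neutral[where T = "range up" and g = "\<lambda>m. b m * of_real (monomial m h)"])
        (auto simp: range_up)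
  qed
qed

text \<open>Expand the form as its value at \<open>x0\<close> plus a combination of centred
  coordinates. Multiplication by a centred coordinate leaves the bound unchanged, so only the
  absolute values of the coefficients enter the constant.\<close>

lemma polydisc_series_linear_mult:
  fixes l :: "real ^ 'n \<Rightarrow> real"
  assumes f: "polydisc_series x0 f M" and l: "linear l"
  shows "polydisc_series x0 (\<lambda>x. of_real (l x) * f x) ((\<bar>l x0\<bar> + (\<Sum>i\<in>UNIV. \<bar>l (axis i 1)\<bar>)) * M)"
proof -
  have "l h = (\<Sum>i\<in>UNIV. h $ i * l (axis i 1))" for h
    using linear_axis_expansion[OF linear_compose[OF l bounded_linear.linear[OF bounded_linear_of_real]], of h]
    by (simp add: o_def of_real_mult[symmetric] of_real_sum[symmetric] del: of_real_mult of_real_sum)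
  then have expand: "l x = l x0 + (\<Sum>i\<in>UNIV. (x - x0) $ i * l (axis i 1))" for x
    using linear_diff[OF l, of x x0] by (metis add.commute diff_add_cancel)
  have eq: "(\<lambda>x. of_real (l x) * f x) = (\<lambda>x. of_real (l x0) * f x +
      (\<Sum>i\<in>UNIV. of_real (l (axis i 1)) * (of_real ((x - x0) $ i) * f x)))"
    by (rule ext, subst expand) (simp add: sum_distrib_right sum_distrib_left distrib_right mult_ac ring_distribs(1))
  have bound: "polydisc_series x0 (\<lambda>x. of_real (l x0) * f x +
      (\<Sum>i\<in>UNIV. of_real (l (axis i 1)) * (of_real ((x - x0) $ i) * f x)))
     (norm (of_real (l x0) :: complex) * M + (\<Sum>i\<in>UNIV. norm (of_real (l (axis i 1)) :: complex) * M))"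
    by (intro polydisc_series_add polydisc_series_sum polydisc_series_cmult polydisc_series_coordinate f) auto
  have "norm (of_real (l x0) :: complex) * M + (\<Sum>i\<in>UNIV. norm (of_real (l (axis i 1)) :: complex) * M) =
      (\<bar>l x0\<bar> + (\<Sum>i\<in>UNIV. \<bar>l (axis i 1)\<bar>)) * M"
    by (simp add: distrib_right sum_distrib_right)
  with bound show ?thesis
    unfolding eq by (simp only:)
qed

text \<open>The coefficient bounds make the family indexed by pairs (n, m) absolutely summable, so
  the sum over n and the sum over multi-indices can be exchanged.\<close>

lemma polydisc_series_suminf:
  fixes f :: "nat \<Rightarrow> real ^ 'n \<Rightarrow> complex"
  assumes f: "\<And>n. polydisc_series x0 (f n) (M n)" and M: "summable M"
    and F: "\<And>x. (\<lambda>n. f n x) sums F x"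
  shows "polydisc_series x0 F (suminf M)"
proof -
  have "\<exists>a. (\<forall>F. finite F \<longrightarrow> (\<Sum>m\<in>F. norm (a m)) \<le> M n) \<and>
     (\<forall>h. (\<forall>i. \<bar>h $ i\<bar> \<le> 1) \<longrightarrow>
       ((\<lambda>m. a m * of_real (monomial m h)) has_sum f n (x0 + h)) UNIV)" for n
    using f unfolding polydisc_series_def by blast
  then obtain a where a: "\<And>n F. finite F \<Longrightarrow> (\<Sum>m\<in>F. norm (a n m)) \<le> M n"
    "\<And>n h. (\<And>i. \<bar>h $ i\<bar> \<le> 1) \<Longrightarrow> ((\<lambda>m. a n m * of_real (monomial m h)) has_sum f n (x0 + h)) UNIV"
    by metis
  have sm_n: "(\<lambda>m. norm (a n m)) summable_on UNIV" for n
    using a(1) by (intro nonneg_bounded_partial_sums_imp_summable_on[where C = "M n"]) auto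
  have le_M: "norm (a n m) \<le> M n" for n m
    using a(1)[of "{m}"] by simp
  have sm_m: "summable (\<lambda>n. norm (a n m))" for m
    by (rule summable_comparison_test'[OF M]) (simp add: le_M)
  define b where "b m = (\<Sum>n. a n m)" for m
  show ?thesis
    unfolding polydisc_series_def
  proof (intro exI[of _ b] conjI allI impI)
    fix F :: "('n \<Rightarrow> nat) set" assume F: "finite F"
    have "(\<Sum>m\<in>F. norm (b m)) \<le> (\<Sum>m\<in>F. \<Sum>n. norm (a n m))"
      unfolding b_def by (intro sum_mono summable_norm sm_m)
    also have "\<dots> = (\<Sum>n. \<Sum>m\<in>F. norm (a n m))"
      by (rule suminf_sum[symmetric]) (rule sm_m)
    also have "\<dots> \<le> suminf M"
      by (intro suminf_le a F M summable_sum sm_m)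
    finally show "(\<Sum>m\<in>F. norm (b m)) \<le> suminf M" .
  next
    fix h :: "real ^ 'n" assume h: "\<forall>i. \<bar>h $ i\<bar> \<le> 1"
    define t where "t = (\<lambda>(n, m). a n m * of_real (monomial m h))"
    have mon: "\<bar>monomial m h\<bar> \<le> 1" for m
      using abs_monomial_le[of h 1 m] h by simp
    \<comment> \<open>A finite set of pairs lies in the product of its projections, where the bounds
      \<open>M n\<close> apply row by row.\<close>
    have "(\<lambda>p. norm (a (fst p) (snd p))) summable_on (UNIV \<times> UNIV)"
    proof (rule nonneg_bounded_partial_sums_imp_summable_on[where C = "suminf M"])
      show "\<forall>\<^sub>F P in finite_subsets_at_top (UNIV \<times> UNIV). (\<Sum>p\<in>P. norm (a (fst p) (snd p))) \<le> suminf M"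
      proof (rule eventually_finite_subsets_at_top_weakI)
        fix P :: "(nat \<times> ('n \<Rightarrow> nat)) set" assume P: "finite P"
        have "(\<Sum>p\<in>P. norm (a (fst p) (snd p))) \<le> (\<Sum>p\<in>(fst ` P) \<times> (snd ` P). norm (a (fst p) (snd p)))"
          using P by (intro sum_mono2) (auto simp: image_iff, metis fst_conv, metis snd_conv)
        also have "\<dots> = (\<Sum>n\<in>fst ` P. \<Sum>m\<in>snd ` P. norm (a n m))"
          by (simp add: sum.cartesian_product case_prod_beta)
        also have "\<dots> \<le> (\<Sum>n\<in>fst ` P. M n)"
          using P by (intro sum_mono a) auto
        also have "\<dots> \<le> suminf M"
          using P M le_M norm_ge_zero order_trans by (intro sum_le_suminf) blast+
        finally show "(\<Sum>p\<in>P. norm (a (fst p) (snd p))) \<le> suminf M" .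
      qed
    qed simp
    then have "(\<lambda>p. norm (t p)) summable_on (UNIV \<times> UNIV)"
      by (rule summable_on_comparison_test) (use mon in \<open>auto simp: t_def norm_mult mult_left_le\<close>)
    then have "t summable_on (UNIV \<times> UNIV)"
      by (rule iffD2[OF summable_on_iff_abs_summable_on_complex])
    then obtain s where s: "(t has_sum s) (UNIV \<times> UNIV)"
      by (auto simp: summable_on_def)
    have "((\<lambda>n. f n (x0 + h)) has_sum s) UNIV"
      by (rule has_sum_SigmaD[OF s]) (use a(2) h in \<open>auto simp: t_def\<close>)
    then have sF: "s = F (x0 + h)"
      using has_sum_imp_sums F sums_unique2 by blast
    have "((\<lambda>(m, n). t (n, m)) has_sum s) (UNIV \<times> UNIV)"
      using has_sum_swap[THEN iffD1, OF s] by (simp add: case_prod_beta)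
    then have "((\<lambda>m. b m * of_real (monomial m h)) has_sum s) UNIV"
    proof (rule has_sum_SigmaD)
      fix m
      have "((\<lambda>n. a n m) has_sum b m) UNIV"
        by (intro norm_summable_imp_has_sum sm_m)
          (simp add: b_def summable_sums summable_norm_cancel[OF sm_m])
      then show "((\<lambda>n. case (m, n) of (m, n) \<Rightarrow> t (n, m)) has_sum b m * of_real (monomial m h)) UNIV"
        unfolding t_def by (simp add: has_sum_cmult_left)
    qed
    then show "((\<lambda>m. b m * of_real (monomial m h)) has_sum F (x0 + h)) UNIV"
      by (simp add: sF)
  qed
qed

text \<open>The Euclidean unit ball lies inside the unit polydisc with the same centre, where the
  series converges.\<close>

lemma real_analytic_polydisc_series:
  assumes "\<And>x. polydisc_series x f (M x)"
  shows "real_analytic f"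
  unfolding real_analytic_def
proof (rule allI, goal_cases)
  case (1 x)
  obtain a where a: "\<And>h. (\<And>i. \<bar>h $ i\<bar> \<le> 1) \<Longrightarrow> ((\<lambda>m. a m * of_real (monomial m h)) has_sum f (x + h)) UNIV"
    using polydisc_seriesE[OF assms] by blast
  have "((\<lambda>m. a m * of_real (monomial m (y - x))) has_sum f y) UNIV" if "y \<in> ball x 1" for y
  proof -
    have "\<bar>(y - x) $ i\<bar> \<le> 1" for i
      using component_le_norm_cart[of "y - x" i] that by (simp add: dist_norm norm_minus_commute)
    from a[OF this] show ?thesis by simp
  qed
  then show ?case
    by (intro exI[of _ 1] conjI exI[of _ a] ballI) (auto simp: monomial_def)
qed

lemma reflection_group_comp:
  "g \<in> reflection_group R \<Longrightarrow> h \<in> reflection_group R \<Longrightarrow> g \<circ> h \<in> reflection_group R"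
proof (induction rule: reflection_group.induct)
  case (refl g v)
  show ?case
    using reflection_group.refl[OF refl(3)[OF refl(4)] refl(2)] by (simp only: comp_assoc)
qed simp

context dunkl
begin

text \<open>The statement ranges over all \<open>g\<close> because the recursion evaluates the
  previous term at group translates. \<open>B\<close> bounds the coefficients of the form <y, g x>
  about \<open>x0\<close>: |y| |x0| for the constant one and |y| for each coordinate.\<close>

lemma polydisc_series_kernel_term:
  fixes x0 y :: "real ^ 'n"
  defines "B \<equiv> norm y * (norm x0 + real CARD('n))"
  shows "g \<in> G \<Longrightarrow> polydisc_series x0 (\<lambda>x. kernel_term n y (g x)) (B ^ n / fact n)"
proof (induction n arbitrary: g)
  case 0
  show ?case using polydisc_series_const[of x0 1] by simp
next
  case (Suc n)
  note g = Suc.prems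
  have 1: "polydisc_series x0 (\<lambda>x. of_real (resolvent (Suc n) g') * (\<i> * (of_real (y \<bullet> g' (g x)) * kernel_term n y (g' (g x)))))
       (resolvent (Suc n) g' * (B * (B ^ n / fact n)))" if g': "g' \<in> G" for g'
  proof -
    have gg: "g' \<circ> g \<in> G" by (rule reflection_group_comp[OF g' g])
    let ?l = "\<lambda>x. y \<bullet> (g' \<circ> g) x"
    have l: "linear ?l"
      using linear_compose[OF reflection_group_linear[OF gg] bounded_linear.linear[OF bounded_linear_inner_right[of y]]]
      by (simp add: o_def)
    have bd: "\<bar>?l x\<bar> \<le> norm y * norm x" for x
      using Cauchy_Schwarz_ineq2[of y "(g' \<circ> g) x"] reflection_group_norm[OF gg, of x] by simp
    have "(\<Sum>i\<in>UNIV. \<bar>?l (axis i 1)\<bar>) \<le> (\<Sum>i\<in>(UNIV::'n set). norm y)"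
    proof (rule sum_mono)
      fix i show "\<bar>?l (axis i 1)\<bar> \<le> norm y"
        using bd[of "axis i 1"] by (simp add: norm_axis_1)
    qed
    then have le: "\<bar>?l x0\<bar> + (\<Sum>i\<in>UNIV. \<bar>?l (axis i 1)\<bar>) \<le> B"
      using bd[of x0] by (simp add: B_def algebra_simps)
    have B: "B \<ge> 0" by (simp add: B_def)
    have "polydisc_series x0 (\<lambda>x. of_real (?l x) * kernel_term n y ((g' \<circ> g) x)) (B * (B ^ n / fact n))"
      using polydisc_series_mono[OF polydisc_series_linear_mult[OF Suc.IH[OF gg] l] mult_right_mono[OF le]] B
      by simp
    from polydisc_series_cmult[OF polydisc_series_cmult[OF this, of \<i>], of "of_real (resolvent (Suc n) g')"]
    show ?thesis using resolvent_nonneg[OF _ g', of "Suc n"] by simp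
  qed
  have "(\<Sum>g'\<in>G. resolvent (Suc n) g' * (B * (B ^ n / fact n))) = B ^ Suc n / fact (Suc n)"
    by (simp only: sum_distrib_right[symmetric] sum_resolvent[OF zero_less_Suc]) (simp add: field_simps)
  moreover have "polydisc_series x0 (\<lambda>x. \<Sum>g'\<in>G. of_real (resolvent (Suc n) g') * (\<i> * (of_real (y \<bullet> g' (g x)) * kernel_term n y (g' (g x)))))
       (\<Sum>g'\<in>G. resolvent (Suc n) g' * (B * (B ^ n / fact n)))"
    by (rule polydisc_series_sum[OF finite_G 1])
  ultimately show ?case by (simp add: mult.assoc)
qed

lemma real_analytic_kernel: "real_analytic (kernel y)"
proof (rule real_analytic_polydisc_series)
  fix x0 :: "real ^ 'n"
  let ?B = "norm y * (norm x0 + real CARD('n))"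
  show "polydisc_series x0 (kernel y) (\<Sum>n. ?B ^ n / fact n)"
  proof (rule polydisc_series_suminf)
    show "polydisc_series x0 (kernel_term n y) (?B ^ n / fact n)" for n
      using polydisc_series_kernel_term[OF id_in_G, of x0 n y] by (simp add: id_def)
    show "summable (\<lambda>n. ?B ^ n / fact n)"
      using summable_exp_generic[of ?B] by (simp add: divide_inverse mult.commute)
    show "(\<lambda>n. kernel_term n y x) sums kernel y x" for x
      unfolding kernel_def by (rule summable_sums[OF summable_kernel_term])
  qed
qed

end

section \<open>Uniqueness of the kernel and bounds\<close>

text \<open>Gronwall's argument: exp (-t) (f t + C) is nonincreasing on the unit interval.\<close>

lemma exponential_growth_bound:
  fixes f :: "real \<Rightarrow> real"
  assumes cont: "continuous_on {0..1} f"
    and der: "\<And>t. 0 < t \<Longrightarrow> t < 1 \<Longrightarrow> (f has_real_derivative f' t) (at t)"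
    and le: "\<And>t. 0 < t \<Longrightarrow> t < 1 \<Longrightarrow> f' t \<le> f t + C"
  shows "f 1 + C \<le> exp 1 * (f 0 + C)"
proof -
  define q where "q t = exp (- t) * (f t + C)" for t
  have "q 1 \<le> q 0"
  proof (rule DERIV_nonpos_imp_decreasing_open[of 0 1])
    fix t :: real assume t: "0 < t" "t < 1"
    have "(q has_real_derivative exp (- t) * (f' t - (f t + C))) (at t)"
      unfolding q_def by (auto intro!: derivative_eq_intros der t simp: algebra_simps)
    moreover have "exp (- t) * (f' t - (f t + C)) \<le> 0"
      using le[OF t] by (simp add: mult_le_0_iff)
    ultimately show "\<exists>y. (q has_real_derivative y) (at t) \<and> y \<le> 0" by blast
  next
    show "continuous_on {0..1} q"
      unfolding q_def by (intro continuous_intros cont)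
  qed simp
  then have "exp (1 :: real) * (exp (- 1) * (f 1 + C)) \<le> exp 1 * (f 0 + C)"
    unfolding q_def by (intro mult_left_mono) auto
  then show ?thesis by (simp add: mult.assoc[symmetric] exp_minus)
qed

lemma dir_deriv_limit:
  assumes f: "f differentiable (at x)"
  shows "((\<lambda>t. (f (x + t *\<^sub>R a) - f x) /\<^sub>R t) \<longlongrightarrow> dir_deriv a f x) (at 0)"
proof -
  have "((\<lambda>t. f (x + t *\<^sub>R a)) has_derivative (\<lambda>t. dir_deriv (t *\<^sub>R a) f x)) (at 0)"
    by (rule has_derivative_compose[where f = "\<lambda>t. x + t *\<^sub>R a" and s = UNIV])
      (auto intro!: derivative_eq_intros has_derivative_dir_deriv[OF f])
  then have "((\<lambda>t. norm (f (x + t *\<^sub>R a) - f x - t *\<^sub>R dir_deriv a f x) / norm t) \<longlongrightarrow> 0) (at 0)"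
    by (simp add: has_derivative_iff_norm linear_cmul[OF linear_dir_deriv[OF f]])
  then have "((\<lambda>t. norm ((f (x + t *\<^sub>R a) - f x) /\<^sub>R t - dir_deriv a f x)) \<longlongrightarrow> 0) (at 0)"
  proof (rule Lim_transform_eventually)
    have "norm (u - t *\<^sub>R w) / norm t = norm (u /\<^sub>R t - w)" if "t \<noteq> 0" for t and u w :: complex
    proof -
      have "u /\<^sub>R t - w = (u - t *\<^sub>R w) /\<^sub>R t" using that by (simp add: scaleR_diff_right)
      then show ?thesis by (simp only: norm_scaleR) (simp add: divide_inverse mult.commute)
    qed
    then show "\<forall>\<^sub>F t in at 0. norm (f (x + t *\<^sub>R a) - f x - t *\<^sub>R dir_deriv a f x) / norm t =
        norm ((f (x + t *\<^sub>R a) - f x) /\<^sub>R t - dir_deriv a f x)"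
      by (auto simp: eventually_at intro!: exI[of _ 1])
  qed
  then show ?thesis
    by (rule LIM_zero_cancel[OF tendsto_norm_zero_cancel])
qed

lemma norm_dir_deriv_le_lipschitz:
  assumes f: "f differentiable (at x)" and lip: "\<And>x'. norm (f x' - f x) \<le> L * norm (x' - x)"
  shows "norm (dir_deriv a f x) \<le> L * norm a"
proof (rule Lim_norm_ubound[OF _ dir_deriv_limit[OF f]])
  have "norm ((f (x + t *\<^sub>R a) - f x) /\<^sub>R t) \<le> L * norm a" if "t \<noteq> 0" for t
  proof -
    have "norm (f (x + t *\<^sub>R a) - f x) \<le> \<bar>t\<bar> * (L * norm a)"
      using lip[of "x + t *\<^sub>R a"] by (simp add: mult_ac)
    then show ?thesis using that by (simp only: norm_scaleR) (simp add: inverse_eq_divide pos_divide_le_eq mult.commute)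
  qed
  then show "\<forall>\<^sub>F t in at 0. norm ((f (x + t *\<^sub>R a) - f x) /\<^sub>R t) \<le> L * norm a"
    by (auto simp: eventually_at intro!: exI[of _ 1])
qed simp

context dunkl
begin

text \<open>Differentiating \<open>\<Sum>\<^sub>g |h (t g x)|\<^sup>2\<close> in \<open>t\<close>, the difference terms of the Dunkl operators pair up to
  \<open>- \<Sum>\<^sub>v k\<^sub>v \<Sum>\<^sub>g |h (t g x) - h (t \<sigma>\<^sub>v g x)|\<^sup>2 \<le> 0\<close>, and the imaginary multiple of \<open>h\<close> drops out.\<close>

lemma G_energy_estimate:
  fixes h r :: "real ^ 'n \<Rightarrow> complex" and \<theta> :: "real ^ 'n \<Rightarrow> real"
  assumes diff: "\<And>x. h differentiable (at x)"
    and eq: "\<And>x. T x h x = \<i> * of_real (\<theta> x) * h x + r x"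
    and r: "\<And>x. norm (r x) \<le> \<rho> * norm x"
  shows "(norm (h x))\<^sup>2 \<le> exp 1 * (real (card G) * ((norm (h 0))\<^sup>2 + (\<rho> * norm x)\<^sup>2))"
proof -
  define N where "N t = (\<Sum>g\<in>G. (norm (h (t *\<^sub>R g x)))\<^sup>2)" for t
  define N' where "N' t = (\<Sum>g\<in>G. 2 * (h (t *\<^sub>R g x) \<bullet> dir_deriv (g x) h (t *\<^sub>R g x)))" for t
  define C where "C = real (card G) * (\<rho> * norm x)\<^sup>2"
  have der: "(N has_real_derivative N' t) (at t)" for t
    unfolding N_def N'_def
  proof (rule DERIV_sum)
    fix g assume "g \<in> G"
    have "((\<lambda>t. h (t *\<^sub>R g x)) has_derivative (\<lambda>d. dir_deriv (d *\<^sub>R g x) h (t *\<^sub>R g x))) (at t)"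
      by (rule has_derivative_compose[OF _ has_derivative_dir_deriv[OF diff]]) (auto intro!: derivative_eq_intros)
    then have "((\<lambda>t. h (t *\<^sub>R g x)) has_vector_derivative dir_deriv (g x) h (t *\<^sub>R g x)) (at t)"
      by (simp add: has_vector_derivative_def linear_cmul[OF linear_dir_deriv[OF diff]])
    then have "((\<lambda>t. h (t *\<^sub>R g x) \<bullet> h (t *\<^sub>R g x)) has_vector_derivative
        h (t *\<^sub>R g x) \<bullet> dir_deriv (g x) h (t *\<^sub>R g x) + dir_deriv (g x) h (t *\<^sub>R g x) \<bullet> h (t *\<^sub>R g x)) (at t)"
      by (intro bounded_bilinear.has_vector_derivative[OF bounded_bilinear_inner])
    then show "((\<lambda>t. (norm (h (t *\<^sub>R g x)))\<^sup>2) has_real_derivative 2 * (h (t *\<^sub>R g x) \<bullet> dir_deriv (g x) h (t *\<^sub>R g x))) (at t)"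
      by (simp add: has_real_derivative_iff_has_vector_derivative power2_norm_eq_inner inner_commute)
  qed
  have bound: "N' t \<le> N t + C" if t: "0 < t" "t < 1" for t
  proof -
    let ?y = "\<lambda>g. t *\<^sub>R g x"
    have refl_y: "reflect_along v (?y g) = ?y (reflect_along v \<circ> g)" for v g
      by (simp add: reflect_along_scaleR)
    have step: "t * (2 * (h (?y g) \<bullet> dir_deriv (g x) h (?y g))) = 2 * (h (?y g) \<bullet> r (?y g)) -
        (\<Sum>v\<in>Rp. k v * (2 * (h (?y g) \<bullet> (h (?y g) - h (?y (reflect_along v \<circ> g))))))" for g
    proof -
      have "t *\<^sub>R dir_deriv (g x) h (?y g) = dir_deriv (?y g) h (?y g)"
        by (simp add: linear_cmul[OF linear_dir_deriv[OF diff]])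
      also have "\<dots> = \<i> * of_real (\<theta> (?y g)) * h (?y g) + r (?y g)
          - (\<Sum>v\<in>Rp. k v *\<^sub>R (h (?y g) - h (?y (reflect_along v \<circ> g))))"
        using eq[of "?y g"] T_radial[OF diff, of "?y g"] by (simp add: refl_y scaleR_conv_of_real[where 'a = complex] algebra_simps)
      finally have *: "t *\<^sub>R dir_deriv (g x) h (?y g) = \<dots>" .
      \<comment> \<open>In the real inner product of the complex plane an imaginary multiple of z is
        orthogonal to z. This is where the reality of \<theta> enters.\<close>
      have i0: "z \<bullet> (\<i> * of_real c * z) = 0" for z :: complex and c
        by (simp add: inner_complex_def)
      have "t * (2 * (h (?y g) \<bullet> dir_deriv (g x) h (?y g))) = 2 * (h (?y g) \<bullet> (t *\<^sub>R dir_deriv (g x) h (?y g)))"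
        by simp
      also have "\<dots> = 2 * (h (?y g) \<bullet> r (?y g)) -
        (\<Sum>v\<in>Rp. k v * (2 * (h (?y g) \<bullet> (h (?y g) - h (?y (reflect_along v \<circ> g))))))"
        unfolding * inner_diff_right inner_add_right[of "h (?y g)"] i0 inner_sum_right
        by (simp add: sum_distrib_left inner_diff_right sum_subtractf algebra_simps)
      finally show ?thesis .
    qed
    have "t * N' t = (\<Sum>g\<in>G. 2 * (h (?y g) \<bullet> r (?y g))) -
        (\<Sum>v\<in>Rp. k v * (\<Sum>g\<in>G. 2 * (h (?y g) \<bullet> (h (?y g) - h (?y (reflect_along v \<circ> g))))))"
      unfolding N'_def sum_distrib_left[of t] step sum_subtractf
      by (simp only: sum.swap[of _ Rp G] sum_distrib_left)
    also have "\<dots> \<le> (\<Sum>g\<in>G. 2 * (h (?y g) \<bullet> r (?y g)))"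
    proof -
      have "0 \<le> (\<Sum>g\<in>G. 2 * (h (?y g) \<bullet> (h (?y g) - h (?y (reflect_along v \<circ> g)))))" if "v \<in> Rp" for v
      proof -
        \<comment> \<open>Polarisation: twice the inner product of h with h - h' is |h - h'|^2 +
          |h|^2 - |h'|^2. Summed over \<open>G\<close> the last two terms cancel, since left
          translation by a reflection permutes the group.\<close>
        have "(\<Sum>g\<in>G. 2 * (h (?y g) \<bullet> (h (?y g) - h (?y (reflect_along v \<circ> g))))) =
          (\<Sum>g\<in>G. (norm (h (?y g) - h (?y (reflect_along v \<circ> g))))\<^sup>2)
            + ((\<Sum>g\<in>G. (norm (h (?y g)))\<^sup>2) - (\<Sum>g\<in>G. (norm (h (?y (reflect_along v \<circ> g))))\<^sup>2))"
          unfolding sum.distrib[symmetric] sum_subtractf[symmetric]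
          by (intro sum.cong HOL.refl)
            (simp add: power2_norm_eq_inner inner_diff_left inner_diff_right inner_commute)
        also have "(\<Sum>g\<in>G. (norm (h (?y (reflect_along v \<circ> g))))\<^sup>2) = (\<Sum>g\<in>G. (norm (h (?y g)))\<^sup>2)"
          by (rule sum_G_reflect_comp[OF Rp_in_R[OF that]])
        finally show ?thesis by (simp add: sum_nonneg)
      qed
      then show ?thesis
        by (simp add: sum_nonneg k_Rp)
    qed
    also have "\<dots> \<le> (\<Sum>g\<in>G. t * ((norm (h (?y g)))\<^sup>2 + (\<rho> * norm x)\<^sup>2))"
    proof (rule sum_mono)
      fix g assume g: "g \<in> G"
      have "2 * (h (?y g) \<bullet> r (?y g)) \<le> 2 * (norm (h (?y g)) * (\<rho> * norm (?y g)))"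
        using norm_cauchy_schwarz[of "h (?y g)" "r (?y g)"] mult_left_mono[OF r[of "?y g"] norm_ge_zero[of "h (?y g)"]]
        by linarith
      \<comment> \<open>The norm of the point on the ray supplies a factor t, which cancels the t
        multiplied onto the derivative.\<close>
      also have "\<dots> = t * (2 * (norm (h (?y g)) * (\<rho> * norm x)))"
        using t by (simp add: reflection_group_norm[OF g])
      also have "\<dots> \<le> t * ((norm (h (?y g)))\<^sup>2 + (\<rho> * norm x)\<^sup>2)"
        using t sum_squares_bound[of "norm (h (?y g))" "\<rho> * norm x"] by (simp add: mult.assoc)
      finally show "2 * (h (?y g) \<bullet> r (?y g)) \<le> t * ((norm (h (?y g)))\<^sup>2 + (\<rho> * norm x)\<^sup>2)" .
    qed
    also have "\<dots> = t * (N t + C)"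
      by (simp add: N_def C_def sum_distrib_left sum.distrib distrib_left)
    finally show ?thesis using t by simp
  qed
  have "N 1 + C \<le> exp 1 * (N 0 + C)"
    using der bound by (intro exponential_growth_bound[where f' = N'])
      (auto intro!: DERIV_continuous_on[where D = N'] intro: has_field_derivative_at_within)
  moreover have "N 0 = real (card G) * (norm (h 0))\<^sup>2"
    by (simp add: N_def)
  moreover have "(norm (h x))\<^sup>2 \<le> N 1"
    using member_le_sum[OF id_in_G, of "\<lambda>g. (norm (h (g x)))\<^sup>2"] finite_G by (simp add: N_def)
  moreover have "C \<ge> 0" by (simp add: C_def)
  ultimately have "(norm (h x))\<^sup>2 \<le> exp 1 * (real (card G) * (norm (h 0))\<^sup>2 + C)" by simp
  then show ?thesis by (simp add: C_def distrib_left)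
qed

text \<open>Here the energy estimate has zero error term and zero initial value, so the energy
  vanishes along every ray.\<close>

lemma T_eigenfunction_unique:
  assumes diff: "\<And>x. h differentiable (at x)"
    and eq: "\<And>x a. T a h x = \<i> * of_real (y \<bullet> a) * h x" and h0: "h 0 = 0"
  shows "h x = 0"
proof -
  have "(norm (h x))\<^sup>2 \<le> exp 1 * (real (card G) * ((norm (h 0))\<^sup>2 + (0 * norm x)\<^sup>2))"
    by (rule G_energy_estimate[where \<theta> = "\<lambda>x. y \<bullet> x" and r = "\<lambda>_. 0", OF diff]) (auto simp: eq)
  then show ?thesis by (simp add: h0)
qed

text \<open>This evaluates the definite description. An analytic competitor is differentiable, its
  equations in the coordinate directions extend to all directions by linearity, and its difference
  from the series solution is an eigenfunction that vanishes at 0.\<close>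

lemma dunkl_kernel_eq: "dunkl_kernel Rp k (imag_vec y) = kernel y"
  unfolding dunkl_kernel_def
proof (rule the_equality)
  show "real_analytic (kernel y) \<and>
      (\<forall>j x. dunkl_operator Rp k j (kernel y) x = imag_vec y $ j * kernel y x) \<and> kernel y 0 = 1"
    by (simp add: real_analytic_kernel dunkl_operator_eq_T T_kernel imag_vec_def inner_axis)
next
  fix f assume f: "real_analytic f \<and> (\<forall>j x. dunkl_operator Rp k j f x = imag_vec y $ j * f x) \<and> f 0 = 1"
  have df: "f differentiable (at x)" for x
    using real_analytic_differentiable f by blast
  have f': "T (axis j 1) f x = imag_vec y $ j * f x" for j x
    using f unfolding dunkl_operator_eq_T by blast
  have "T a f x = \<i> * of_real (y \<bullet> a) * f x" for a x
  proof -
    have "T a f x = (\<Sum>j\<in>UNIV. of_real (a $ j) * (imag_vec y $ j * f x))"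
      by (subst linear_axis_expansion[OF linear_T[OF df]]) (simp only: f')
    also have "\<dots> = \<i> * of_real (\<Sum>j\<in>UNIV. y $ j * a $ j) * f x"
      by (simp add: imag_vec_def sum_distrib_left sum_distrib_right mult_ac)
    finally show ?thesis by (simp add: inner_vec_def)
  qed
  note Tf = this
  have "f x - kernel y x = 0" for x
  proof (rule T_eigenfunction_unique[where y = y])
    show "(\<lambda>x. f x - kernel y x) differentiable at x" for x
      by (rule differentiable_diff[OF df differentiable_kernel])
    show "T a (\<lambda>x. f x - kernel y x) x = \<i> * of_real (y \<bullet> a) * (f x - kernel y x)" for x a
      by (simp only: T_diff[OF df differentiable_kernel] Tf T_kernel right_diff_distrib)
    show "f 0 - kernel y 0 = 0" using f by simp
  qed
  then show "f = kernel y" by (simp add: fun_eq_iff)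
qed

lemma dunkl_kernel_eq_uminus: "dunkl_kernel Rp k (- imag_vec y) = kernel (- y)"
proof -
  have "- imag_vec y = imag_vec (- y)" by (simp add: imag_vec_def vec_eq_iff)
  then show ?thesis by (simp only: dunkl_kernel_eq)
qed

text \<open>The factor \<open>exp 1\<close> is the Gronwall growth over unit time and the group
  order is the initial energy of an orbit. The number bounds the square of the kernel and, being at
  least 1, also the kernel itself.\<close>

definition kernel_bound :: real where "kernel_bound = exp 1 * real (card G)"

lemma kernel_bound_ge_1: "kernel_bound \<ge> 1"
proof -
  have "1 * 1 \<le> exp 1 * real (card G)"
    using card_G by (intro mult_mono) auto
  then show ?thesis by (simp add: kernel_bound_def)
qed

lemma norm_kernel_le: "norm (kernel y x) \<le> kernel_bound"
proof -
  have "(norm (kernel y x))\<^sup>2 \<le> exp 1 * (real (card G) * ((norm (kernel y 0))\<^sup>2 + (0 * norm x)\<^sup>2))"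
    by (rule G_energy_estimate[where \<theta> = "\<lambda>x. y \<bullet> x" and r = "\<lambda>_. 0", OF differentiable_kernel]) (auto simp: T_kernel)
  then have "(norm (kernel y x))\<^sup>2 \<le> kernel_bound" by (simp add: kernel_bound_def)
  also have "\<dots> \<le> kernel_bound\<^sup>2"
    using kernel_bound_ge_1 by (simp add: power2_eq_square)
  finally show ?thesis
    using kernel_bound_ge_1 by (simp add: abs_le_square_iff[symmetric])
qed

text \<open>The difference of two kernels vanishes at 0 and solves the equation for \<open>y\<close>
  with the error term i<y - y', x> times the kernel of y'. Boundedness of the kernel makes this
  error at most linear in x, as the energy estimate requires.\<close>

lemma kernel_lipschitz: "norm (kernel y x - kernel y' x) \<le> kernel_bound\<^sup>2 * norm (y - y') * norm x"
proof -
  have "(norm (kernel y x - kernel y' x))\<^sup>2 \<le>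
    exp 1 * (real (card G) * ((norm (kernel y 0 - kernel y' 0))\<^sup>2 + (norm (y - y') * kernel_bound * norm x)\<^sup>2))"
  proof (rule G_energy_estimate[where \<theta> = "\<lambda>x. y \<bullet> x" and r = "\<lambda>x. \<i> * of_real ((y - y') \<bullet> x) * kernel y' x"])
    show "(\<lambda>x. kernel y x - kernel y' x) differentiable at x" for x
      by (intro differentiable_diff differentiable_kernel)
    show "T x (\<lambda>x. kernel y x - kernel y' x) x = \<i> * of_real (y \<bullet> x) * (kernel y x - kernel y' x)
        + \<i> * of_real ((y - y') \<bullet> x) * kernel y' x" for x
      by (simp add: T_diff differentiable_kernel T_kernel inner_diff_left algebra_simps)
    fix x
    have "norm (\<i> * of_real ((y - y') \<bullet> x) * kernel y' x) = \<bar>(y - y') \<bullet> x\<bar> * norm (kernel y' x)"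
      by (simp add: norm_mult)
    also have "\<dots> \<le> (norm (y - y') * norm x) * kernel_bound"
      by (intro mult_mono Cauchy_Schwarz_ineq2 norm_kernel_le) auto
    finally show "norm (\<i> * of_real ((y - y') \<bullet> x) * kernel y' x) \<le> norm (y - y') * kernel_bound * norm x"
      by (simp add: mult_ac)
  qed
  also have "\<dots> = kernel_bound * (norm (y - y') * kernel_bound * norm x)\<^sup>2"
    by (simp add: kernel_bound_def)
  also have "\<dots> \<le> kernel_bound\<^sup>2 * (norm (y - y') * kernel_bound * norm x)\<^sup>2"
    using kernel_bound_ge_1 by (intro mult_right_mono) (auto simp: power2_eq_square)
  also have "\<dots> = (kernel_bound\<^sup>2 * norm (y - y') * norm x)\<^sup>2"
    by (simp add: power_mult_distrib power2_eq_square mult_ac)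
  finally show ?thesis
    using kernel_bound_ge_1 by (simp add: abs_le_square_iff[symmetric] abs_mult)
qed

lemma kernel_lipschitz': "norm (kernel y x - kernel y x') \<le> kernel_bound\<^sup>2 * norm (x - x') * norm y"
  using kernel_lipschitz[of x y x'] by (simp add: kernel_commute[of y])

text \<open>The gradient inherits the Lipschitz constant, so it grows at most linearly in
  \<open>y\<close>, uniformly in \<open>x\<close>.\<close>

lemma norm_dir_deriv_kernel: "norm (dir_deriv a (kernel y) x) \<le> kernel_bound\<^sup>2 * norm y * norm a"
  by (rule norm_dir_deriv_le_lipschitz[OF differentiable_kernel])
    (use kernel_lipschitz'[of y] in \<open>simp add: mult_ac\<close>)

lemma continuous_kernel: "continuous_on S (kernel y)"
  using differentiable_kernel differentiable_imp_continuous_within continuous_at_imp_continuous_on by blast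

lemma continuous_kernel': "continuous_on S (\<lambda>y. kernel y x)"
  using continuous_kernel[of S x] by (simp add: kernel_commute[of x])

lemma kernel_measurable [measurable]: "kernel y \<in> borel_measurable borel"
  by (rule borel_measurable_continuous_onI[OF continuous_kernel])

lemma kernel_measurable' [measurable]: "(\<lambda>y. kernel y x) \<in> borel_measurable borel"
  by (rule borel_measurable_continuous_onI[OF continuous_kernel'])

end

section \<open>Growth, decay and integration\<close>

definition poly_bounded :: "('a::real_normed_vector \<Rightarrow> 'b::real_normed_vector) \<Rightarrow> bool" where
  "poly_bounded f \<longleftrightarrow> (\<exists>C K. \<forall>x. norm (f x) \<le> C * (1 + norm x) ^ K)"

definition rapid :: "('a::real_normed_vector \<Rightarrow> 'b::real_normed_vector) \<Rightarrow> bool" where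
  "rapid f \<longleftrightarrow> (\<forall>m. \<exists>C. \<forall>x. norm (f x) * (1 + norm x) ^ m \<le> C)"

lemma poly_boundedI: "(\<And>x. norm (f x) \<le> C * (1 + norm x) ^ K) \<Longrightarrow> poly_bounded f"
  by (auto simp: poly_bounded_def)

lemma poly_boundedE:
  assumes "poly_bounded f"
  obtains C K where "C \<ge> 0" "\<And>x. norm (f x) \<le> C * (1 + norm x) ^ K"
proof -
  obtain C K where CK: "\<And>x. norm (f x) \<le> C * (1 + norm x) ^ K"
    using assms by (auto simp: poly_bounded_def)
  have "0 \<le> norm (f 0)" by simp
  also have "\<dots> \<le> C" using CK[of 0] by simp
  finally show thesis using CK that by blast
qed

lemma poly_bounded_const: "poly_bounded (\<lambda>x. c)"
  unfolding poly_bounded_def by (rule exI[of _ "norm c"], rule exI[of _ 0]) simp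

lemma poly_bounded_le:
  assumes "poly_bounded f" "\<And>x. norm (g x) \<le> norm (f x)"
  shows "poly_bounded g"
proof -
  obtain C K where CK: "\<And>x. norm (f x) \<le> C * (1 + norm x) ^ K"
    using assms(1) by (auto simp: poly_bounded_def)
  show ?thesis by (rule poly_boundedI) (rule order_trans[OF assms(2) CK])
qed

lemma poly_bounded_add:
  assumes "poly_bounded f" "poly_bounded g"
  shows "poly_bounded (\<lambda>x. f x + g x)"
proof -
  obtain C K where f: "C \<ge> 0" "\<And>x. norm (f x) \<le> C * (1 + norm x) ^ K"
    using poly_boundedE[OF assms(1)] by blast
  obtain D L where g: "D \<ge> 0" "\<And>x. norm (g x) \<le> D * (1 + norm x) ^ L"
    using poly_boundedE[OF assms(2)] by blast
  show ?thesis
  proof (rule poly_boundedI)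
    fix x
    have "norm (f x + g x) \<le> C * (1 + norm x) ^ K + D * (1 + norm x) ^ L"
      using norm_triangle_ineq[of "f x" "g x"] f(2)[of x] g(2)[of x] by linarith
    also have "\<dots> \<le> C * (1 + norm x) ^ (K + L) + D * (1 + norm x) ^ (K + L)"
      using f(1) g(1) by (intro add_mono mult_left_mono power_increasing) auto
    finally show "norm (f x + g x) \<le> (C + D) * (1 + norm x) ^ (K + L)"
      by (simp add: distrib_right)
  qed
qed

lemma poly_bounded_mult_le:
  assumes "poly_bounded f" "poly_bounded g" "\<And>x. norm (h x) \<le> norm (f x) * norm (g x)"
  shows "poly_bounded h"
proof -
  obtain C K where f: "C \<ge> 0" "\<And>x. norm (f x) \<le> C * (1 + norm x) ^ K"
    using poly_boundedE[OF assms(1)] by blast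
  obtain D L where g: "D \<ge> 0" "\<And>x. norm (g x) \<le> D * (1 + norm x) ^ L"
    using poly_boundedE[OF assms(2)] by blast
  show ?thesis
  proof (rule poly_boundedI)
    fix x
    have "norm (h x) \<le> (C * (1 + norm x) ^ K) * (D * (1 + norm x) ^ L)"
      using f(1) by (intro order_trans[OF assms(3)] mult_mono f g) auto
    then show "norm (h x) \<le> (C * D) * (1 + norm x) ^ (K + L)"
      by (simp add: power_add mult_ac)
  qed
qed

lemma poly_bounded_mult:
  fixes f g :: "'a::real_normed_vector \<Rightarrow> 'b::real_normed_algebra"
  shows "poly_bounded f \<Longrightarrow> poly_bounded g \<Longrightarrow> poly_bounded (\<lambda>x. f x * g x)"
  by (rule poly_bounded_mult_le[of f g]) (auto intro: norm_mult_ineq)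

lemma poly_bounded_sum:
  assumes "finite A" "\<And>i. i \<in> A \<Longrightarrow> poly_bounded (f i)"
  shows "poly_bounded (\<lambda>x. \<Sum>i\<in>A. f i x)"
  using assms by (induction A rule: finite_induct) (auto intro: poly_bounded_const poly_bounded_add)

lemma poly_bounded_inner: "poly_bounded (\<lambda>x. c \<bullet> x)"
proof (rule poly_boundedI[of _ "norm c" 1])
  fix x
  show "norm (c \<bullet> x) \<le> norm c * (1 + norm x) ^ 1"
    using Cauchy_Schwarz_ineq2[of c x] mult_left_mono[of "norm x" "1 + norm x" "norm c"] by simp
qed

lemma poly_bounded_of_real:
  "poly_bounded f \<Longrightarrow> poly_bounded (\<lambda>x. of_real (f x) :: complex)"
  by (erule poly_bounded_le) simp

lemma rapid_poly_bounded: "rapid f \<Longrightarrow> poly_bounded f"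
  unfolding rapid_def poly_bounded_def
  by (drule spec[of _ 0], erule exE, rule_tac x = C in exI, rule exI[of _ 0]) simp

lemma rapid_le:
  assumes "rapid f" "\<And>x. norm (g x) \<le> norm (f x)"
  shows "rapid g"
  unfolding rapid_def
proof
  fix m
  obtain C where C: "\<And>x. norm (f x) * (1 + norm x) ^ m \<le> C"
    using assms(1) unfolding rapid_def by blast
  have "norm (g x) * (1 + norm x) ^ m \<le> C" for x
    by (rule order_trans[OF mult_right_mono[OF assms(2)] C]) simp
  then show "\<exists>C. \<forall>x. norm (g x) * (1 + norm x) ^ m \<le> C" by blast
qed

lemma rapid_mult_le:
  assumes f: "rapid f" and g: "poly_bounded g" and le: "\<And>x. norm (h x) \<le> norm (f x) * norm (g x)"
  shows "rapid h"
  unfolding rapid_def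
proof
  fix m
  obtain D L where D: "D \<ge> 0" "\<And>x. norm (g x) \<le> D * (1 + norm x) ^ L"
    using poly_boundedE[OF g] by blast
  obtain C where C: "\<And>x. norm (f x) * (1 + norm x) ^ (L + m) \<le> C"
    using f unfolding rapid_def by blast
  have "norm (h x) * (1 + norm x) ^ m \<le> D * C" for x
  proof -
    have "norm (h x) * (1 + norm x) ^ m \<le> (norm (f x) * (D * (1 + norm x) ^ L)) * (1 + norm x) ^ m"
      by (intro mult_right_mono order_trans[OF le] mult_left_mono D) auto
    also have "\<dots> = D * (norm (f x) * (1 + norm x) ^ (L + m))"
      by (simp add: power_add mult_ac)
    also have "\<dots> \<le> D * C" by (intro mult_left_mono C D)
    finally show ?thesis .
  qed
  then show "\<exists>C. \<forall>x. norm (h x) * (1 + norm x) ^ m \<le> C" by blast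
qed

lemma rapid_mult:
  fixes f g :: "'a::real_normed_vector \<Rightarrow> 'b::real_normed_algebra"
  shows "rapid f \<Longrightarrow> poly_bounded g \<Longrightarrow> rapid (\<lambda>x. f x * g x)"
  by (rule rapid_mult_le[of f g]) (auto intro: norm_mult_ineq)

lemma rapid_mult':
  fixes f g :: "'a::real_normed_vector \<Rightarrow> 'b::{real_normed_algebra,comm_ring}"
  shows "poly_bounded f \<Longrightarrow> rapid g \<Longrightarrow> rapid (\<lambda>x. f x * g x)"
  using rapid_mult[of g f] by (simp add: mult.commute)

lemma rapid_add:
  assumes "rapid f" "rapid g"
  shows "rapid (\<lambda>x. f x + g x)"
  unfolding rapid_def
proof
  fix m
  obtain C where C: "\<And>x. norm (f x) * (1 + norm x) ^ m \<le> C"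
    using assms(1) unfolding rapid_def by blast
  obtain D where D: "\<And>x. norm (g x) * (1 + norm x) ^ m \<le> D"
    using assms(2) unfolding rapid_def by blast
  have "norm (f x + g x) * (1 + norm x) ^ m \<le> C + D" for x
    using mult_right_mono[OF norm_triangle_ineq[of "f x" "g x"], of "(1 + norm x) ^ m"] C[of x] D[of x]
    by (simp add: distrib_right)
  then show "\<exists>C. \<forall>x. norm (f x + g x) * (1 + norm x) ^ m \<le> C" by blast
qed

lemma rapid_cmult:
  fixes f :: "'a::real_normed_vector \<Rightarrow> 'b::{real_normed_algebra,comm_ring}"
  shows "rapid f \<Longrightarrow> rapid (\<lambda>x. c * f x)"
  by (rule rapid_mult'[OF poly_bounded_const])

lemma rapid_gaussian:
  assumes "\<delta> > 0"
  shows "rapid (\<lambda>x :: 'a::real_normed_vector. exp (- \<delta> * (norm x)\<^sup>2))"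
  unfolding rapid_def
proof
  fix m :: nat
  have "norm (exp (- \<delta> * (norm x)\<^sup>2)) * (1 + norm x) ^ m \<le> exp ((real m)\<^sup>2 / (4 * \<delta>))" for x :: 'a
  proof -
    have "(1 + norm x) ^ m \<le> exp (norm x) ^ m"
      by (intro power_mono exp_ge_add_one_self) auto
    also have "\<dots> = exp (real m * norm x)" by (simp add: exp_of_nat_mult)
    finally have "norm (exp (- \<delta> * (norm x)\<^sup>2)) * (1 + norm x) ^ m \<le> exp (- \<delta> * (norm x)\<^sup>2) * exp (real m * norm x)"
      by simp
    also have "\<dots> \<le> exp ((real m)\<^sup>2 / (4 * \<delta>))"
    proof -
      \<comment> \<open>The constant is the maximum of m r - \<delta> r^2 over r, found by
        completing the square.\<close>
      have "0 \<le> (2 * \<delta> * norm x - real m)\<^sup>2" by simp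
      also have "\<dots> = 4 * \<delta> * (\<delta> * (norm x)\<^sup>2 - real m * norm x) + (real m)\<^sup>2"
        by (simp add: power2_diff power_mult_distrib power2_eq_square algebra_simps)
      finally have "real m * norm x - \<delta> * (norm x)\<^sup>2 \<le> (real m)\<^sup>2 / (4 * \<delta>)"
        using assms by (subst pos_le_divide_eq) (auto simp: algebra_simps)
      then show ?thesis by (simp add: exp_add[symmetric])
    qed
    finally show ?thesis .
  qed
  then show "\<exists>C. \<forall>x :: 'a. norm (exp (- \<delta> * (norm x)\<^sup>2)) * (1 + norm x) ^ m \<le> C" by blast
qed

lemma integrable_inverse_one_plus_square: "integrable lborel (\<lambda>x::real. inverse (1 + x\<^sup>2))"
proof -
  have "set_integrable lborel (einterval (-\<infinity>) \<infinity>) (\<lambda>x::real. inverse (1 + x\<^sup>2))"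
  proof (rule interval_integral_FTC_nonneg)
    show "((arctan \<circ> real_of_ereal) \<longlongrightarrow> - (pi / 2)) (at_right (-\<infinity>))"
      unfolding ereal_tendsto_simps by (rule tendsto_arctan_at_bot)
    show "((arctan \<circ> real_of_ereal) \<longlongrightarrow> pi / 2) (at_left \<infinity>)"
      unfolding ereal_tendsto_simps by (rule tendsto_arctan_at_top)
    show "isCont (\<lambda>x. inverse (1 + x\<^sup>2)) x" for x :: real
      by (intro continuous_intros) (simp add: add_nonneg_eq_0_iff)
  qed (auto intro: DERIV_arctan)
  then show ?thesis by (simp add: set_integrable_def)
qed

text \<open>Comparison with the product over the coordinates of 1 / (1 + s^2). Each factor 1 + s^2
  is at most (1 + |x|)^2, which explains an exponent of twice the dimension.\<close>

lemma integrable_one_plus_norm_power: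
  "integrable lborel (\<lambda>x :: real ^ 'n. inverse ((1 + norm x) ^ (2 * DIM(real ^ 'n))))"
proof -
  interpret P: product_sigma_finite "\<lambda>_ :: real ^ 'n. lborel :: real measure" ..
  let ?p = "\<lambda>x :: real ^ 'n. \<Prod>b\<in>Basis. inverse (1 + (x \<bullet> b)\<^sup>2)"
  have "integrable (\<Pi>\<^sub>M b\<in>(Basis :: (real ^ 'n) set). lborel) (\<lambda>x. \<Prod>b\<in>Basis. inverse (1 + (x b)\<^sup>2) :: real)"
    by (intro P.product_integrable_prod integrable_inverse_one_plus_square) auto
  also have "(\<lambda>x. \<Prod>b\<in>Basis. inverse (1 + (x b)\<^sup>2) :: real) = (\<lambda>x. ?p (\<Sum>b\<in>Basis. x b *\<^sub>R b))"
    by (intro ext prod.cong HOL.refl) (simp add: inner_sum_left_Basis)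
  finally have "integrable (distr (\<Pi>\<^sub>M b\<in>(Basis :: (real ^ 'n) set). lborel) borel (\<lambda>f. \<Sum>b\<in>Basis. f b *\<^sub>R b)) ?p"
    by (subst integrable_distr_eq) auto
  then have "integrable lborel ?p" by (subst lborel_eq)
  then show ?thesis
  proof (rule Bochner_Integration.integrable_bound)
    show "AE x :: real ^ 'n in lborel. norm (inverse ((1 + norm x) ^ (2 * DIM(real ^ 'n)))) \<le> norm (?p x)"
    proof (rule AE_I2)
      fix x :: "real ^ 'n"
      have "(\<Prod>b\<in>(Basis :: (real ^ 'n) set). 1 + (x \<bullet> b)\<^sup>2) \<le> (\<Prod>b\<in>(Basis :: (real ^ 'n) set). (1 + norm x)\<^sup>2)"
      proof (intro prod_mono conjI)
        fix b :: "real ^ 'n" assume "b \<in> Basis"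
        then have "(x \<bullet> b)\<^sup>2 \<le> (norm x)\<^sup>2"
          using Basis_le_norm[of b x] abs_le_square_iff[of "x \<bullet> b" "norm x"] by simp
        then show "1 + (x \<bullet> b)\<^sup>2 \<le> (1 + norm x)\<^sup>2"
          by (simp add: power2_sum add_increasing2)
      qed simp
      then have "(\<Prod>b\<in>(Basis :: (real ^ 'n) set). 1 + (x \<bullet> b)\<^sup>2) \<le> (1 + norm x) ^ (2 * DIM(real ^ 'n))"
        by (simp add: power_mult)
      moreover have "0 < (\<Prod>b\<in>(Basis :: (real ^ 'n) set). 1 + (x \<bullet> b)\<^sup>2)"
        by (intro prod_pos) (simp add: add_pos_nonneg)
      ultimately have "inverse ((1 + norm x) ^ (2 * DIM(real ^ 'n))) \<le> ?p x"
        using le_imp_inverse_le prod_inversef[of "\<lambda>b. 1 + (x \<bullet> b)\<^sup>2" Basis] by (simp add: o_def)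
      moreover have "0 \<le> ?p x" by (intro prod_nonneg) simp
      ultimately show "norm (inverse ((1 + norm x) ^ (2 * DIM(real ^ 'n)))) \<le> norm (?p x)"
        by simp
    qed
  qed measurable
qed

lemma rapid_dominated:
  fixes f :: "real ^ 'n \<Rightarrow> 'b::real_normed_vector"
  assumes "rapid f"
  obtains C where "\<And>x. norm (f x) \<le> C * inverse ((1 + norm x) ^ (2 * DIM(real ^ 'n)))"
proof -
  obtain C where "\<And>x. norm (f x) * (1 + norm x) ^ (2 * DIM(real ^ 'n)) \<le> C"
    using assms unfolding rapid_def by blast
  moreover have "(1 + norm x) ^ (2 * DIM(real ^ 'n)) > 0" for x :: "real ^ 'n"
    by (simp add: add_pos_nonneg)
  ultimately have "norm (f x) \<le> C * inverse ((1 + norm x) ^ (2 * DIM(real ^ 'n)))" for x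
    by (simp add: pos_le_divide_eq divide_inverse[symmetric])
  then show thesis using that by blast
qed

lemma integrable_rapid:
  fixes f :: "real ^ 'n \<Rightarrow> 'b::{banach,second_countable_topology}"
  assumes "rapid f" and [measurable]: "f \<in> borel_measurable borel"
  shows "integrable lborel f"
proof -
  obtain C where C: "\<And>x. norm (f x) \<le> C * inverse ((1 + norm x) ^ (2 * DIM(real ^ 'n)))"
    using rapid_dominated[OF assms(1)] by blast
  show ?thesis
  proof (rule Bochner_Integration.integrable_bound)
    show "integrable lborel (\<lambda>x :: real ^ 'n. C * inverse ((1 + norm x) ^ (2 * DIM(real ^ 'n))))"
      by (intro integrable_mult_right integrable_one_plus_norm_power)
    show "AE x in lborel. norm (f x) \<le> norm (C * inverse ((1 + norm x) ^ (2 * DIM(real ^ 'n))))"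
      using C order_trans[OF C abs_ge_self] by simp
  qed measurable
qed

section \<open>Translations and reflections preserve Lebesgue measure\<close>

lemma integral_lborel_translate:
  fixes f :: "'a::euclidean_space \<Rightarrow> 'b::{banach,second_countable_topology}"
  assumes [measurable]: "f \<in> borel_measurable borel"
  shows "(LINT x|lborel. f (x + c)) = (LINT x|lborel. f x)"
proof -
  have "(LINT x|lborel. f x) = (LINT x|distr lborel borel ((+) c). f x)"
    by (simp only: lborel_distr_plus)
  also have "\<dots> = (LINT x|lborel. f (c + x))"
    by (rule integral_distr) auto
  finally show ?thesis by (simp add: add.commute)
qed

lemma nn_integral_lborel_translate:
  fixes f :: "'a::euclidean_space \<Rightarrow> ennreal"
  assumes [measurable]: "f \<in> borel_measurable borel"
  shows "(\<integral>\<^sup>+x. f (x + c) \<partial>lborel) = (\<integral>\<^sup>+x. f x \<partial>lborel)"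
proof -
  have "(\<integral>\<^sup>+x. f x \<partial>lborel) = (\<integral>\<^sup>+x. f x \<partial>distr lborel borel ((+) c))"
    by (simp only: lborel_distr_plus)
  also have "\<dots> = (\<integral>\<^sup>+x. f (c + x) \<partial>lborel)"
    by (rule nn_integral_distr) auto
  finally show ?thesis by (simp add: add.commute)
qed

lemma reflect_along_measurable [measurable]: "reflect_along v \<in> borel_measurable borel"
  by (intro borel_measurable_continuous_onI linear_continuous_on reflect_along_bounded_linear)

text \<open>Uniqueness of translation invariant measures: convolve with the indicator of a ball, which the
  reflection preserves. (The change of variables theorems in the library need a well-ordered index type.)\<close>

lemma nn_integral_lborel_reflect:
  fixes f :: "real ^ 'n \<Rightarrow> ennreal"
  assumes [measurable]: "f \<in> borel_measurable borel"
  shows "(\<integral>\<^sup>+x. f (reflect_along v x) \<partial>lborel) = (\<integral>\<^sup>+x. f x \<partial>lborel)"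
proof -
  let ?s = "reflect_along v"
  define \<phi> :: "real ^ 'n \<Rightarrow> ennreal" where "\<phi> = indicator (ball 0 1)"
  have [measurable]: "\<phi> \<in> borel_measurable borel"
    unfolding \<phi>_def by (intro borel_measurable_indicator) simp
  define \<beta> where "\<beta> = emeasure lborel (ball (0 :: real ^ 'n) 1)"
  have ball: "emeasure lborel (ball y 1) = \<beta>" for y :: "real ^ 'n"
    by (simp add: \<beta>_def emeasure_ball)
  have \<beta>: "\<beta> \<noteq> 0" "\<beta> \<noteq> \<infinity>"
    by (auto simp: \<beta>_def emeasure_ball unit_ball_vol_pos less_imp_neq[symmetric])
  have g: "(\<integral>\<^sup>+x. \<phi> x \<partial>lborel) = \<beta>"
    by (simp add: \<beta>_def \<phi>_def)
  have g': "(\<integral>\<^sup>+x. \<phi> (y - ?s x) \<partial>lborel) = \<beta>" for y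
  proof -
    have "\<phi> (y - ?s x) = indicator (ball (?s y) 1) x" for x
    proof -
      have "norm (y - ?s x) = norm (?s (y - ?s x))" by simp
      also have "\<dots> = dist (?s y) x" by (simp add: linear_diff dist_norm del: norm_reflect_along)
      finally show ?thesis by (simp add: indicator_def \<phi>_def)
    qed
    then show ?thesis by (simp add: ball)
  qed
  have "(\<integral>\<^sup>+x. f (?s x) \<partial>lborel) * \<beta> = (\<integral>\<^sup>+y. (\<integral>\<^sup>+x. f (?s x) \<partial>lborel) * \<phi> y \<partial>lborel)"
    by (subst nn_integral_cmult) (auto simp: g)
  also have "\<dots> = (\<integral>\<^sup>+y. (\<integral>\<^sup>+x. f (?s (x + ?s y)) \<partial>lborel) * \<phi> y \<partial>lborel)"
    using nn_integral_lborel_translate[of "\<lambda>x. f (?s x)"] by simp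
  also have "\<dots> = (\<integral>\<^sup>+y. (\<integral>\<^sup>+x. f (?s x + y) * \<phi> y \<partial>lborel) \<partial>lborel)"
    by (simp add: linear_add nn_integral_multc)
  also have "\<dots> = (\<integral>\<^sup>+x. (\<integral>\<^sup>+y. f (?s x + y) * \<phi> y \<partial>lborel) \<partial>lborel)"
    by (rule lborel_pair.Fubini') measurable
  also have "\<dots> = (\<integral>\<^sup>+x. (\<integral>\<^sup>+y. f y * \<phi> (y - ?s x) \<partial>lborel) \<partial>lborel)"
  proof (rule nn_integral_cong)
    fix x
    show "(\<integral>\<^sup>+y. f (?s x + y) * \<phi> y \<partial>lborel) = (\<integral>\<^sup>+y. f y * \<phi> (y - ?s x) \<partial>lborel)"
      using nn_integral_lborel_translate[of "\<lambda>y. f y * \<phi> (y - ?s x)" "?s x"]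
      by (simp add: add.commute)
  qed
  also have "\<dots> = (\<integral>\<^sup>+y. (\<integral>\<^sup>+x. f y * \<phi> (y - ?s x) \<partial>lborel) \<partial>lborel)"
    by (rule lborel_pair.Fubini') measurable
  also have "\<dots> = (\<integral>\<^sup>+y. f y * \<beta> \<partial>lborel)"
    by (subst nn_integral_cmult) (auto simp: g')
  also have "\<dots> = (\<integral>\<^sup>+y. f y \<partial>lborel) * \<beta>"
    by (rule nn_integral_multc) measurable
  finally show ?thesis
    using \<beta> ennreal_mult_divide_eq by (metis infinity_ennreal_def)
qed

lemma lborel_distr_reflect: "distr lborel borel (reflect_along v) = lborel"
proof (rule measure_eqI)
  fix A assume "A \<in> sets (distr lborel borel (reflect_along v))"
  then have [measurable]: "A \<in> sets borel" by simp
  have "emeasure (distr lborel borel (reflect_along v)) A = (\<integral>\<^sup>+x. indicator A x \<partial>distr lborel borel (reflect_along v))"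
    by simp
  also have "\<dots> = (\<integral>\<^sup>+x. indicator A (reflect_along v x) \<partial>lborel)"
    by (rule nn_integral_distr) auto
  also have "\<dots> = (\<integral>\<^sup>+x. indicator A x \<partial>lborel)"
    by (rule nn_integral_lborel_reflect) measurable
  finally show "emeasure (distr lborel borel (reflect_along v)) A = emeasure lborel A" by simp
qed simp

lemma integral_lborel_reflect_odd:
  fixes f :: "real ^ 'n \<Rightarrow> complex"
  assumes [measurable]: "f \<in> borel_measurable borel"
    and odd: "\<And>x. f (reflect_along v x) = - f x"
  shows "(LINT x|lborel. f x) = 0"
proof -
  have "(LINT x|lborel. f x) = (LINT x|distr lborel borel (reflect_along v). f x)"
    by (simp only: lborel_distr_reflect)
  also have "\<dots> = (LINT x|lborel. f (reflect_along v x))"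
    by (rule integral_distr) auto
  finally have "(LINT x|lborel. f x) = - (LINT x|lborel. f x)" by (simp add: odd)
  then show ?thesis by simp
qed

lemma differentiable_borel_measurable:
  fixes f :: "real ^ 'n \<Rightarrow> complex"
  assumes "\<And>x. f differentiable (at x)"
  shows "f \<in> borel_measurable borel"
  using assms differentiable_imp_continuous_within continuous_at_imp_continuous_on
  by (intro borel_measurable_continuous_onI) blast

lemma dir_deriv_LIMSEQ:
  assumes "f differentiable (at x)"
  shows "(\<lambda>n. of_nat (Suc n) * (f (x + (1 / real (Suc n)) *\<^sub>R a) - f x)) \<longlonglongrightarrow> dir_deriv a f x"
proof -
  have "filterlim (\<lambda>n. 1 / real (Suc n)) (at 0) sequentially"
    unfolding filterlim_at using LIMSEQ_inverse_real_of_nat by (auto simp: inverse_eq_divide)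
  from filterlim_compose[OF dir_deriv_limit[OF assms] this]
  show ?thesis by (simp add: scaleR_conv_of_real[where 'a = complex])
qed

lemma dir_deriv_measurable:
  fixes f :: "real ^ 'n \<Rightarrow> complex"
  assumes "\<And>x. f differentiable (at x)"
  shows "dir_deriv a f \<in> borel_measurable borel"
proof -
  note [measurable] = differentiable_borel_measurable[OF assms]
  show ?thesis
    by (rule borel_measurable_LIMSEQ_metric[where f = "\<lambda>n x. of_nat (Suc n) * (f (x + (1 / real (Suc n)) *\<^sub>R a) - f x)"])
      (measurable, rule dir_deriv_LIMSEQ[OF assms])
qed

lemma dir_deriv_mean_value:
  assumes "\<And>x. f differentiable (at x)"
  obtains s where "0 < s" "s < 1" "norm (f (x + v) - f x) \<le> norm (dir_deriv v f (x + s *\<^sub>R v))"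
proof -
  have der: "((\<lambda>t. f (x + t *\<^sub>R v)) has_derivative (\<lambda>d. dir_deriv (d *\<^sub>R v) f (x + t *\<^sub>R v))) (at t)" for t
    by (rule has_derivative_compose[OF _ has_derivative_dir_deriv[OF assms]]) (auto intro!: derivative_eq_intros)
  have "\<exists>s\<in>{0<..<1}. norm (f (x + 1 *\<^sub>R v) - f (x + 0 *\<^sub>R v)) \<le> norm (dir_deriv ((1 - 0) *\<^sub>R v) f (x + s *\<^sub>R v))"
  proof (rule mvt_general)
    show "continuous_on {0..1} (\<lambda>t. f (x + t *\<^sub>R v))"
      by (intro continuous_at_imp_continuous_on ballI has_derivative_continuous[OF der])
  qed (use der in auto)
  then show thesis using that by auto
qed

text \<open>By translation invariance the difference quotients with step 1 / (n + 1) have integral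
  zero, and dominated convergence passes to the derivative.\<close>

lemma integral_dir_deriv_eq_0:
  fixes f :: "real ^ 'n \<Rightarrow> complex"
  assumes diff: "\<And>x. f differentiable (at x)" and f: "rapid f" and f': "rapid (dir_deriv a f)"
  shows "(LINT x|lborel. dir_deriv a f x) = 0"
proof -
  note [measurable] = differentiable_borel_measurable[OF diff] dir_deriv_measurable[OF diff]
  define D where "D n x = of_nat (Suc n) * (f (x + (1 / real (Suc n)) *\<^sub>R a) - f x)" for n x
  define N where "N = 2 * DIM(real ^ 'n)"
  obtain C where C: "\<And>x. norm (dir_deriv a f x) * (1 + norm x) ^ N \<le> C"
    using f' unfolding rapid_def by blast
  have int0: "(LINT x|lborel. D n x) = 0" for n
  proof -
    have i: "integrable lborel f" by (rule integrable_rapid[OF f]) measurable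
    let ?h = "(1 / real (Suc n)) *\<^sub>R a"
    have tr: "(LINT x|lborel. f (x + ?h)) = (LINT x|lborel. f x)"
      by (rule integral_lborel_translate) measurable
    have "integrable (distr lborel borel ((+) ?h)) f" using i by (simp only: lborel_distr_plus)
    then have i': "integrable lborel (\<lambda>x. f (x + ?h))"
      by (subst (asm) integrable_distr_eq) (auto simp: add.commute)
    show ?thesis
      unfolding D_def by (simp only: Bochner_Integration.integral_mult_right_zero Bochner_Integration.integral_diff[OF i' i] tr) simp
  qed
  have "(\<lambda>n. LINT x|lborel. D n x) \<longlonglongrightarrow> (LINT x|lborel. dir_deriv a f x)"
  proof (rule integral_dominated_convergence[where w = "\<lambda>x. (C * (1 + norm a) ^ N) * inverse ((1 + norm x) ^ N)"])
    show "integrable lborel (\<lambda>x :: real ^ 'n. (C * (1 + norm a) ^ N) * inverse ((1 + norm x) ^ N))"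
      unfolding N_def by (intro integrable_mult_right integrable_one_plus_norm_power)
    show "AE x in lborel. (\<lambda>n. D n x) \<longlonglongrightarrow> dir_deriv a f x"
      unfolding D_def using dir_deriv_LIMSEQ[OF diff] by simp
    fix n
    show "AE x in lborel. norm (D n x) \<le> (C * (1 + norm a) ^ N) * inverse ((1 + norm x) ^ N)"
    proof (rule AE_I2)
      fix x
      define h where "h = 1 / real (Suc n)"
      have h: "0 < h" "h \<le> 1" by (auto simp: h_def)
      obtain s where s: "0 < s" "s < 1" "norm (f (x + h *\<^sub>R a) - f x) \<le> norm (dir_deriv (h *\<^sub>R a) f (x + s *\<^sub>R h *\<^sub>R a))"
        using dir_deriv_mean_value[OF diff] by blast
      define y where "y = x + s *\<^sub>R h *\<^sub>R a"
      have "norm (D n x) = norm (f (x + h *\<^sub>R a) - f x) / h"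
        by (simp add: D_def norm_mult h_def del: of_nat_Suc)
      also have "\<dots> \<le> norm (dir_deriv (h *\<^sub>R a) f y) / h"
        using s(3) h by (intro divide_right_mono) (auto simp: y_def)
      also have "\<dots> = norm (dir_deriv a f y)"
        using h by (simp add: linear_cmul[OF linear_dir_deriv[OF diff]])
      also have "\<dots> \<le> (C * (1 + norm a) ^ N) * inverse ((1 + norm x) ^ N)"
      proof -
        \<comment> \<open>Moving the point by at most |a| changes (1 + |x|)^N by no more than the
          factor (1 + |a|)^N, so a single majorant serves all n.\<close>
        have "norm x \<le> norm y + norm (s *\<^sub>R h *\<^sub>R a)"
          using norm_triangle_ineq4[of y "s *\<^sub>R h *\<^sub>R a"] by (simp add: y_def)
        also have "norm (s *\<^sub>R h *\<^sub>R a) \<le> 1 * norm a"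
          using s h mult_right_mono[OF mult_le_one[of s h], of "norm a"] by (simp add: mult.assoc)
        finally have "1 + norm x \<le> 1 + norm y + norm a" by simp
        also have "\<dots> \<le> (1 + norm y) * (1 + norm a)" by (simp add: algebra_simps)
        finally have "(1 + norm x) ^ N \<le> ((1 + norm y) * (1 + norm a)) ^ N"
          by (intro power_mono) auto
        then have "norm (dir_deriv a f y) * (1 + norm x) ^ N \<le> norm (dir_deriv a f y) * (1 + norm y) ^ N * (1 + norm a) ^ N"
          by (simp add: power_mult_distrib mult.assoc mult_left_mono)
        also have "\<dots> \<le> C * (1 + norm a) ^ N"
          by (intro mult_right_mono C) simp
        finally have *: "norm (dir_deriv a f y) * (1 + norm x) ^ N \<le> C * (1 + norm a) ^ N" .
        have "0 < (1 + norm x) ^ N" by (simp add: add_pos_nonneg)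
        with * show ?thesis by (simp add: pos_le_divide_eq divide_inverse[symmetric])
      qed
      finally show "norm (D n x) \<le> (C * (1 + norm a) ^ N) * inverse ((1 + norm x) ^ N)" .
    qed
  qed (auto simp: D_def)
  then have "(\<lambda>n. 0 :: complex) \<longlonglongrightarrow> (LINT x|lborel. dir_deriv a f x)" by (simp add: int0)
  then show ?thesis using LIMSEQ_unique tendsto_const by blast
qed

section \<open>Antisymmetry of the Dunkl operators\<close>

text \<open>A class containing both the Schwartz functions and the kernel. The gradient bound is
  uniform in the direction so that it can be used along the segment between a point and its mirror
  image, whose direction is scaled by the point.\<close>

definition moderate :: "(real ^ 'n \<Rightarrow> complex) \<Rightarrow> bool" where
  "moderate f \<longleftrightarrow> (\<forall>x. f differentiable (at x)) \<and> poly_bounded f \<and>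
     (\<exists>C K. \<forall>a x. norm (dir_deriv a f x) \<le> C * norm a * (1 + norm x) ^ K)"

lemma moderate_differentiable: "moderate f \<Longrightarrow> f differentiable (at x)"
  by (simp add: moderate_def)

lemma moderate_poly_bounded: "moderate f \<Longrightarrow> poly_bounded f"
  by (simp add: moderate_def)

lemma moderate_gradient:
  assumes "moderate f"
  shows "\<exists>C K. C \<ge> 0 \<and> (\<forall>a x. norm (dir_deriv a f x) \<le> C * norm a * (1 + norm x) ^ K)"
proof -
  obtain C K where C: "\<And>a x. norm (dir_deriv a f x) \<le> C * norm a * (1 + norm x) ^ K"
    using assms by (auto simp: moderate_def)
  have "0 \<le> norm (dir_deriv (axis undefined 1) f 0)" by simp
  also have "\<dots> \<le> C" using C[of "axis undefined 1" 0] by simp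
  finally show ?thesis using C by blast
qed

lemma moderate_measurable: "moderate f \<Longrightarrow> f \<in> borel_measurable borel"
  by (simp add: differentiable_borel_measurable moderate_def)

lemma moderate_dir_deriv_measurable: "moderate f \<Longrightarrow> dir_deriv a f \<in> borel_measurable borel"
  by (simp add: dir_deriv_measurable moderate_def)

lemma moderate_dir_deriv_poly_bounded:
  assumes "moderate f"
  shows "poly_bounded (dir_deriv a f)"
proof -
  obtain C K where "C \<ge> 0" "\<And>a x. norm (dir_deriv a f x) \<le> C * norm a * (1 + norm x) ^ K"
    using moderate_gradient[OF assms] by blast
  then have "norm (dir_deriv a f x) \<le> (C * norm a) * (1 + norm x) ^ K" for x by blast
  then show ?thesis unfolding poly_bounded_def by blast
qed

lemma dunkl_quotient_measurable:
  assumes "moderate f"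
  shows "dunkl_quotient v f \<in> borel_measurable borel"
proof -
  note [measurable] = moderate_measurable[OF assms] moderate_dir_deriv_measurable[OF assms]
  show ?thesis unfolding dunkl_quotient_def[abs_def] by measurable
qed

text \<open>The segment from the mirror image to \<open>x\<close> has length 2 |v . x| / |v|, so the
  mean value bound cancels the denominator. The segment stays in the ball of radius |x|, which keeps
  the polynomial growth.\<close>

lemma dunkl_quotient_poly_bounded:
  assumes f: "moderate f" and v: "v \<noteq> 0"
  shows "poly_bounded (dunkl_quotient v f)"
proof -
  note diff = moderate_differentiable[OF f]
  obtain C K where C: "C \<ge> 0" "\<And>a x. norm (dir_deriv a f x) \<le> C * norm a * (1 + norm x) ^ K"
    using moderate_gradient[OF f] by blast
  have nv: "norm v > 0" using v by simp
  show ?thesis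
  proof (rule poly_boundedI)
    fix x
    show "norm (dunkl_quotient v f x) \<le> (2 / norm v * C) * (1 + norm x) ^ K"
    proof (cases "v \<bullet> x = 0")
      case True
      have "norm (dunkl_quotient v f x) = 2 / (norm v)\<^sup>2 * norm (dir_deriv v f x)"
        using True by (simp add: dunkl_quotient_def norm_mult norm_divide norm_power)
      also have "\<dots> \<le> 2 / (norm v)\<^sup>2 * (C * norm v * (1 + norm x) ^ K)"
        by (intro mult_left_mono C) auto
      also have "\<dots> = (2 / norm v * C) * (1 + norm x) ^ K"
        using nv by (simp add: power2_eq_square)
      finally show ?thesis .
    next
      case False
      let ?h = "x - reflect_along v x"
      have h: "norm ?h = 2 * \<bar>v \<bullet> x\<bar> / norm v"
        using nv by (simp add: reflect_along_def inner_commute power2_eq_square abs_mult)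
      obtain s where s: "0 < s" "s < 1" "norm (f (reflect_along v x + ?h) - f (reflect_along v x))
          \<le> norm (dir_deriv ?h f (reflect_along v x + s *\<^sub>R ?h))"
        using dir_deriv_mean_value[OF diff] by blast
      have "reflect_along v x + s *\<^sub>R ?h = (1 - s) *\<^sub>R reflect_along v x + s *\<^sub>R x"
        by (simp add: algebra_simps)
      then have "norm (reflect_along v x + s *\<^sub>R ?h) \<le> (1 - s) * norm x + s * norm x"
        using s norm_triangle_ineq[of "(1 - s) *\<^sub>R reflect_along v x" "s *\<^sub>R x"] by simp
      then have le: "norm (reflect_along v x + s *\<^sub>R ?h) \<le> norm x" by (simp add: algebra_simps)
      have "norm (f x - f (reflect_along v x)) \<le> C * norm ?h * (1 + norm (reflect_along v x + s *\<^sub>R ?h)) ^ K"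
        using order_trans[OF s(3) C(2)] by simp
      also have "\<dots> \<le> C * norm ?h * (1 + norm x) ^ K"
        using le C(1) by (intro mult_left_mono power_mono) auto
      finally have "norm (f x - f (reflect_along v x)) / \<bar>v \<bullet> x\<bar> \<le> C * norm ?h * (1 + norm x) ^ K / \<bar>v \<bullet> x\<bar>"
        by (rule divide_right_mono) simp
      then show ?thesis
        unfolding h using False by (simp add: dunkl_quotient_def norm_divide mult_ac)
    qed
  qed
qed

context dunkl
begin

lemma T_measurable:
  assumes f: "moderate f"
  shows "T a f \<in> borel_measurable borel"
proof -
  note [measurable] = moderate_dir_deriv_measurable[OF f] dunkl_quotient_measurable[OF f]
  show ?thesis unfolding T_def[abs_def] by measurable
qed

text \<open>The weight is not differentiable on the hyperplanes when \<open>2 k\<^sub>v < 1\<close>. Integration by parts is done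
  with this smooth invariant substitute, for which the terms that do not cancel pointwise are odd under
  a reflection.\<close>

definition reg_weight :: "real \<Rightarrow> real ^ 'n \<Rightarrow> real" where
  "reg_weight \<epsilon> x = exp (\<Sum>v\<in>Rp. k v * ln ((v \<bullet> x)\<^sup>2 + \<epsilon>))"

lemma reg_weight_pos: "reg_weight \<epsilon> x > 0"
  by (simp add: reg_weight_def)

lemma reg_weight_mono:
  assumes "0 < \<epsilon>" "\<epsilon> \<le> \<epsilon>'"
  shows "reg_weight \<epsilon> x \<le> reg_weight \<epsilon>' x"
proof -
  have "ln ((v \<bullet> x)\<^sup>2 + \<epsilon>) \<le> ln ((v \<bullet> x)\<^sup>2 + \<epsilon>')" for v
    using assms by (subst ln_le_cancel_iff) (auto simp: add_nonneg_pos)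
  then show ?thesis
    unfolding reg_weight_def by (simp add: sum_mono mult_left_mono k_Rp)
qed

lemma reg_weight_reflect:
  assumes "u \<in> R"
  shows "reg_weight \<epsilon> (reflect_along u x) = reg_weight \<epsilon> x"
  using sum_Rp_reflect[OF assms, of "\<lambda>v. ln ((v \<bullet> x)\<^sup>2 + \<epsilon>)"]
  by (simp add: reg_weight_def inner_reflect_along_commute)

lemma reg_weight_has_derivative:
  assumes "\<epsilon> > 0"
  shows "(reg_weight \<epsilon> has_derivative
    (\<lambda>h. reg_weight \<epsilon> x * (\<Sum>v\<in>Rp. k v * (2 * (v \<bullet> x) * (v \<bullet> h) / ((v \<bullet> x)\<^sup>2 + \<epsilon>))))) (at x)"
proof -
  have pos: "(v \<bullet> x)\<^sup>2 + \<epsilon> > 0" for v using assms by (simp add: add_nonneg_pos)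
  have "((\<lambda>x. \<Sum>v\<in>Rp. k v * ln ((v \<bullet> x)\<^sup>2 + \<epsilon>)) has_derivative
    (\<lambda>h. \<Sum>v\<in>Rp. k v * (2 * (v \<bullet> x) * (v \<bullet> h) / ((v \<bullet> x)\<^sup>2 + \<epsilon>)))) (at x)"
  proof (intro has_derivative_sum)
    fix v
    have "((\<lambda>x. (v \<bullet> x)\<^sup>2 + \<epsilon>) has_derivative (\<lambda>h. 2 * (v \<bullet> x) * (v \<bullet> h))) (at x)"
      by (auto intro!: derivative_eq_intros simp: mult_ac)
    from has_derivative_mult_right[OF has_derivative_ln[OF pos this], of "k v"]
    show "((\<lambda>x. k v * ln ((v \<bullet> x)\<^sup>2 + \<epsilon>)) has_derivative
      (\<lambda>h. k v * (2 * (v \<bullet> x) * (v \<bullet> h) / ((v \<bullet> x)\<^sup>2 + \<epsilon>)))) (at x)"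
      by (simp add: divide_inverse mult_ac)
  qed
  from has_derivative_exp[OF this] show ?thesis
    unfolding reg_weight_def[abs_def] by (rule has_derivative_eq_rhs) (simp add: fun_eq_iff mult.commute)
qed

lemma reg_weight_measurable [measurable]: "reg_weight \<epsilon> \<in> borel_measurable borel"
  unfolding reg_weight_def[abs_def] by measurable

lemma reg_weight_poly_bounded: "poly_bounded (reg_weight 1)"
proof (rule poly_boundedI)
  fix x
  define A where "A = (\<Sum>v\<in>Rp. 2 * k v * ln (1 + norm v))"
  \<comment> \<open>The weight grows with degree twice the sum of the multiplicities, rounded up
    here to an integer exponent.\<close>
  define K where "K = nat \<lceil>2 * \<gamma>\<rceil>"
  have K: "2 * \<gamma> \<le> real K" using \<gamma>_nonneg by (simp add: K_def of_nat_ceiling)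
  have "k v * ln ((v \<bullet> x)\<^sup>2 + 1) \<le> 2 * k v * ln (1 + norm v) + 2 * k v * ln (1 + norm x)" if "v \<in> Rp" for v
  proof -
    have "(v \<bullet> x)\<^sup>2 \<le> (norm v * norm x)\<^sup>2"
      using Cauchy_Schwarz_ineq2[of v x] abs_le_square_iff[of "v \<bullet> x" "norm v * norm x"] by simp
    also have "\<dots> + 1 \<le> ((1 + norm v) * (1 + norm x))\<^sup>2"
    proof -
      have "norm v * norm x + 1 \<le> (1 + norm v) * (1 + norm x)" by (simp add: algebra_simps)
      then have "(norm v * norm x + 1)\<^sup>2 \<le> ((1 + norm v) * (1 + norm x))\<^sup>2" by (intro power_mono) auto
      moreover have "(norm v * norm x)\<^sup>2 + 1 \<le> (norm v * norm x + 1)\<^sup>2" by (simp add: power2_sum)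
      ultimately show ?thesis by (rule order_trans[rotated])
    qed
    finally have le: "(v \<bullet> x)\<^sup>2 + 1 \<le> ((1 + norm v) * (1 + norm x))\<^sup>2" by simp
    have pos: "0 < (v \<bullet> x)\<^sup>2 + 1" by (simp add: add_nonneg_pos)
    have "ln ((v \<bullet> x)\<^sup>2 + 1) \<le> ln (((1 + norm v) * (1 + norm x))\<^sup>2)"
      using le pos less_le_trans[OF pos le] by (simp only: ln_le_cancel_iff)
    also have "\<dots> = 2 * (ln (1 + norm v) + ln (1 + norm x))"
      using add_pos_nonneg[OF zero_less_one norm_ge_zero, of v] add_pos_nonneg[OF zero_less_one norm_ge_zero, of x]
      by (simp only: ln_realpow ln_mult mult_pos_pos) simp
    finally show ?thesis
      using mult_left_mono[OF _ k_Rp[OF that]] by (fastforce simp: algebra_simps)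
  qed
  then have "(\<Sum>v\<in>Rp. k v * ln ((v \<bullet> x)\<^sup>2 + 1)) \<le> (\<Sum>v\<in>Rp. 2 * k v * ln (1 + norm v) + 2 * k v * ln (1 + norm x))"
    by (rule sum_mono)
  also have "\<dots> = A + 2 * \<gamma> * ln (1 + norm x)"
    by (simp add: A_def \<gamma>_def sum.distrib sum_distrib_left sum_distrib_right mult_ac)
  also have "\<dots> \<le> A + real K * ln (1 + norm x)"
    using K by (intro add_left_mono mult_right_mono) auto
  finally have "reg_weight 1 x \<le> exp (A + real K * ln (1 + norm x))"
    by (simp add: reg_weight_def)
  also have "\<dots> = exp A * (1 + norm x) ^ K"
    by (simp add: exp_add exp_of_nat_mult add_pos_nonneg)
  finally show "norm (reg_weight 1 x) \<le> exp A * (1 + norm x) ^ K"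
    using reg_weight_pos[of 1 x] by simp
qed

abbreviation "w \<equiv> dunkl_weight Rp k"

text \<open>Each factor is a power of (v . x)^2 + \<epsilon>. For multiplicity zero it is constantly
  1, because its base stays positive; this agrees with the case distinction in the weight.\<close>

lemma reg_weight_LIMSEQ: "(\<lambda>n. reg_weight (1 / real (Suc n)) x) \<longlonglongrightarrow> w x"
proof -
  have eq: "(\<lambda>n. reg_weight (1 / real (Suc n)) x) =
      (\<lambda>n. \<Prod>v\<in>Rp. ((v \<bullet> x)\<^sup>2 + 1 / real (Suc n)) powr k v)"
  proof
    fix n
    have "(v \<bullet> x)\<^sup>2 + 1 / real (Suc n) \<noteq> 0" for v
      by (rule less_imp_neq[symmetric]) (simp add: add_nonneg_pos)
    then show "reg_weight (1 / real (Suc n)) x = (\<Prod>v\<in>Rp. ((v \<bullet> x)\<^sup>2 + 1 / real (Suc n)) powr k v)"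
      unfolding reg_weight_def powr_def exp_sum[OF finite_Rp] by (intro prod.cong) auto
  qed
  show ?thesis
    unfolding eq dunkl_weight_def
  proof (rule tendsto_prod)
    fix v assume v: "v \<in> Rp"
    have lim: "(\<lambda>n. (v \<bullet> x)\<^sup>2 + 1 / real (Suc n)) \<longlonglongrightarrow> (v \<bullet> x)\<^sup>2"
      using tendsto_add[OF tendsto_const LIMSEQ_inverse_real_of_nat, of "(v \<bullet> x)\<^sup>2"]
      by (simp add: inverse_eq_divide)
    show "(\<lambda>n. ((v \<bullet> x)\<^sup>2 + 1 / real (Suc n)) powr k v) \<longlonglongrightarrow> (if k v = 0 then 1 else \<bar>x \<bullet> v\<bar> powr (2 * k v))"
    proof (cases "k v = 0")
      case True
      have "(v \<bullet> x)\<^sup>2 + 1 / real (Suc n) \<noteq> 0" for n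
        by (rule less_imp_neq[symmetric]) (simp add: add_nonneg_pos)
      with True show ?thesis by simp
    next
      case False
      with k_Rp[OF v] have kv: "k v > 0" by simp
      have "(\<lambda>n. ((v \<bullet> x)\<^sup>2 + 1 / real (Suc n)) powr k v) \<longlonglongrightarrow> ((v \<bullet> x)\<^sup>2) powr k v"
        using kv by (intro tendsto_powr'[OF lim tendsto_const]) auto
      also have "((v \<bullet> x)\<^sup>2) powr k v = \<bar>x \<bullet> v\<bar> powr (2 * k v)"
        by (cases "v \<bullet> x = 0") (auto simp: inner_commute powr_powr[symmetric])
      finally show ?thesis using False by simp
    qed
  qed
qed

lemma weight_nonneg: "w x \<ge> 0"
  unfolding dunkl_weight_def by (intro prod_nonneg) auto

lemma weight_le: "w x \<le> reg_weight 1 x"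
  by (rule LIMSEQ_le_const2[OF reg_weight_LIMSEQ]) (auto intro!: exI[of _ 0] reg_weight_mono)

lemma weight_poly_bounded: "poly_bounded w"
  by (rule poly_bounded_le[OF reg_weight_poly_bounded])
    (use weight_nonneg weight_le in \<open>auto intro: order_trans[OF _ abs_ge_self]\<close>)

lemma weight_measurable [measurable]: "w \<in> borel_measurable borel"
  by (rule borel_measurable_LIMSEQ_metric[OF reg_weight_measurable reg_weight_LIMSEQ])

lemma weight_eq_0: "v \<in> Rp \<Longrightarrow> k v \<noteq> 0 \<Longrightarrow> v \<bullet> x = 0 \<Longrightarrow> w x = 0"
  unfolding dunkl_weight_def using finite_Rp
  by (intro prod_zero) (auto simp: inner_commute)

text \<open>The damping is chosen so that damping times quotient equals (v . x) / ((v . x)^2 +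
  \<epsilon>) times the increment of \<open>f\<close> from the mirror image to x. The same fraction
  occurs in the logarithmic derivative of \<open>reg_weight\<close>, which makes this operator
  antisymmetric for the regularised weight.\<close>

definition T_reg :: "real \<Rightarrow> real ^ 'n \<Rightarrow> (real ^ 'n \<Rightarrow> complex) \<Rightarrow> real ^ 'n \<Rightarrow> complex" where
  "T_reg \<epsilon> a f x = dir_deriv a f x + (\<Sum>v\<in>Rp. of_real (k v * (v \<bullet> a)) *
     (of_real ((v \<bullet> x)\<^sup>2 / ((v \<bullet> x)\<^sup>2 + \<epsilon>)) * dunkl_quotient v f x))"

text \<open>A majorant of both \<open>T\<close> and \<open>T_reg\<close> that is independent of
  \<epsilon>, for dominated convergence.\<close>

definition T_bound :: "real ^ 'n \<Rightarrow> (real ^ 'n \<Rightarrow> complex) \<Rightarrow> real ^ 'n \<Rightarrow> real" where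
  "T_bound a f x = norm (dir_deriv a f x) + (\<Sum>v\<in>Rp. \<bar>k v * (v \<bullet> a)\<bar> * norm (dunkl_quotient v f x))"

lemma T_bound_poly_bounded:
  assumes "moderate f"
  shows "poly_bounded (T_bound a f)"
proof -
  have 1: "poly_bounded (\<lambda>x. norm (dir_deriv a f x))"
    by (rule poly_bounded_le[OF moderate_dir_deriv_poly_bounded[OF assms, of a]]) simp
  have 2: "poly_bounded (\<lambda>x. norm (dunkl_quotient v f x))" if "v \<in> Rp" for v
    by (rule poly_bounded_le[OF dunkl_quotient_poly_bounded[OF assms Rp_nonzero[OF that]]]) simp
  show ?thesis
    unfolding T_bound_def[abs_def]
    by (intro poly_bounded_add 1 poly_bounded_sum finite_Rp poly_bounded_mult poly_bounded_const 2)
qed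

lemma T_bound_measurable:
  assumes "moderate f"
  shows "T_bound a f \<in> borel_measurable borel"
proof -
  note [measurable] = moderate_dir_deriv_measurable[OF assms] dunkl_quotient_measurable[OF assms]
  show ?thesis unfolding T_bound_def[abs_def] by measurable
qed

lemma T_reg_measurable:
  assumes "moderate f"
  shows "T_reg \<epsilon> a f \<in> borel_measurable borel"
proof -
  note [measurable] = moderate_dir_deriv_measurable[OF assms] dunkl_quotient_measurable[OF assms]
  show ?thesis unfolding T_reg_def[abs_def] by measurable
qed

lemma norm_T_reg_le:
  assumes "\<epsilon> > 0"
  shows "norm (T_reg \<epsilon> a f x) \<le> T_bound a f x"
  unfolding T_reg_def T_bound_def
proof (rule norm_triangle_le, rule add_left_mono, rule sum_norm_le)
  fix v
  have "(v \<bullet> x)\<^sup>2 + \<epsilon> > 0" using assms by (simp add: add_nonneg_pos)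
  then have "\<bar>(v \<bullet> x)\<^sup>2 / ((v \<bullet> x)\<^sup>2 + \<epsilon>)\<bar> \<le> 1" using assms by (simp add: abs_of_pos)
  then have "\<bar>(v \<bullet> x)\<^sup>2 / ((v \<bullet> x)\<^sup>2 + \<epsilon>)\<bar> * norm (dunkl_quotient v f x) \<le> 1 * norm (dunkl_quotient v f x)"
    by (intro mult_right_mono) auto
  then show "norm (of_real (k v * (v \<bullet> a)) * (of_real ((v \<bullet> x)\<^sup>2 / ((v \<bullet> x)\<^sup>2 + \<epsilon>)) * dunkl_quotient v f x))
      \<le> \<bar>k v * (v \<bullet> a)\<bar> * norm (dunkl_quotient v f x)"
    unfolding norm_mult norm_of_real by (intro mult_left_mono) auto
qed

lemma norm_T_le: "norm (T a f x) \<le> T_bound a f x"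
  unfolding T_def T_bound_def
  by (rule norm_triangle_le, rule add_left_mono, rule sum_norm_le) (simp only: norm_mult norm_of_real order_refl)

lemma T_bound_nonneg: "0 \<le> T_bound a f x"
  by (rule order_trans[OF norm_ge_zero norm_T_le])

lemma T_poly_bounded: "moderate f \<Longrightarrow> poly_bounded (T a f)"
  by (rule poly_bounded_le[OF T_bound_poly_bounded]) (auto intro: order_trans[OF norm_T_le abs_ge_self])

text \<open>Off the hyperplane the damping tends to 1. On it the damping is constantly 0, but there
  the weight vanishes as soon as the root has nonzero multiplicity, so the limit is still the right
  one.\<close>

lemma T_reg_LIMSEQ:
  "(\<lambda>n. T_reg (1 / real (Suc n)) a f x * of_real (reg_weight (1 / real (Suc n)) x)) \<longlonglongrightarrow> T a f x * of_real (w x)"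
proof -
  let ?e = "\<lambda>n. 1 / real (Suc n)"
  have 1: "(\<lambda>n. of_real (k v * (v \<bullet> a)) * (of_real ((v \<bullet> x)\<^sup>2 / ((v \<bullet> x)\<^sup>2 + ?e n)) * dunkl_quotient v f x) *
      of_real (reg_weight (?e n) x)) \<longlonglongrightarrow> of_real (k v * (v \<bullet> a)) * dunkl_quotient v f x * of_real (w x)" (is "?L v")
    if v: "v \<in> Rp" for v
  proof (cases "v \<bullet> x = 0")
    case True
    then show ?thesis using weight_eq_0[OF v] by (cases "k v = 0") auto
  next
    case False
    have "?e \<longlonglongrightarrow> 0" using LIMSEQ_inverse_real_of_nat by (simp add: inverse_eq_divide)
    then have "(\<lambda>n. (v \<bullet> x)\<^sup>2 / ((v \<bullet> x)\<^sup>2 + ?e n)) \<longlonglongrightarrow> (v \<bullet> x)\<^sup>2 / ((v \<bullet> x)\<^sup>2 + 0)"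
      using False by (intro tendsto_intros) auto
    then have "(\<lambda>n. (v \<bullet> x)\<^sup>2 / ((v \<bullet> x)\<^sup>2 + ?e n)) \<longlonglongrightarrow> 1" using False by simp
    note h = tendsto_of_real[OF this, where 'a = complex]
    have "(\<lambda>n. of_real (k v * (v \<bullet> a)) * (of_real ((v \<bullet> x)\<^sup>2 / ((v \<bullet> x)\<^sup>2 + ?e n)) * dunkl_quotient v f x) *
      of_real (reg_weight (?e n) x)) \<longlonglongrightarrow> of_real (k v * (v \<bullet> a)) * (of_real 1 * dunkl_quotient v f x) * of_real (w x)"
      by (intro tendsto_mult tendsto_const h tendsto_of_real[OF reg_weight_LIMSEQ])
    then show ?thesis by simp
  qed
  have "(\<lambda>n. dir_deriv a f x * of_real (reg_weight (?e n) x) +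
     (\<Sum>v\<in>Rp. of_real (k v * (v \<bullet> a)) * (of_real ((v \<bullet> x)\<^sup>2 / ((v \<bullet> x)\<^sup>2 + ?e n)) * dunkl_quotient v f x) *
      of_real (reg_weight (?e n) x))) \<longlonglongrightarrow>
     dir_deriv a f x * of_real (w x) + (\<Sum>v\<in>Rp. of_real (k v * (v \<bullet> a)) * dunkl_quotient v f x * of_real (w x))"
    by (intro tendsto_add tendsto_mult tendsto_sum tendsto_const tendsto_of_real reg_weight_LIMSEQ 1)
  then show ?thesis
    unfolding T_reg_def T_def distrib_right sum_distrib_right by simp
qed

text \<open>The derivative of f g W integrates to zero, where \<open>W\<close> is a Gaussian cutoff
  times the regularised weight. It differs from the integrand here only by the terms
  \<open>B v\<close>, which are odd under a reflection. The term with \<delta> comes from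
  differentiating the cutoff.\<close>

lemma T_antisymmetric_reg:
  assumes f: "moderate f" and g: "moderate g" and \<delta>: "\<delta> > 0" and \<epsilon>: "0 < \<epsilon>" "\<epsilon> \<le> 1"
  shows "(LINT x|lborel. (T_reg \<epsilon> a f x * g x + f x * T_reg \<epsilon> a g x - of_real (2 * \<delta> * (a \<bullet> x)) * (f x * g x)) *
    of_real (exp (- \<delta> * (norm x)\<^sup>2) * reg_weight \<epsilon> x)) = 0"
proof -
  note [measurable] = moderate_measurable[OF f] moderate_measurable[OF g]
    moderate_dir_deriv_measurable[OF f] moderate_dir_deriv_measurable[OF g]
  define W where "W x = exp (- \<delta> * (norm x)\<^sup>2) * reg_weight \<epsilon> x" for x
  have [measurable]: "W \<in> borel_measurable borel" unfolding W_def[abs_def] by measurable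
  have W_pos: "W x > 0" for x by (simp add: W_def reg_weight_pos)
  have "rapid (\<lambda>x. exp (- \<delta> * (norm x)\<^sup>2) * reg_weight 1 x)"
    by (rule rapid_mult[OF rapid_gaussian[OF \<delta>] reg_weight_poly_bounded])
  then have W_rapid: "rapid W"
    by (rule rapid_le) (use reg_weight_mono[OF \<epsilon>] in \<open>auto simp: W_def abs_mult reg_weight_pos abs_of_pos intro!: mult_left_mono\<close>)
  have rapid_W: "rapid (\<lambda>x. p x * of_real (W x))" if "poly_bounded p" for p :: "real ^ 'n \<Rightarrow> complex"
    by (rule rapid_mult_le[OF W_rapid that]) (simp add: norm_mult)
  have W_der: "(W has_derivative (\<lambda>h. W x * (- 2 * \<delta> * (x \<bullet> h) + (\<Sum>v\<in>Rp. k v * (2 * (v \<bullet> x) * (v \<bullet> h) / ((v \<bullet> x)\<^sup>2 + \<epsilon>)))))) (at x)" for x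
  proof -
    have "((\<lambda>x. exp (- \<delta> * (x \<bullet> x))) has_derivative (\<lambda>h. exp (- \<delta> * (x \<bullet> x)) * (- \<delta> * (x \<bullet> h + h \<bullet> x)))) (at x)"
      by (auto intro!: derivative_eq_intros)
    from has_derivative_mult[OF this reg_weight_has_derivative[OF \<epsilon>(1), of x]]
    show ?thesis unfolding W_def[abs_def] power2_norm_eq_inner
      by (rule has_derivative_eq_rhs) (simp add: fun_eq_iff inner_commute algebra_simps)
  qed
  have W_refl: "W (reflect_along u x) = W x" if "u \<in> R" for u x
    by (simp add: W_def reg_weight_reflect[OF that])
  define c where "c v x = (v \<bullet> x) / ((v \<bullet> x)\<^sup>2 + \<epsilon>)" for v x :: "real ^ 'n"
  have c_poly: "poly_bounded (c v)" for v
  proof (rule poly_bounded_le[of "\<lambda>x. (1 / \<epsilon>) * (v \<bullet> x)"])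
    show "poly_bounded (\<lambda>x. (1 / \<epsilon>) * (v \<bullet> x))"
      by (intro poly_bounded_mult poly_bounded_const poly_bounded_inner)
    fix x
    have p: "0 < (v \<bullet> x)\<^sup>2 + \<epsilon>" using \<epsilon> by (simp add: add_nonneg_pos)
    have "\<bar>v \<bullet> x\<bar> / ((v \<bullet> x)\<^sup>2 + \<epsilon>) \<le> \<bar>v \<bullet> x\<bar> / \<epsilon>"
      using \<epsilon> by (intro divide_left_mono) (auto simp: add_nonneg_pos)
    then show "norm (c v x) \<le> norm ((1 / \<epsilon>) * (v \<bullet> x))"
      using \<epsilon> p by (simp add: c_def abs_mult)
  qed
  have [measurable]: "c v \<in> borel_measurable borel" for v unfolding c_def[abs_def] by measurable
  \<comment> \<open>The derivative of f g W in the direction \<open>a\<close>, divided by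
    \<open>W\<close>.\<close>
  define P where "P x = dir_deriv a f x * g x + f x * dir_deriv a g x +
      f x * g x * of_real (- 2 * \<delta> * (a \<bullet> x) + (\<Sum>v\<in>Rp. k v * (2 * (v \<bullet> a)) * c v x))" for x
  have P_poly: "poly_bounded P"
    unfolding P_def[abs_def]
    by (intro poly_bounded_add poly_bounded_mult poly_bounded_of_real poly_bounded_sum finite_Rp
        moderate_poly_bounded f g moderate_dir_deriv_poly_bounded poly_bounded_const poly_bounded_inner c_poly)
  define F where "F x = f x * g x * of_real (W x)" for x
  have F_der: "(F has_derivative (\<lambda>h. (dir_deriv h f x * g x + f x * dir_deriv h g x) * of_real (W x) +
      f x * g x * of_real (W x * (- 2 * \<delta> * (x \<bullet> h) + (\<Sum>v\<in>Rp. k v * (2 * (v \<bullet> x) * (v \<bullet> h) / ((v \<bullet> x)\<^sup>2 + \<epsilon>))))))) (at x)" for x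
    unfolding F_def[abs_def]
    by (rule has_derivative_eq_rhs, rule has_derivative_mult[OF has_derivative_mult[OF
          has_derivative_dir_deriv[OF moderate_differentiable[OF f]] has_derivative_dir_deriv[OF moderate_differentiable[OF g]]]
          has_derivative_of_real[OF W_der]]) (simp add: algebra_simps)
  have F_deriv: "dir_deriv a F = (\<lambda>x. P x * of_real (W x))"
    unfolding dir_deriv_eq[OF F_der, abs_def] P_def c_def
    by (simp add: fun_eq_iff inner_commute algebra_simps)
  have F_diff: "F differentiable (at x)" for x using F_der by (auto simp: differentiable_def)
  have F_rapid: "rapid F" unfolding F_def[abs_def]
    by (intro rapid_W poly_bounded_mult moderate_poly_bounded f g)
  have F'_rapid: "rapid (dir_deriv a F)" unfolding F_deriv by (rule rapid_W[OF P_poly])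
  have A0: "(LINT x|lborel. P x * of_real (W x)) = 0"
    using integral_dir_deriv_eq_0[OF F_diff F_rapid F'_rapid] by (simp add: F_deriv)
  have A_int: "integrable lborel (\<lambda>x. P x * of_real (W x))"
    using integrable_rapid[OF F'_rapid dir_deriv_measurable[OF F_diff]] by (simp add: F_deriv)
  \<comment> \<open>The mixed products left over when the increments in \<open>T_reg\<close> are
    multiplied out. Under the reflection in v the factor \<open>c v\<close> changes sign, while the
    bracket and \<open>W\<close> are invariant.\<close>
  define B where "B v x = of_real (k v * (v \<bullet> a) * c v x) * (f (reflect_along v x) * g x + f x * g (reflect_along v x)) * of_real (W x)" for v x
  have refl_poly: "poly_bounded (\<lambda>x. h (reflect_along v x))" if h: "poly_bounded h" for h :: "real ^ 'n \<Rightarrow> complex" and v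
  proof -
    obtain C K where "\<And>x. norm (h x) \<le> C * (1 + norm x) ^ K" using poly_boundedE[OF h] by blast
    from this[of "reflect_along v _"] show ?thesis
      by (intro poly_boundedI[of _ C K]) simp
  qed
  have B_int: "integrable lborel (B v)" for v
  proof (rule integrable_rapid)
    show "rapid (B v)" unfolding B_def[abs_def]
      by (intro rapid_W poly_bounded_mult poly_bounded_add refl_poly moderate_poly_bounded f g
          poly_bounded_of_real poly_bounded_const c_poly)
    show "B v \<in> borel_measurable borel" unfolding B_def[abs_def] by measurable
  qed
  have B0: "(LINT x|lborel. B v x) = 0" if "v \<in> Rp" for v
  proof (rule integral_lborel_reflect_odd)
    show "B v \<in> borel_measurable borel" unfolding B_def[abs_def] by measurable
    fix x
    have "c v (reflect_along v x) = - c v x"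
      by (simp add: c_def inner_reflect_along_self)
    then show "B v (reflect_along v x) = - B v x"
      by (simp add: B_def W_refl[OF Rp_in_R[OF that]] algebra_simps)
  qed
  have q: "of_real ((v \<bullet> x)\<^sup>2 / ((v \<bullet> x)\<^sup>2 + \<epsilon>)) * dunkl_quotient v h x = of_real (c v x) * (h x - h (reflect_along v x))"
    for v x and h :: "real ^ 'n \<Rightarrow> complex"
    by (simp add: c_def dunkl_quotient_def power2_eq_square)
  have eq: "(T_reg \<epsilon> a f x * g x + f x * T_reg \<epsilon> a g x - of_real (2 * \<delta> * (a \<bullet> x)) * (f x * g x)) * of_real (W x)
      = P x * of_real (W x) - (\<Sum>v\<in>Rp. B v x)" for x
  proof -
    have "(\<Sum>v\<in>Rp. B v x) = (f x * g x * of_real (\<Sum>v\<in>Rp. k v * (2 * (v \<bullet> a)) * c v x)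
       - (\<Sum>v\<in>Rp. of_real (k v * (v \<bullet> a)) * (of_real (c v x) * (f x - f (reflect_along v x)))) * g x
       - f x * (\<Sum>v\<in>Rp. of_real (k v * (v \<bullet> a)) * (of_real (c v x) * (g x - g (reflect_along v x))))) * of_real (W x)"
      unfolding B_def of_real_sum sum_distrib_left sum_distrib_right sum_subtractf[symmetric]
      by (intro sum.cong HOL.refl) (simp add: algebra_simps)
    then show ?thesis
      unfolding T_reg_def q P_def by (simp add: algebra_simps)
  qed
  have "(LINT x|lborel. P x * of_real (W x) - (\<Sum>v\<in>Rp. B v x)) = 0 - (\<Sum>v\<in>Rp. 0)"
    using A_int B_int A0 B0 by (subst Bochner_Integration.integral_diff) (auto simp: Bochner_Integration.integral_sum)
  then show ?thesis unfolding eq[unfolded W_def] by (simp add: W_def)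
qed

text \<open>The limit \<epsilon> -> 0 with the cutoff kept fixed: the regularised weights are
  dominated by the one with \<epsilon> = 1, and the Gaussian absorbs all polynomial growth.\<close>

lemma T_antisymmetric_gaussian:
  assumes f: "moderate f" and g: "moderate g" and \<delta>: "\<delta> > 0"
  shows "(LINT x|lborel. (T a f x * g x + f x * T a g x - of_real (2 * \<delta> * (a \<bullet> x)) * (f x * g x)) *
    of_real (exp (- \<delta> * (norm x)\<^sup>2) * w x)) = 0"
proof -
  note [measurable] = moderate_measurable[OF f] moderate_measurable[OF g]
    T_reg_measurable[OF f] T_reg_measurable[OF g] T_measurable[OF f] T_measurable[OF g]
    T_bound_measurable[OF f] T_bound_measurable[OF g]
  let ?e = "\<lambda>n. 1 / real (Suc n)"
  define S where "S n x = (T_reg (?e n) a f x * g x + f x * T_reg (?e n) a g x - of_real (2 * \<delta> * (a \<bullet> x)) * (f x * g x)) *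
    of_real (exp (- \<delta> * (norm x)\<^sup>2) * reg_weight (?e n) x)" for n x
  define Q where "Q x = T_bound a f x * norm (g x) + norm (f x) * T_bound a g x + norm (of_real (2 * \<delta> * (a \<bullet> x)) * (f x * g x))" for x
  define D where "D x = (exp (- \<delta> * (norm x)\<^sup>2) * reg_weight 1 x) * Q x" for x
  have norm_poly: "poly_bounded (\<lambda>x. norm (h x))" if "poly_bounded h" for h :: "real ^ 'n \<Rightarrow> complex"
    using poly_bounded_le[OF that, of "\<lambda>x. norm (h x)"] by simp
  have "poly_bounded Q"
    unfolding Q_def[abs_def]
    by (intro poly_bounded_add poly_bounded_mult norm_poly T_bound_poly_bounded moderate_poly_bounded f g
        poly_bounded_of_real poly_bounded_const poly_bounded_inner)
  then have D_rapid: "rapid D"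
    unfolding D_def[abs_def] by (intro rapid_mult rapid_gaussian \<delta> reg_weight_poly_bounded)
  have "(\<lambda>n. LINT x|lborel. S n x) \<longlonglongrightarrow> (LINT x|lborel.
      (T a f x * g x + f x * T a g x - of_real (2 * \<delta> * (a \<bullet> x)) * (f x * g x)) * of_real (exp (- \<delta> * (norm x)\<^sup>2) * w x))"
  proof (rule integral_dominated_convergence[where w = D])
    show "integrable lborel D"
      by (rule integrable_rapid[OF D_rapid]) (unfold D_def[abs_def] Q_def[abs_def], measurable)
    show "AE x in lborel. (\<lambda>n. S n x) \<longlonglongrightarrow>
      (T a f x * g x + f x * T a g x - of_real (2 * \<delta> * (a \<bullet> x)) * (f x * g x)) * of_real (exp (- \<delta> * (norm x)\<^sup>2) * w x)"
    proof (rule AE_I2)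
      fix x :: "real ^ 'n"
      let ?G = "of_real (exp (- \<delta> * (norm x)\<^sup>2)) :: complex"
      have "(\<lambda>n. (T_reg (?e n) a f x * of_real (reg_weight (?e n) x)) * (g x * ?G)
          + (T_reg (?e n) a g x * of_real (reg_weight (?e n) x)) * (f x * ?G)
          - of_real (reg_weight (?e n) x) * (of_real (2 * \<delta> * (a \<bullet> x)) * (f x * g x) * ?G))
        \<longlonglongrightarrow> (T a f x * of_real (w x)) * (g x * ?G) + (T a g x * of_real (w x)) * (f x * ?G)
          - of_real (w x) * (of_real (2 * \<delta> * (a \<bullet> x)) * (f x * g x) * ?G)"
        by (intro tendsto_diff tendsto_add tendsto_mult T_reg_LIMSEQ tendsto_const tendsto_of_real[OF reg_weight_LIMSEQ])
      then show "(\<lambda>n. S n x) \<longlonglongrightarrow>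
        (T a f x * g x + f x * T a g x - of_real (2 * \<delta> * (a \<bullet> x)) * (f x * g x)) * of_real (exp (- \<delta> * (norm x)\<^sup>2) * w x)"
        unfolding S_def by (simp add: algebra_simps)
    qed
    fix n
    show "AE x in lborel. norm (S n x) \<le> D x"
    proof (rule AE_I2)
      fix x :: "real ^ 'n"
      have e: "0 < ?e n" "?e n \<le> 1" by auto
      have "norm (T_reg (?e n) a f x * g x + f x * T_reg (?e n) a g x - of_real (2 * \<delta> * (a \<bullet> x)) * (f x * g x)) \<le> Q x"
        unfolding Q_def using norm_T_reg_le[OF e(1), of a]
        by (intro order_trans[OF norm_triangle_ineq4] order_trans[OF norm_triangle_ineq] add_mono)
          (auto simp: norm_mult T_bound_nonneg intro!: mult_mono)
      moreover have "exp (- \<delta> * (norm x)\<^sup>2) * reg_weight (?e n) x \<le> exp (- \<delta> * (norm x)\<^sup>2) * reg_weight 1 x"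
        using reg_weight_mono[OF e] by (intro mult_left_mono) auto
      ultimately have "norm (T_reg (?e n) a f x * g x + f x * T_reg (?e n) a g x - of_real (2 * \<delta> * (a \<bullet> x)) * (f x * g x)) *
         (exp (- \<delta> * (norm x)\<^sup>2) * reg_weight (?e n) x) \<le> Q x * (exp (- \<delta> * (norm x)\<^sup>2) * reg_weight 1 x)"
        using reg_weight_pos[of "?e n" x] order_trans[OF norm_ge_zero] by (intro mult_mono) auto
      then show "norm (S n x) \<le> D x"
        unfolding S_def D_def norm_mult norm_of_real using reg_weight_pos[of "?e n" x] by (simp add: mult_ac abs_mult)
    qed
  qed (unfold S_def[abs_def], measurable)
  moreover have "(LINT x|lborel. S n x) = 0" for n
    unfolding S_def by (rule T_antisymmetric_reg[OF f g \<delta>]) auto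
  ultimately show ?thesis by (simp only: LIMSEQ_const_iff)
qed

text \<open>The limit \<delta> -> 0. The first two integrability assumptions dominate the main
  terms, the third one the term contributed by the cutoff, whose coefficient 2 \<delta> tends to
  0.\<close>

theorem T_antisymmetric:
  assumes f: "moderate f" and g: "moderate g"
    and i1: "integrable lborel (\<lambda>x. T a f x * g x * of_real (w x))"
    and i2: "integrable lborel (\<lambda>x. f x * T a g x * of_real (w x))"
    and i3: "integrable lborel (\<lambda>x. of_real (a \<bullet> x) * (f x * g x * of_real (w x)))"
  shows "(LINT x|lborel. T a f x * g x * of_real (w x)) = - (LINT x|lborel. f x * T a g x * of_real (w x))"
proof -
  let ?e = "\<lambda>n. 1 / real (Suc n)"
  let ?t1 = "\<lambda>x. T a f x * g x * of_real (w x)"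
  let ?t2 = "\<lambda>x. f x * T a g x * of_real (w x)"
  let ?t3 = "\<lambda>x. of_real (a \<bullet> x) * (f x * g x * of_real (w x))"
  define S where "S n x = (?t1 x + ?t2 x - of_real (2 * ?e n) * ?t3 x) * of_real (exp (- ?e n * (norm x)\<^sup>2))" for n x
  note [measurable] = borel_measurable_integrable[OF i1] borel_measurable_integrable[OF i2] borel_measurable_integrable[OF i3]
  have e: "?e \<longlonglongrightarrow> 0" using LIMSEQ_inverse_real_of_nat by (simp add: inverse_eq_divide)
  have "(\<lambda>n. LINT x|lborel. S n x) \<longlonglongrightarrow> (LINT x|lborel. ?t1 x + ?t2 x)"
  proof (rule integral_dominated_convergence[where w = "\<lambda>x. norm (?t1 x) + norm (?t2 x) + 2 * norm (?t3 x)"])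
    show "integrable lborel (\<lambda>x. norm (?t1 x) + norm (?t2 x) + 2 * norm (?t3 x))"
      by (intro Bochner_Integration.integrable_add integrable_norm integrable_mult_right i1 i2 i3)
    show "AE x in lborel. (\<lambda>n. S n x) \<longlonglongrightarrow> ?t1 x + ?t2 x"
    proof (rule AE_I2)
      fix x :: "real ^ 'n"
      have "(\<lambda>n. S n x) \<longlonglongrightarrow> (?t1 x + ?t2 x - of_real (2 * 0) * ?t3 x) * of_real (exp (- 0 * (norm x)\<^sup>2))"
        unfolding S_def
        by (intro tendsto_mult tendsto_diff tendsto_const tendsto_of_real tendsto_exp tendsto_minus e)
      then show "(\<lambda>n. S n x) \<longlonglongrightarrow> ?t1 x + ?t2 x" by simp
    qed
    fix n
    show "AE x in lborel. norm (S n x) \<le> norm (?t1 x) + norm (?t2 x) + 2 * norm (?t3 x)"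
    proof (rule AE_I2)
      fix x :: "real ^ 'n"
      let ?N = "norm (?t1 x + ?t2 x - of_real (2 * ?e n) * ?t3 x)"
      have "norm (S n x) = ?N * exp (- ?e n * (norm x)\<^sup>2)"
        unfolding S_def norm_mult[of _ "of_real _"] norm_of_real by simp
      also have "\<dots> \<le> ?N * 1"
        by (intro mult_left_mono) auto
      also have "?N \<le> norm (?t1 x) + norm (?t2 x) + norm (of_real (2 * ?e n) * ?t3 x)"
        by (rule order_trans[OF norm_triangle_ineq4]) (rule add_right_mono[OF norm_triangle_ineq])
      also have "norm (of_real (2 * ?e n) * ?t3 x) \<le> 2 * norm (?t3 x)"
        unfolding norm_mult[of "of_real (2 * ?e n)"] norm_of_real by (intro mult_right_mono) (auto simp: divide_le_eq)
      finally show "norm (S n x) \<le> norm (?t1 x) + norm (?t2 x) + 2 * norm (?t3 x)" by simp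
    qed
  qed (unfold S_def[abs_def], measurable)
  moreover have "(LINT x|lborel. S n x) = 0" for n
  proof -
    have "S n x = (T a f x * g x + f x * T a g x - of_real (2 * ?e n * (a \<bullet> x)) * (f x * g x)) *
        of_real (exp (- ?e n * (norm x)\<^sup>2) * w x)" for x
      by (simp add: S_def algebra_simps)
    then show ?thesis using T_antisymmetric_gaussian[OF f g, of "?e n" a] by simp
  qed
  ultimately have "(LINT x|lborel. ?t1 x + ?t2 x) = 0" by (simp only: LIMSEQ_const_iff)
  then show ?thesis by (simp add: Bochner_Integration.integral_add[OF i1 i2] add_eq_0_iff)
qed

end

section \<open>Schwartz functions\<close>

lemma rapid_iff: "rapid f \<longleftrightarrow> (\<forall>m. bounded (range (\<lambda>x. norm x ^ m *\<^sub>R f x)))"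
proof
  assume f: "rapid f"
  show "\<forall>m. bounded (range (\<lambda>x. norm x ^ m *\<^sub>R f x))"
  proof
    fix m
    obtain C where C: "\<And>x. norm (f x) * (1 + norm x) ^ m \<le> C"
      using f unfolding rapid_def by blast
    have "norm (norm x ^ m *\<^sub>R f x) \<le> C" for x
    proof -
      have "norm x ^ m * norm (f x) \<le> (1 + norm x) ^ m * norm (f x)"
        by (intro mult_right_mono power_mono) auto
      with C[of x] show ?thesis by (simp add: mult.commute)
    qed
    then show "bounded (range (\<lambda>x. norm x ^ m *\<^sub>R f x))" by (auto intro!: boundedI)
  qed
next
  assume f: "\<forall>m. bounded (range (\<lambda>x. norm x ^ m *\<^sub>R f x))"
  show "rapid f"
    unfolding rapid_def
  proof
    fix m
    obtain C where C: "\<And>x. norm x ^ m * norm (f x) \<le> C"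
      using f[rule_format, of m] by (auto simp: bounded_iff)
    obtain D where D: "\<And>x. norm (f x) \<le> D"
      using f[rule_format, of 0] by (auto simp: bounded_iff)
    have "norm (f x) * (1 + norm x) ^ m \<le> 2 ^ m * (C + D)" for x
    proof -
      have "(1 + norm x) ^ m \<le> (2 * max 1 (norm x)) ^ m"
        by (intro power_mono) auto
      also have "\<dots> \<le> 2 ^ m * (1 + norm x ^ m)"
        by (simp add: power_mult_distrib max_def)
      finally have "norm (f x) * (1 + norm x) ^ m \<le> norm (f x) * (2 ^ m * (1 + norm x ^ m))"
        by (rule mult_left_mono) simp
      also have "\<dots> = 2 ^ m * (norm x ^ m * norm (f x) + norm (f x))" by (simp add: algebra_simps)
      also have "\<dots> \<le> 2 ^ m * (C + D)" by (intro mult_left_mono add_mono C D) simp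
      finally show ?thesis .
    qed
    then show "\<exists>C. \<forall>x. norm (f x) * (1 + norm x) ^ m \<le> C" by blast
  qed
qed

lemma schwartz_rapid: "f \<in> schwartz_space \<Longrightarrow> rapid f"
  unfolding schwartz_space_def rapid_iff by (auto dest: spec[of _ "[]"])

lemma schwartz_differentiable: "f \<in> schwartz_space \<Longrightarrow> f differentiable (at x)"
  unfolding schwartz_space_def by (auto dest: spec[of _ "[]"])

lemma schwartz_partial_deriv:
  assumes "f \<in> schwartz_space"
  shows "partial_deriv j f \<in> schwartz_space"
proof -
  have "foldr partial_deriv js (partial_deriv j f) = foldr partial_deriv (js @ [j]) f" for js
    by simp
  then show ?thesis
    using assms unfolding schwartz_space_def by (auto simp del: foldr_append)
qed

text \<open>The Schwartz space is the largest class of differentiable, rapidly decreasing functions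
  closed under partial derivatives, so any class with these properties may serve as
  invariant.\<close>

lemma schwartz_coinduct:
  assumes "f \<in> X"
    and X: "\<And>f x. f \<in> X \<Longrightarrow> f differentiable (at x)" "\<And>f. f \<in> X \<Longrightarrow> rapid f"
      "\<And>f j. f \<in> X \<Longrightarrow> partial_deriv j f \<in> X"
  shows "f \<in> schwartz_space"
proof -
  have "foldr partial_deriv js f \<in> X" for js
    by (induction js) (auto intro: assms)
  then show ?thesis
    unfolding schwartz_space_def using X(1,2) by (auto simp: rapid_iff)
qed

lemma continuous_differentiable:
  fixes f :: "real ^ 'n \<Rightarrow> complex"
  shows "(\<And>x. f differentiable (at x)) \<Longrightarrow> continuous_on S f"
  by (intro continuous_at_imp_continuous_on ballI differentiable_imp_continuous_within)

section \<open>Schwartz functions obtained by integrating over a parameter\<close>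

lemma parametric_integral:
  fixes F :: "real \<Rightarrow> real ^ 'n \<Rightarrow> complex"
  assumes diff: "\<And>t x. F t differentiable (at x)"
    and cont: "continuous_on UNIV (\<lambda>(x, t). F t x)"
    and cont': "\<And>j. continuous_on UNIV (\<lambda>(x, t). partial_deriv j (F t) x)"
  shows "(\<lambda>x. integral {0..1} (\<lambda>t. F t x)) differentiable (at x)"
    and "partial_deriv j (\<lambda>x. integral {0..1} (\<lambda>t. F t x)) x = integral {0..1} (\<lambda>t. partial_deriv j (F t) x)"
proof -
  \<comment> \<open>\<open>leibniz_rule\<close> expects the derivative as a continuous family of
    bounded operators; the continuity is then checked on basis vectors only.\<close>
  define F' where "F' x t = Blinfun (\<lambda>v. dir_deriv v (F t) x)" for x t
  have F': "blinfun_apply (F' x t) = (\<lambda>v. dir_deriv v (F t) x)" for x t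
    unfolding F'_def by (rule bounded_linear_Blinfun_apply[OF bounded_linear_dir_deriv[OF diff]])
  have cont_F': "continuous_on UNIV (\<lambda>(x, t). F' x t)"
  proof (rule continuous_on_blinfun_componentwise)
    fix i :: "real ^ 'n" assume "i \<in> Basis"
    then obtain j where "i = axis j 1" by (auto simp: Basis_vec_def)
    then show "continuous_on UNIV (\<lambda>p. (case p of (x, t) \<Rightarrow> F' x t) i)"
      using cont'[of j] by (simp add: case_prod_beta F')
  qed
  have "((\<lambda>x. integral (cbox 0 1) (\<lambda>t. F t x)) has_derivative integral (cbox 0 1) (F' x)) (at x within UNIV)"
  proof (rule leibniz_rule)
    show "((\<lambda>x. F t x) has_derivative blinfun_apply (F' y t)) (at y within UNIV)" for y t
      unfolding F' using has_derivative_dir_deriv[OF diff] by simp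
    show "(\<lambda>t. F t y) integrable_on cbox 0 1" for y
    proof (rule integrable_continuous)
      show "continuous_on (cbox 0 1) (\<lambda>t. F t y)"
        using continuous_on_compose2[OF cont, of "cbox 0 1" "\<lambda>t. (y, t)"] by (simp add: continuous_on_Pair)
    qed
    show "continuous_on (UNIV \<times> cbox 0 1) (\<lambda>(x, t). F' x t)"
      by (rule continuous_on_subset[OF cont_F']) simp
  qed auto
  then have der: "((\<lambda>x. integral {0..1} (\<lambda>t. F t x)) has_derivative integral {0..1} (F' x)) (at x)"
    by simp
  then show "(\<lambda>x. integral {0..1} (\<lambda>t. F t x)) differentiable (at x)"
    by (auto simp: differentiable_def)
  have "F' x integrable_on {0..1}"
  proof (rule integrable_continuous_real)
    show "continuous_on {0..1} (F' x)"
      using continuous_on_compose2[OF cont_F', of "{0..1}" "\<lambda>t. (x, t)"] by (simp add: continuous_on_Pair)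
  qed
  then show "partial_deriv j (\<lambda>x. integral {0..1} (\<lambda>t. F t x)) x = integral {0..1} (\<lambda>t. partial_deriv j (F t) x)"
    by (simp add: dir_deriv_eq[OF der] blinfun_apply_integral F')
qed

text \<open>The integrals of the members of \<open>X\<close> form an invariant class for
  \<open>schwartz_coinduct\<close>: differentiation passes to the integrand, which stays in
  \<open>X\<close>, and the decay is uniform in the parameter.\<close>

lemma parametric_integral_schwartz:
  fixes X :: "(real \<Rightarrow> real ^ 'n \<Rightarrow> complex) set"
  assumes F: "F \<in> X"
    and diff: "\<And>F t x. F \<in> X \<Longrightarrow> F t differentiable (at x)"
    and cont: "\<And>F. F \<in> X \<Longrightarrow> continuous_on UNIV (\<lambda>(x, t). F t x)"
    and deriv: "\<And>F j. F \<in> X \<Longrightarrow> (\<lambda>t. partial_deriv j (F t)) \<in> X"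
    and decay: "\<And>F m. F \<in> X \<Longrightarrow> \<exists>C. \<forall>t\<in>{0..1}. \<forall>x. norm (F t x) * (1 + norm x) ^ m \<le> C"
  shows "(\<lambda>x. integral {0..1} (\<lambda>t. F t x)) \<in> schwartz_space"
proof (rule schwartz_coinduct[where X = "(\<lambda>F x. integral {0..1} (\<lambda>t. F t x)) ` X"])
  show "(\<lambda>x. integral {0..1} (\<lambda>t. F t x)) \<in> (\<lambda>F x. integral {0..1} (\<lambda>t. F t x)) ` X"
    using F by blast
next
  fix f x assume "f \<in> (\<lambda>F x. integral {0..1} (\<lambda>t. F t x)) ` X"
  then obtain F where F: "F \<in> X" "f = (\<lambda>x. integral {0..1} (\<lambda>t. F t x))" by blast
  show "f differentiable (at x)"
    unfolding F(2) by (rule parametric_integral(1)[of F, OF diff[OF F(1)] cont[OF F(1)] cont[OF deriv[OF F(1)]]])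
next
  fix f j assume "f \<in> (\<lambda>F x. integral {0..1} (\<lambda>t. F t x)) ` X"
  then obtain F where F: "F \<in> X" "f = (\<lambda>x. integral {0..1} (\<lambda>t. F t x))" by blast
  have eq: "partial_deriv j f = (\<lambda>x. integral {0..1} (\<lambda>t. partial_deriv j (F t) x))"
    unfolding F(2) using parametric_integral(2)[of F, OF diff[OF F(1)] cont[OF F(1)] cont[OF deriv[OF F(1)]]] by (rule ext)
  show "partial_deriv j f \<in> (\<lambda>F x. integral {0..1} (\<lambda>t. F t x)) ` X"
    unfolding eq using imageI[OF deriv[OF F(1), of j], of "\<lambda>F x. integral {0..1} (\<lambda>t. F t x)"] by simp
next
  fix f assume "f \<in> (\<lambda>F x. integral {0..1} (\<lambda>t. F t x)) ` X"
  then obtain F where F: "F \<in> X" "f = (\<lambda>x. integral {0..1} (\<lambda>t. F t x))" by blast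
  show "rapid f"
    unfolding rapid_def
  proof
    fix m
    obtain C where C: "\<And>t x. t \<in> {0..1} \<Longrightarrow> norm (F t x) * (1 + norm x) ^ m \<le> C"
      using decay[OF F(1), of m] by blast
    have "norm (f x) * (1 + norm x) ^ m \<le> C" for x
    proof -
      have p: "0 < (1 + norm x) ^ m" by (simp add: add_pos_nonneg)
      have "norm (integral {0..1} (\<lambda>t. F t x)) \<le> (C / (1 + norm x) ^ m) * (1 - 0)"
      proof (rule integral_bound)
        show "continuous_on {0..1} (\<lambda>t. F t x)"
          using continuous_on_compose2[OF cont[OF F(1)], of "{0..1}" "\<lambda>t. (x, t)"] by (simp add: continuous_on_Pair)
        show "norm (F t x) \<le> C / (1 + norm x) ^ m" if "t \<in> {0..1}" for t
          using C[OF that, of x] p by (simp add: pos_le_divide_eq)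
      qed simp
      then show ?thesis using p by (simp add: F(2) pos_le_divide_eq)
    qed
    then show "\<exists>C. \<forall>x. norm (f x) * (1 + norm x) ^ m \<le> C" by blast
  qed
qed

text \<open>Real polynomials jointly in the parameter and the coordinates, generated inductively so
  that differentiation, continuity and growth follow by rule induction.\<close>

inductive polynomial_family :: "(real \<Rightarrow> real ^ 'n \<Rightarrow> real) \<Rightarrow> bool" where
  const: "polynomial_family (\<lambda>t x. c)"
| param: "polynomial_family (\<lambda>t x. t)"
| coord: "polynomial_family (\<lambda>t x. x $ i)"
| add: "polynomial_family p \<Longrightarrow> polynomial_family q \<Longrightarrow> polynomial_family (\<lambda>t x. p t x + q t x)"
| mult: "polynomial_family p \<Longrightarrow> polynomial_family q \<Longrightarrow> polynomial_family (\<lambda>t x. p t x * q t x)"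

lemma polynomial_family_sum:
  assumes "finite I" "\<And>i. i \<in> I \<Longrightarrow> polynomial_family (p i)"
  shows "polynomial_family (\<lambda>t x. \<Sum>i\<in>I. p i t x)"
  using assms
  by (induction I rule: finite_induct) (auto intro: polynomial_family.const polynomial_family.add)

lemma polynomial_family_linear:
  fixes A :: "real ^ 'n \<Rightarrow> real ^ 'n"
  assumes "linear A"
  shows "polynomial_family (\<lambda>t x. A x $ i)"
proof -
  have "(\<lambda>(t :: real) x. A x $ i) = (\<lambda>t x. \<Sum>j\<in>UNIV. A (axis j 1) $ i * x $ j)"
  proof (intro ext)
    fix x
    have "A x = A (\<Sum>j\<in>UNIV. x $ j *\<^sub>R axis j 1)"
      using basis_expansion[of x] by (simp add: scalar_mult_eq_scaleR)
    then show "A x $ i = (\<Sum>j\<in>UNIV. A (axis j 1) $ i * x $ j)"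
      by (simp only: linear_sum[OF assms] linear_cmul[OF assms] sum_component vector_scaleR_component) (simp add: mult.commute)
  qed
  moreover have "polynomial_family (\<lambda>t x. \<Sum>j\<in>UNIV. A (axis j 1) $ i * x $ j)"
    by (intro polynomial_family_sum polynomial_family.const polynomial_family.coord polynomial_family.mult) auto
  ultimately show ?thesis by simp
qed

lemma polynomial_family_deriv:
  assumes "polynomial_family p"
  shows "\<exists>p'. polynomial_family p' \<and> (\<forall>t x. \<exists>D. (p t has_derivative D) (at x) \<and> D (axis j 1) = p' t x)"
  using assms
proof (induction rule: polynomial_family.induct)
  case (const c)
  show ?case
    by (rule exI[of _ "\<lambda>t x. 0"]) (auto intro!: polynomial_family.const exI[of _ "\<lambda>h. 0"])
next
  case param
  show ?case
    by (rule exI[of _ "\<lambda>t x. 0"]) (auto intro!: polynomial_family.const exI[of _ "\<lambda>h. 0"])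
next
  case (coord i)
  show ?case
    by (rule exI[of _ "\<lambda>t x. axis j 1 $ i"])
      (auto intro!: polynomial_family.const exI[of _ "\<lambda>h. h $ i"] bounded_linear_imp_has_derivative bounded_linear_vec_nth)
next
  case (add p q)
  then obtain p' q' where p': "polynomial_family p'" "\<And>t x. \<exists>D. (p t has_derivative D) (at x) \<and> D (axis j 1) = p' t x"
    and q': "polynomial_family q'" "\<And>t x. \<exists>D. (q t has_derivative D) (at x) \<and> D (axis j 1) = q' t x" by blast
  have "\<exists>D. ((\<lambda>x. p t x + q t x) has_derivative D) (at x) \<and> D (axis j 1) = p' t x + q' t x" for t x
  proof -
    obtain D E where "(p t has_derivative D) (at x)" "D (axis j 1) = p' t x"
      "(q t has_derivative E) (at x)" "E (axis j 1) = q' t x" using p'(2) q'(2) by blast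
    then show ?thesis by (intro exI[of _ "\<lambda>h. D h + E h"]) (auto intro: has_derivative_add)
  qed
  then show ?case using polynomial_family.add[OF p'(1) q'(1)] by blast
next
  case (mult p q)
  then obtain p' q' where p': "polynomial_family p'" "\<And>t x. \<exists>D. (p t has_derivative D) (at x) \<and> D (axis j 1) = p' t x"
    and q': "polynomial_family q'" "\<And>t x. \<exists>D. (q t has_derivative D) (at x) \<and> D (axis j 1) = q' t x" by blast
  have "\<exists>D. ((\<lambda>x. p t x * q t x) has_derivative D) (at x) \<and> D (axis j 1) = p t x * q' t x + p' t x * q t x" for t x
  proof -
    obtain D E where "(p t has_derivative D) (at x)" "D (axis j 1) = p' t x"
      "(q t has_derivative E) (at x)" "E (axis j 1) = q' t x" using p'(2) q'(2) by blast
    then show ?thesis by (intro exI[of _ "\<lambda>h. p t x * E h + D h * q t x"]) (auto intro: has_derivative_mult)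
  qed
  moreover have "polynomial_family (\<lambda>t x. p t x * q' t x + p' t x * q t x)"
    by (intro polynomial_family.add polynomial_family.mult mult p' q')
  ultimately show ?case by blast
qed

lemma polynomial_family_continuous:
  assumes "polynomial_family p"
  shows "continuous_on UNIV (\<lambda>y. p (snd y) (fst y))"
  using assms
proof (induction rule: polynomial_family.induct)
  case (coord i)
  show ?case by (intro continuous_intros)
next
  case (add p q)
  then show ?case by (intro continuous_on_add)
next
  case (mult p q)
  then show ?case by (intro continuous_on_mult)
qed (intro continuous_intros)+

lemma polynomial_family_bound:
  assumes "polynomial_family p"
  shows "\<exists>C K. C \<ge> 0 \<and> (\<forall>t\<in>{0..1}. \<forall>x. \<bar>p t x\<bar> \<le> C * (1 + norm x) ^ K)"
  using assms
proof (induction rule: polynomial_family.induct)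
  case (const c)
  show ?case by (rule exI[of _ "\<bar>c\<bar>"], rule exI[of _ 0]) auto
next
  case param
  show ?case by (rule exI[of _ 1], rule exI[of _ 0]) auto
next
  case (coord i)
  show ?case
    by (rule exI[of _ 1], rule exI[of _ 1]) (auto intro: order_trans[OF component_le_norm_cart])
next
  case (add p q)
  then obtain C K D M where C: "C \<ge> 0" "\<And>t x. t \<in> {0..1} \<Longrightarrow> \<bar>p t x\<bar> \<le> C * (1 + norm x) ^ K"
    and D: "D \<ge> 0" "\<And>t x. t \<in> {0..1} \<Longrightarrow> \<bar>q t x\<bar> \<le> D * (1 + norm x) ^ M" by blast
  have "\<bar>p t x + q t x\<bar> \<le> (C + D) * (1 + norm x) ^ (K + M)" if "t \<in> {0..1}" for t x
  proof -
    have "\<bar>p t x + q t x\<bar> \<le> C * (1 + norm x) ^ K + D * (1 + norm x) ^ M"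
      using C(2)[OF that, of x] D(2)[OF that, of x] by linarith
    also have "\<dots> \<le> C * (1 + norm x) ^ (K + M) + D * (1 + norm x) ^ (K + M)"
      using C(1) D(1) by (intro add_mono mult_left_mono power_increasing) auto
    finally show ?thesis by (simp add: distrib_right)
  qed
  then show ?case using C(1) D(1) by (intro exI[of _ "C + D"] exI[of _ "K + M"]) auto
next
  case (mult p q)
  then obtain C K D M where C: "C \<ge> 0" "\<And>t x. t \<in> {0..1} \<Longrightarrow> \<bar>p t x\<bar> \<le> C * (1 + norm x) ^ K"
    and D: "D \<ge> 0" "\<And>t x. t \<in> {0..1} \<Longrightarrow> \<bar>q t x\<bar> \<le> D * (1 + norm x) ^ M" by blast
  have "\<bar>p t x * q t x\<bar> \<le> (C * D) * (1 + norm x) ^ (K + M)" if "t \<in> {0..1}" for t x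
  proof -
    have "\<bar>p t x * q t x\<bar> \<le> (C * (1 + norm x) ^ K) * (D * (1 + norm x) ^ M)"
      unfolding abs_mult using C(1) by (intro mult_mono C(2)[OF that] D(2)[OF that]) auto
    then show ?thesis by (simp add: power_add mult_ac)
  qed
  then show ?case using C(1) D(1) by (intro exI[of _ "C * D"] exI[of _ "K + M"]) auto
qed

text \<open>Along the affine maps \<open>L\<^sub>t\<close> a Schwartz function need not decay uniformly in \<open>t\<close> (a segment from \<open>x\<close>
  to \<open>\<sigma>\<^sub>v x\<close> comes close to the origin). The factor \<open>exp ((|L\<^sub>t x|\<^sup>2 - |x|\<^sup>2) / 2)\<close> restores the decay.\<close>

locale affine_family =
  fixes A B :: "real ^ 'n \<Rightarrow> real ^ 'n" and c d :: "real ^ 'n" and C0 :: real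
  assumes linear_A: "linear A" and linear_B: "linear B"
    and norm_bound: "\<And>t x. t \<in> {0..1} \<Longrightarrow> (norm (A x + c + t *\<^sub>R (B x + d)))\<^sup>2 \<le> (norm x)\<^sup>2 + C0"
begin

definition L :: "real \<Rightarrow> real ^ 'n \<Rightarrow> real ^ 'n" where
  "L t x = A x + c + t *\<^sub>R (B x + d)"

definition E :: "real \<Rightarrow> real ^ 'n \<Rightarrow> real" where
  "E t x = exp (((norm (L t x))\<^sup>2 - (norm x)\<^sup>2) / 2)"

text \<open>Differentiating \<open>E\<close> or the inner map \<open>L\<close> only produces
  polynomial factors and partial derivatives of \<open>h\<close>, so finite sums of such products
  are closed under partial derivatives.\<close>

inductive_set family :: "(real \<Rightarrow> real ^ 'n \<Rightarrow> complex) set" where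
  base: "polynomial_family p \<Longrightarrow> h \<in> schwartz_space \<Longrightarrow> (\<lambda>t x. of_real (p t x * E t x) * h (L t x)) \<in> family"
| add: "F \<in> family \<Longrightarrow> H \<in> family \<Longrightarrow> (\<lambda>t x. F t x + H t x) \<in> family"

lemma L_bounded_linear: "bounded_linear (\<lambda>x. A x + t *\<^sub>R B x)"
  using linear_A linear_B
  by (auto simp: linear_conv_bounded_linear intro!: bounded_linear_add bounded_linear_const_scaleR)

lemma L_has_derivative: "(L t has_derivative (\<lambda>x. A x + t *\<^sub>R B x)) (at x)"
proof -
  have "L t = (\<lambda>x. (A x + t *\<^sub>R B x) + (c + t *\<^sub>R d))"
    by (simp add: L_def fun_eq_iff algebra_simps)
  then show ?thesis
    using has_derivative_add[OF bounded_linear_imp_has_derivative[OF L_bounded_linear] has_derivative_const] by simp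
qed

lemma L_polynomial: "polynomial_family (\<lambda>t x. L t x $ i)"
  unfolding L_def vector_add_component vector_scaleR_component real_scaleR_def
  by (intro polynomial_family.add polynomial_family.mult polynomial_family.const polynomial_family.param
      polynomial_family_linear linear_A linear_B)

lemma L_continuous: "continuous_on UNIV (\<lambda>p. L (snd p) (fst p))"
proof -
  have fst: "continuous_on UNIV (fst :: (real ^ 'n) \<times> real \<Rightarrow> real ^ 'n)"
    by (intro continuous_on_fst continuous_on_id)
  show ?thesis
    unfolding L_def
    by (intro continuous_intros linear_continuous_on_compose[OF fst linear_A]
        linear_continuous_on_compose[OF fst linear_B])
qed

lemma E_continuous: "continuous_on UNIV (\<lambda>p. E (snd p) (fst p))"
  unfolding E_def by (intro continuous_intros L_continuous) auto

lemma E_has_derivative: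
  "(E t has_derivative (\<lambda>h. E t x * (L t x \<bullet> (A h + t *\<^sub>R B h) - x \<bullet> h))) (at x)"
proof -
  have "((\<lambda>x. (1 / 2) * (L t x \<bullet> L t x - x \<bullet> x)) has_derivative
      (\<lambda>h. (1 / 2) * ((L t x \<bullet> (A h + t *\<^sub>R B h) + (A h + t *\<^sub>R B h) \<bullet> L t x) - (x \<bullet> h + h \<bullet> x)))) (at x)"
    by (intro has_derivative_mult_right has_derivative_diff has_derivative_inner L_has_derivative has_derivative_ident)
  note der = has_derivative_exp[OF this]
  have eq: "E t = (\<lambda>x. exp ((1 / 2) * (L t x \<bullet> L t x - x \<bullet> x)))"
    by (simp add: E_def fun_eq_iff power2_norm_eq_inner)
  show ?thesis
    unfolding eq by (rule has_derivative_eq_rhs[OF der]) (auto simp: fun_eq_iff inner_commute)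
qed

lemma family_sum:
  assumes "finite I" "I \<noteq> {}" "\<And>i. i \<in> I \<Longrightarrow> F i \<in> family"
  shows "(\<lambda>t x. \<Sum>i\<in>I. F i t x) \<in> family"
  using assms by (induction I rule: finite_ne_induct) (auto intro: family.add)

lemma family_differentiable_deriv:
  assumes "F \<in> family"
  shows "(\<forall>t x. F t differentiable (at x)) \<and> (\<lambda>t. partial_deriv j (F t)) \<in> family"
  using assms
proof (induction rule: family.induct)
  case (base p h)
  obtain p' where p': "polynomial_family p'" "\<And>t x. \<exists>D. (p t has_derivative D) (at x) \<and> D (axis j 1) = p' t x"
    using polynomial_family_deriv[OF base(1)] by blast
  let ?M = "\<lambda>t. A (axis j 1) + t *\<^sub>R B (axis j 1)"
  let ?F = "\<lambda>t x. of_real (p t x * E t x) * h (L t x)"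
  \<comment> \<open>The coefficient of \<open>h\<close> in the derivative: the derivative of
    \<open>p\<close> plus \<open>p\<close> times the logarithmic derivative of \<open>E t\<close> in
    the direction \<open>j\<close>.\<close>
  define q where "q t x = p' t x + p t x * ((\<Sum>i\<in>UNIV. L t x $ i * ?M t $ i) - x $ j)" for t x
  have M_poly: "polynomial_family (\<lambda>t x. ?M t $ i)" for i
    by (simp add: polynomial_family.add polynomial_family.mult polynomial_family.const polynomial_family.param)
  have q_eq: "q = (\<lambda>t x. p' t x + p t x * ((\<Sum>i\<in>UNIV. L t x $ i * ?M t $ i) + (- 1) * x $ j))"
    by (simp add: q_def fun_eq_iff)
  have q: "polynomial_family q"
    unfolding q_eq
    by (intro polynomial_family.add polynomial_family.mult polynomial_family_sum L_polynomial M_poly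
        polynomial_family.const polynomial_family.coord p' base) auto
  have *: "?F t differentiable (at x) \<and> partial_deriv j (?F t) x = of_real (q t x * E t x) * h (L t x) +
      (\<Sum>i\<in>UNIV. of_real ((p t x * ?M t $ i) * E t x) * partial_deriv i h (L t x))" for t x
  proof -
    obtain D where D: "(p t has_derivative D) (at x)" "D (axis j 1) = p' t x" using p'(2) by blast
    note hd = schwartz_differentiable[OF base(2), of "L t x"]
    have 1: "((\<lambda>x. h (L t x)) has_derivative (\<lambda>v. dir_deriv (A v + t *\<^sub>R B v) h (L t x))) (at x)"
      by (rule has_derivative_compose[OF L_has_derivative has_derivative_dir_deriv[OF hd]])
    have 2: "((\<lambda>x. of_real (p t x * E t x) :: complex) has_derivative
        (\<lambda>v. of_real (p t x * (E t x * (L t x \<bullet> (A v + t *\<^sub>R B v) - x \<bullet> v)) + D v * E t x))) (at x)"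
      by (rule has_derivative_of_real[OF has_derivative_mult[OF D(1) E_has_derivative]])
    note 3 = has_derivative_mult[OF 2 1]
    have "partial_deriv j (?F t) x = of_real (p t x * E t x) * dir_deriv (?M t) h (L t x)
        + of_real (p t x * (E t x * (L t x \<bullet> ?M t - x \<bullet> axis j 1)) + D (axis j 1) * E t x) * h (L t x)"
      by (rule dir_deriv_eq[OF 3])
    also have "dir_deriv (?M t) h (L t x) = (\<Sum>i\<in>UNIV. of_real (?M t $ i) * partial_deriv i h (L t x))"
      by (rule linear_axis_expansion[OF linear_dir_deriv[OF hd]])
    also have "p t x * (E t x * (L t x \<bullet> ?M t - x \<bullet> axis j 1)) + D (axis j 1) * E t x = q t x * E t x"
      unfolding D(2) q_def inner_vec_def[of "L t x"] by (simp add: inner_axis algebra_simps)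
    finally show ?thesis
      using 3 by (auto simp: differentiable_def sum_distrib_left mult_ac)
  qed
  have "(\<lambda>t x. of_real (q t x * E t x) * h (L t x) +
      (\<Sum>i\<in>UNIV. of_real ((p t x * ?M t $ i) * E t x) * partial_deriv i h (L t x))) \<in> family"
    by (intro family.add family_sum family.base q base polynomial_family.mult M_poly schwartz_partial_deriv) auto
  moreover have "(\<lambda>t. partial_deriv j (?F t)) = (\<lambda>t x. of_real (q t x * E t x) * h (L t x) +
      (\<Sum>i\<in>UNIV. of_real ((p t x * ?M t $ i) * E t x) * partial_deriv i h (L t x)))"
    by (intro ext conjunct2[OF *])
  ultimately show ?case using conjunct1[OF *] by (simp only:) simp
next
  case (add F H)
  have "dir_deriv v (\<lambda>x. F t x + H t x) x = dir_deriv v (F t) x + dir_deriv v (H t) x" for v t x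
    using add by (intro dir_deriv_eq has_derivative_add has_derivative_dir_deriv) auto
  then show ?case
    using add family.add[of "\<lambda>t. partial_deriv j (F t)" "\<lambda>t. partial_deriv j (H t)"]
    by (auto intro: differentiable_add)
qed

lemma family_differentiable: "F \<in> family \<Longrightarrow> F t differentiable (at x)"
  using family_differentiable_deriv by blast

lemma family_deriv: "F \<in> family \<Longrightarrow> (\<lambda>t. partial_deriv j (F t)) \<in> family"
  using family_differentiable_deriv by blast

lemma family_continuous: "F \<in> family \<Longrightarrow> continuous_on UNIV (\<lambda>(x, t). F t x)"
proof (induction rule: family.induct)
  case (base p h)
  have 1: "continuous_on UNIV (\<lambda>y. p (snd y) (fst y))"
    by (rule polynomial_family_continuous[OF base(1)])
  have 2: "continuous_on UNIV (\<lambda>y. h (L (snd y) (fst y)))"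
    by (rule continuous_on_compose2[OF continuous_differentiable L_continuous, where t = UNIV])
      (auto intro: schwartz_differentiable base)
  show ?case
    unfolding case_prod_beta by (intro continuous_intros 1 2 E_continuous)
next
  case (add F H)
  then show ?case by (simp add: case_prod_beta continuous_on_add)
qed

text \<open>Two regimes. If |x|^2 \<le> 2 |L_t x|^2, the decay of \<open>h\<close> at the image
  point controls powers of |x|, and \<open>norm_bound\<close> controls \<open>E\<close>. Otherwise
  the exponent in \<open>E\<close> is at most -|x|^2 / 4 and a Gaussian supplies the decay.\<close>

lemma base_decay:
  assumes h: "rapid h"
  shows "\<exists>C. \<forall>t\<in>{0..1}. \<forall>x. E t x * norm (h (L t x)) * (1 + norm x) ^ m \<le> C"
proof -
  obtain C where C: "\<And>x. norm (h x) * (1 + norm x) ^ m \<le> C" using h unfolding rapid_def by blast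
  obtain D where D: "\<And>x. norm (h x) * (1 + norm x) ^ 0 \<le> D" using h unfolding rapid_def by blast
  have "rapid (\<lambda>x :: real ^ 'n. exp (- (1 / 4) * (norm x)\<^sup>2))" by (rule rapid_gaussian) simp
  then obtain M where "\<And>x :: real ^ 'n. norm (exp (- (1 / 4) * (norm x)\<^sup>2)) * (1 + norm x) ^ m \<le> M"
    unfolding rapid_def by blast
  then have M: "exp (- (1 / 4) * (norm x)\<^sup>2) * (1 + norm x) ^ m \<le> M" for x :: "real ^ 'n" by simp
  have D0: "0 \<le> D" using order_trans[OF norm_ge_zero, of "h 0" D] D[of 0] by simp
  have C0': "0 \<le> C" using order_trans[OF norm_ge_zero, of "h 0" C] C[of 0] by simp
  have M0: "0 \<le> M" using order_trans[OF exp_ge_zero, of "- (1 / 4) * (norm (0 :: real ^ 'n))\<^sup>2" M] M[of 0] by simp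
  have "E t x * norm (h (L t x)) * (1 + norm x) ^ m \<le> exp (C0 / 2) * 2 ^ m * C + M * D"
    if t: "t \<in> {0..1}" for t x
  proof (cases "(norm x)\<^sup>2 \<le> 2 * (norm (L t x))\<^sup>2")
    case True
    have "(norm (L t x))\<^sup>2 - (norm x)\<^sup>2 \<le> C0" using norm_bound[OF t, of x] by (simp add: L_def)
    then have E: "E t x \<le> exp (C0 / 2)" by (simp add: E_def)
    have "(2 * norm (L t x))\<^sup>2 = 4 * (norm (L t x))\<^sup>2" by (simp add: power_mult_distrib)
    then have "(norm x)\<^sup>2 \<le> (2 * norm (L t x))\<^sup>2"
      using True zero_le_power2[of "norm (L t x)"] by linarith
    then have "norm x \<le> 2 * norm (L t x)" by (rule power2_le_imp_le) simp
    then have "(1 + norm x) ^ m \<le> (2 * (1 + norm (L t x))) ^ m" by (intro power_mono) auto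
    then have "norm (h (L t x)) * (1 + norm x) ^ m \<le> norm (h (L t x)) * (2 ^ m * (1 + norm (L t x)) ^ m)"
      unfolding power_mult_distrib by (intro mult_left_mono) auto
    also have "\<dots> \<le> 2 ^ m * C" using C[of "L t x"] by (simp add: mult_ac)
    finally have le: "norm (h (L t x)) * (1 + norm x) ^ m \<le> 2 ^ m * C" .
    have "E t x * (norm (h (L t x)) * (1 + norm x) ^ m) \<le> exp (C0 / 2) * (2 ^ m * C)"
      by (rule mult_mono[OF E le]) auto
    moreover have "0 \<le> M * D" using M0 D0 by simp
    ultimately show ?thesis by (simp add: mult.assoc)
  next
    case False
    then have "((norm (L t x))\<^sup>2 - (norm x)\<^sup>2) / 2 \<le> - (1 / 4) * (norm x)\<^sup>2" by simp
    then have "E t x * (1 + norm x) ^ m \<le> exp (- (1 / 4) * (norm x)\<^sup>2) * (1 + norm x) ^ m"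
      unfolding E_def by (intro mult_right_mono) auto
    then have "E t x * (1 + norm x) ^ m \<le> M" using M[of x] by linarith
    then have "(E t x * (1 + norm x) ^ m) * norm (h (L t x)) \<le> M * D"
      using D[of "L t x"] M0 by (intro mult_mono) auto
    moreover have "0 \<le> exp (C0 / 2) * 2 ^ m * C" using C0' by simp
    ultimately show ?thesis by (simp add: mult_ac)
  qed
  then show ?thesis by blast
qed

lemma family_decay: "F \<in> family \<Longrightarrow> \<exists>C. \<forall>t\<in>{0..1}. \<forall>x. norm (F t x) * (1 + norm x) ^ m \<le> C"
proof (induction rule: family.induct)
  case (base p h)
  obtain D K where D: "D \<ge> 0" "\<And>t x. t \<in> {0..1} \<Longrightarrow> \<bar>p t x\<bar> \<le> D * (1 + norm x) ^ K"
    using polynomial_family_bound[OF base(1)] by blast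
  obtain C where C: "\<And>t x. t \<in> {0..1} \<Longrightarrow> E t x * norm (h (L t x)) * (1 + norm x) ^ (K + m) \<le> C"
    using base_decay[OF schwartz_rapid[OF base(2)]] by blast
  have "norm (of_real (p t x * E t x) * h (L t x)) * (1 + norm x) ^ m \<le> D * C" if t: "t \<in> {0..1}" for t x
  proof -
    have "norm (of_real (p t x * E t x) * h (L t x)) * (1 + norm x) ^ m = \<bar>p t x\<bar> * (E t x * norm (h (L t x)) * (1 + norm x) ^ m)"
      by (simp add: norm_mult E_def mult_ac)
    also have "\<dots> \<le> (D * (1 + norm x) ^ K) * (E t x * norm (h (L t x)) * (1 + norm x) ^ m)"
      by (intro mult_right_mono D t) (simp add: E_def)
    also have "\<dots> = D * (E t x * norm (h (L t x)) * (1 + norm x) ^ (K + m))"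
      by (simp add: power_add mult_ac)
    also have "\<dots> \<le> D * C" by (intro mult_left_mono C t D)
    finally show ?thesis .
  qed
  then show ?case by blast
next
  case (add F H)
  then obtain C D where C: "\<And>t x. t \<in> {0..1} \<Longrightarrow> norm (F t x) * (1 + norm x) ^ m \<le> C"
    and D: "\<And>t x. t \<in> {0..1} \<Longrightarrow> norm (H t x) * (1 + norm x) ^ m \<le> D" by blast
  have "norm (F t x + H t x) * (1 + norm x) ^ m \<le> C + D" if t: "t \<in> {0..1}" for t x
    using mult_right_mono[OF norm_triangle_ineq[of "F t x" "H t x"], of "(1 + norm x) ^ m"] C[OF t, of x] D[OF t, of x]
    by (simp add: distrib_right)
  then show ?case by blast
qed

lemma family_integral_schwartz: "F \<in> family \<Longrightarrow> (\<lambda>x. integral {0..1} (\<lambda>t. F t x)) \<in> schwartz_space"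
  by (rule parametric_integral_schwartz[where X = family])
    (assumption, erule family_differentiable, erule family_continuous, erule family_deriv, erule family_decay)

lemma integral_schwartz:
  assumes "h \<in> schwartz_space"
  shows "(\<lambda>x. integral {0..1} (\<lambda>t. of_real (E t x) * h (L t x))) \<in> schwartz_space"
  using family_integral_schwartz[OF family.base[OF polynomial_family.const[of 1] assms]] by simp

text \<open>The fundamental theorem of calculus for E_t(x) h(L_t x) as a function of t; the term
  with the inner product is the derivative of the exponential factor.\<close>

lemma increment_eq_integral:
  assumes h: "h \<in> schwartz_space"
  shows "of_real (E 1 x) * h (L 1 x) - of_real (E 0 x) * h (L 0 x) = integral {0..1} (\<lambda>t. of_real (E t x) *
    (of_real (L t x \<bullet> (B x + d)) * h (L t x) + dir_deriv (B x + d) h (L t x)))"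
proof -
  let ?v = "B x + d"
  have "((\<lambda>t. of_real (E t x) * h (L t x)) has_vector_derivative of_real (E t x) *
    (of_real (L t x \<bullet> ?v) * h (L t x) + dir_deriv ?v h (L t x))) (at t)" for t
  proof -
    have L: "((\<lambda>t. L t x) has_derivative (\<lambda>s. s *\<^sub>R ?v)) (at t)"
      unfolding L_def by (auto intro!: derivative_eq_intros)
    have "((\<lambda>t. (1 / 2) * (L t x \<bullet> L t x - x \<bullet> x)) has_derivative
        (\<lambda>s. (1 / 2) * ((L t x \<bullet> (s *\<^sub>R ?v) + (s *\<^sub>R ?v) \<bullet> L t x) - 0))) (at t)"
      by (intro has_derivative_mult_right has_derivative_diff has_derivative_inner L has_derivative_const)
    note der = has_derivative_exp[OF this]
    have eq: "(\<lambda>t. E t x) = (\<lambda>t. exp ((1 / 2) * (L t x \<bullet> L t x - x \<bullet> x)))"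
      by (simp add: E_def fun_eq_iff power2_norm_eq_inner)
    have E: "((\<lambda>t. E t x) has_derivative (\<lambda>s. s * (E t x * (L t x \<bullet> ?v)))) (at t)"
      unfolding eq by (rule has_derivative_eq_rhs[OF der]) (auto simp: fun_eq_iff inner_commute fun_cong[OF eq])
    have 1: "((\<lambda>t. h (L t x)) has_derivative (\<lambda>s. dir_deriv (s *\<^sub>R ?v) h (L t x))) (at t)"
      by (rule has_derivative_compose[OF L has_derivative_dir_deriv[OF schwartz_differentiable[OF h]]])
    have "((\<lambda>t. of_real (E t x) * h (L t x)) has_derivative (\<lambda>s. of_real (E t x) * dir_deriv (s *\<^sub>R ?v) h (L t x)
        + of_real (s * (E t x * (L t x \<bullet> ?v))) * h (L t x))) (at t)"
      by (rule has_derivative_mult[OF has_derivative_of_real[OF E] 1])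
    moreover have "of_real e * (s *\<^sub>R D) + of_real (s * (e * q)) * z = s *\<^sub>R (of_real e * (of_real q * z + D))"
      for e s q and z D :: complex
      by (simp add: scaleR_conv_of_real[where 'a = complex] algebra_simps)
    ultimately show ?thesis
      unfolding has_vector_derivative_def
      by (simp only: linear_cmul[OF linear_dir_deriv[OF schwartz_differentiable[OF h]]])
  qed
  note der = this
  have "((\<lambda>t. of_real (E t x) *
    (of_real (L t x \<bullet> ?v) * h (L t x) + dir_deriv ?v h (L t x))) has_integral
      of_real (E 1 x) * h (L 1 x) - of_real (E 0 x) * h (L 0 x)) {0..1}"
    by (rule fundamental_theorem_of_calculus[OF zero_le_one has_vector_derivative_at_within[OF der]])
  then show ?thesis by (simp add: integral_unique)
qed

end

text \<open>For the constant segment the integral over the parameter is the integrand itself, so the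
  closure theorem specialises to sums and products with polynomials.\<close>

interpretation id_family: affine_family "\<lambda>x :: real ^ 'n. x" "\<lambda>x. 0" 0 0 0
  by unfold_locales (auto intro: linear_id[unfolded id_def] linear_zero)

lemma id_family_E_L [simp]: "id_family.E t x = 1" "id_family.L t x = x"
  by (simp_all add: id_family.E_def id_family.L_def)

section \<open>Closure properties of the Schwartz space\<close>

lemma schwartz_add:
  assumes "f \<in> schwartz_space" "g \<in> schwartz_space"
  shows "(\<lambda>x. f x + g x) \<in> schwartz_space"
  using id_family.family_integral_schwartz[OF id_family.family.add[OF
        id_family.family.base[OF polynomial_family.const[of 1] assms(1)]
        id_family.family.base[OF polynomial_family.const[of 1] assms(2)]]] by simp

lemma schwartz_coordinate: "f \<in> schwartz_space \<Longrightarrow> (\<lambda>x. of_real (x $ i) * f x) \<in> schwartz_space"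
  using id_family.family_integral_schwartz[OF id_family.family.base[OF polynomial_family.coord[of i]]] by simp

lemma schwartz_cmult: "f \<in> schwartz_space \<Longrightarrow> (\<lambda>x. of_real r * f x) \<in> schwartz_space"
  using id_family.family_integral_schwartz[OF id_family.family.base[OF polynomial_family.const[of r]]] by simp

lemma schwartz_sum:
  assumes "finite I" "I \<noteq> {}" "\<And>i. i \<in> I \<Longrightarrow> f i \<in> schwartz_space"
  shows "(\<lambda>x. \<Sum>i\<in>I. f i x) \<in> schwartz_space"
  using assms by (induction I rule: finite_ne_induct) (auto intro: schwartz_add)

lemma schwartz_dir_deriv:
  assumes "f \<in> schwartz_space"
  shows "dir_deriv v f \<in> schwartz_space"
proof -
  have "dir_deriv v f = (\<lambda>x. \<Sum>i\<in>UNIV. of_real (v $ i) * partial_deriv i f x)"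
    using linear_axis_expansion[OF linear_dir_deriv[OF schwartz_differentiable[OF assms]]] by blast
  also have "\<dots> \<in> schwartz_space"
    by (intro schwartz_sum schwartz_cmult schwartz_partial_deriv assms) auto
  finally show ?thesis .
qed

lemma schwartz_inner:
  assumes "f \<in> schwartz_space"
  shows "(\<lambda>x. of_real (v \<bullet> x) * f x) \<in> schwartz_space"
proof -
  have "(\<lambda>x. of_real (v \<bullet> x) * f x) = (\<lambda>x. \<Sum>i\<in>UNIV. of_real (v $ i) * (of_real (x $ i) * f x))"
    by (simp add: inner_vec_def sum_distrib_right mult.assoc)
  also have "\<dots> \<in> schwartz_space"
    by (intro schwartz_sum schwartz_cmult schwartz_coordinate assms) auto
  finally show ?thesis .
qed

text \<open>Integrating along the segment from \<open>x\<close> to its mirror image cancels the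
  denominator and leaves a formula without singularity. Both ends have the same norm, so the factor
  \<open>E\<close> is 1 at both and the increment of \<open>f\<close> is undisturbed.\<close>

lemma schwartz_dunkl_quotient:
  assumes f: "f \<in> schwartz_space" and v: "v \<noteq> 0"
  shows "dunkl_quotient v f \<in> schwartz_space"
proof -
  define B where "B x = - (2 * (x \<bullet> v) / (norm v)\<^sup>2) *\<^sub>R v" for x
  have B_refl: "reflect_along v x = x + B x" for x by (simp add: B_def reflect_along_def)
  have lin_B: "linear B"
    unfolding B_def by (intro linearI) (simp_all add: inner_add_left algebra_simps add_divide_distrib)
  interpret affine_family "\<lambda>x. x" B 0 0 0
  proof
    fix t :: real and x assume t: "t \<in> {0..1}"
    have "x + 0 + t *\<^sub>R (B x + 0) = (1 - t) *\<^sub>R x + t *\<^sub>R reflect_along v x"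
      by (simp add: B_refl algebra_simps)
    then have "norm (x + 0 + t *\<^sub>R (B x + 0)) \<le> (1 - t) * norm x + t * norm x"
      using t norm_triangle_ineq[of "(1 - t) *\<^sub>R x" "t *\<^sub>R reflect_along v x"] by simp
    then have "norm (x + 0 + t *\<^sub>R (B x + 0)) \<le> norm x" by (simp add: algebra_simps)
    then show "(norm (x + 0 + t *\<^sub>R (B x + 0)))\<^sup>2 \<le> (norm x)\<^sup>2 + 0"
      by (simp add: power_mono)
  qed (auto simp: linear_add[OF lin_B] linear_cmul[OF lin_B])
  define h where "h y = of_real (v \<bullet> y) * f y + dir_deriv v f y" for y
  have h: "h \<in> schwartz_space"
    unfolding h_def[abs_def] by (intro schwartz_add schwartz_inner schwartz_dir_deriv f)
  have "dunkl_quotient v f = (\<lambda>x. of_real (2 / (norm v)\<^sup>2) * integral {0..1} (\<lambda>t. of_real (E t x) * h (L t x)))"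
  proof
    fix x
    show "dunkl_quotient v f x = of_real (2 / (norm v)\<^sup>2) * integral {0..1} (\<lambda>t. of_real (E t x) * h (L t x))"
    proof (cases "v \<bullet> x = 0")
      case True
      \<comment> \<open>On the hyperplane the segment degenerates to a point, and the constant
        integrand is the value prescribed there.\<close>
      then have "B x = 0" by (simp add: B_def inner_commute)
      then have "L t x = x" "E t x = 1" for t by (simp_all add: L_def E_def)
      with True show ?thesis by (simp add: dunkl_quotient_def h_def)
    next
      case False
      define s where "s = 2 * (x \<bullet> v) / (norm v)\<^sup>2"
      have Bs: "B x + 0 = (- s) *\<^sub>R v" by (simp add: B_def s_def)
      have L01: "L 0 x = x" "L 1 x = reflect_along v x" by (simp_all add: L_def B_refl)
      have E01: "E 0 x = 1" "E 1 x = 1" by (simp_all add: E_def L01)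
      have "f (reflect_along v x) - f x = integral {0..1} (\<lambda>t. of_real (E t x) *
          (of_real (L t x \<bullet> ((- s) *\<^sub>R v)) * f (L t x) + dir_deriv ((- s) *\<^sub>R v) f (L t x)))"
        using increment_eq_integral[OF f, of x] unfolding Bs L01 E01 by simp
      also have "\<dots> = integral {0..1} (\<lambda>t. of_real (- s) * (of_real (E t x) * h (L t x)))"
        unfolding h_def linear_cmul[OF linear_dir_deriv[OF schwartz_differentiable[OF f]]] inner_scaleR_right
        by (intro arg_cong[where f = "integral {0..1}"] ext)
          (simp add: scaleR_conv_of_real[where 'a = complex] inner_commute algebra_simps)
      also have "\<dots> = of_real (- s) * integral {0..1} (\<lambda>t. of_real (E t x) * h (L t x))"
        by (rule integral_mult_right)
      finally have "f x - f (reflect_along v x) = of_real s * integral {0..1} (\<lambda>t. of_real (E t x) * h (L t x))"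
        by (simp add: algebra_simps)
      then have "dunkl_quotient v f x = of_real (s / (v \<bullet> x)) * integral {0..1} (\<lambda>t. of_real (E t x) * h (L t x))"
        using False by (simp add: dunkl_quotient_def)
      also have "s / (v \<bullet> x) = 2 / (norm v)\<^sup>2"
        using False by (simp add: s_def inner_commute)
      finally show ?thesis .
    qed
  qed
  also have "\<dots> \<in> schwartz_space"
    by (intro schwartz_cmult integral_schwartz h)
  finally show ?thesis .
qed

text \<open>On the segment from \<open>x0\<close> to \<open>x\<close> the exponential factor is 1 at
  the end \<open>x\<close> and a Gaussian in \<open>x\<close> at the end \<open>x0\<close>. The
  constant f x0 thus comes with a Gaussian factor, and the remainders can be Schwartz
  functions.\<close>

lemma schwartz_hadamard:
  fixes f :: "real ^ 'n \<Rightarrow> complex"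
  assumes f: "f \<in> schwartz_space"
  obtains u where "\<And>j. u j \<in> schwartz_space"
    "\<And>x. f x = of_real (exp (((norm x0)\<^sup>2 - (norm x)\<^sup>2) / 2)) * f x0 + (\<Sum>j\<in>UNIV. of_real (x $ j - x0 $ j) * u j x)"
proof -
  interpret affine_family "\<lambda>x. 0" "\<lambda>x. x" x0 "- x0" "(norm x0)\<^sup>2"
  proof
    fix t :: real and x :: "real ^ 'n" assume t: "t \<in> {0..1}"
    have eq: "0 + x0 + t *\<^sub>R (x + - x0) = (1 - t) *\<^sub>R x0 + t *\<^sub>R x" by (simp add: algebra_simps)
    have "norm ((1 - t) *\<^sub>R x0 + t *\<^sub>R x) \<le> (1 - t) * norm x0 + t * norm x"
      using t norm_triangle_ineq[of "(1 - t) *\<^sub>R x0" "t *\<^sub>R x"] by simp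
    also have "\<dots> \<le> (1 - t) * max (norm x0) (norm x) + t * max (norm x0) (norm x)"
      using t by (intro add_mono mult_left_mono) auto
    also have "\<dots> = max (norm x0) (norm x)" by (simp add: algebra_simps)
    finally have "(norm ((1 - t) *\<^sub>R x0 + t *\<^sub>R x))\<^sup>2 \<le> (max (norm x0) (norm x))\<^sup>2"
      by (intro power_mono) auto
    also have "\<dots> \<le> (norm x)\<^sup>2 + (norm x0)\<^sup>2" by (simp add: max_def)
    finally show "(norm (0 + x0 + t *\<^sub>R (x + - x0)))\<^sup>2 \<le> (norm x)\<^sup>2 + (norm x0)\<^sup>2"
      unfolding eq .
  qed (auto intro: linear_id[unfolded id_def] linear_zero)
  define h where "h j y = of_real (y $ j) * f y + partial_deriv j f y" for j y
  have h: "h j \<in> schwartz_space" for j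
    unfolding h_def[abs_def] by (intro schwartz_add schwartz_coordinate schwartz_partial_deriv f)
  define u where "u j x = integral {0..1} (\<lambda>t. of_real (E t x) * h j (L t x))" for j x
  have u: "u j \<in> schwartz_space" for j
    unfolding u_def[abs_def] by (rule integral_schwartz[OF h])
  have "f x = of_real (exp (((norm x0)\<^sup>2 - (norm x)\<^sup>2) / 2)) * f x0 + (\<Sum>j\<in>UNIV. of_real (x $ j - x0 $ j) * u j x)" for x
  proof -
    have int: "(\<lambda>t. of_real (E t x) * h j (L t x)) integrable_on {0..1}" for j
    proof (rule integrable_continuous_real)
      have "continuous_on UNIV (\<lambda>(y, t). of_real (E t y) * h j (L t y))"
        using family_continuous[OF family.base[OF polynomial_family.const[of 1] h[of j]]] by simp
      from continuous_on_compose2[OF this, of "{0..1}" "\<lambda>t. (x, t)"]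
      show "continuous_on {0..1} (\<lambda>t. of_real (E t x) * h j (L t x))" by (simp add: continuous_on_Pair)
    qed
    have "f x - of_real (exp (((norm x0)\<^sup>2 - (norm x)\<^sup>2) / 2)) * f x0 = integral {0..1} (\<lambda>t. of_real (E t x) *
        (of_real (L t x \<bullet> (x - x0)) * f (L t x) + dir_deriv (x - x0) f (L t x)))"
      using increment_eq_integral[OF f, of x] by (simp add: L_def E_def)
    also have "\<dots> = integral {0..1} (\<lambda>t. \<Sum>j\<in>UNIV. of_real (x $ j - x0 $ j) * (of_real (E t x) * h j (L t x)))"
    proof (intro arg_cong[where f = "integral {0..1}"] ext)
      fix t
      have "dir_deriv (x - x0) f (L t x) = (\<Sum>j\<in>UNIV. of_real (x $ j - x0 $ j) * partial_deriv j f (L t x))"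
        using linear_axis_expansion[OF linear_dir_deriv[OF schwartz_differentiable[OF f]], of "x - x0" "L t x"] by simp
      moreover have "(of_real (L t x \<bullet> (x - x0)) :: complex) = (\<Sum>j\<in>UNIV. of_real (x $ j - x0 $ j) * of_real (L t x $ j))"
        by (simp add: inner_vec_def mult.commute)
      ultimately show "of_real (E t x) * (of_real (L t x \<bullet> (x - x0)) * f (L t x) + dir_deriv (x - x0) f (L t x)) =
          (\<Sum>j\<in>UNIV. of_real (x $ j - x0 $ j) * (of_real (E t x) * h j (L t x)))"
        by (simp only: h_def sum_distrib_left sum_distrib_right sum.distrib[symmetric]) (simp add: algebra_simps)
    qed
    also have "\<dots> = (\<Sum>j\<in>UNIV. integral {0..1} (\<lambda>t. of_real (x $ j - x0 $ j) * (of_real (E t x) * h j (L t x))))"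
      by (rule integral_sum) (auto intro!: integrable_on_mult_right int)
    also have "\<dots> = (\<Sum>j\<in>UNIV. of_real (x $ j - x0 $ j) * u j x)"
      unfolding u_def by (intro sum.cong HOL.refl integral_mult_right)
    finally show ?thesis by (simp add: algebra_simps)
  qed
  with u that show thesis by blast
qed

lemma schwartz_moderate:
  assumes f: "f \<in> schwartz_space"
  shows "moderate f"
proof -
  have "poly_bounded (\<lambda>x. \<Sum>j\<in>UNIV. norm (partial_deriv j f x))"
    by (intro poly_bounded_sum poly_bounded_le[OF rapid_poly_bounded[OF schwartz_rapid[OF schwartz_partial_deriv[OF f]]]]) auto
  then obtain C K where C: "\<And>x. norm (\<Sum>j\<in>UNIV. norm (partial_deriv j f x)) \<le> C * (1 + norm x) ^ K"
    unfolding poly_bounded_def by blast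
  have "norm (dir_deriv a f x) \<le> C * norm a * (1 + norm x) ^ K" for a x
  proof -
    have "norm (dir_deriv a f x) \<le> (\<Sum>j\<in>UNIV. norm (of_real (a $ j) * partial_deriv j f x))"
      unfolding linear_axis_expansion[OF linear_dir_deriv[OF schwartz_differentiable[OF f]], of a x] by (rule norm_sum)
    also have "\<dots> \<le> (\<Sum>j\<in>UNIV. norm a * norm (partial_deriv j f x))"
      by (intro sum_mono) (simp add: norm_mult component_le_norm_cart mult_right_mono)
    also have "\<dots> \<le> norm a * (C * (1 + norm x) ^ K)"
      using C[of x] by (simp add: sum_distrib_left[symmetric] mult_left_mono sum_nonneg)
    finally show ?thesis by (simp add: mult_ac)
  qed
  then show ?thesis
    unfolding moderate_def using schwartz_differentiable[OF f] rapid_poly_bounded[OF schwartz_rapid[OF f]] by blast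
qed

lemma (in dunkl) schwartz_T:
  assumes f: "f \<in> schwartz_space"
  shows "T a f \<in> schwartz_space"
proof -
  have "(\<lambda>x. \<Sum>v\<in>Rp. of_real (k v * (v \<bullet> a)) * dunkl_quotient v f x) \<in> schwartz_space"
  \<comment> \<open>\<open>schwartz_sum\<close> is stated for nonempty index sets; the empty sum is
    obtained as a zero multiple of \<open>f\<close>.\<close>
  proof (cases "Rp = {}")
    case True
    then show ?thesis using schwartz_cmult[OF f, of 0] by simp
  next
    case False
    then show ?thesis
      by (intro schwartz_sum finite_Rp schwartz_cmult schwartz_dunkl_quotient f Rp_nonzero)
  qed
  then show ?thesis
    unfolding T_def[abs_def] by (intro schwartz_add schwartz_dir_deriv f)
qed

context dunkl
begin

section \<open>Inversion of the Dunkl transform\<close>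

lemma moderate_kernel: "moderate (kernel y)"
  unfolding moderate_def
proof (intro conjI allI differentiable_kernel)
  show "poly_bounded (kernel y)"
    by (rule poly_boundedI[of _ kernel_bound 0]) (simp add: norm_kernel_le)
  show "\<exists>C K. \<forall>a x. norm (dir_deriv a (kernel y) x) \<le> C * norm a * (1 + norm x) ^ K"
    using norm_dir_deriv_kernel by (intro exI[of _ "kernel_bound\<^sup>2 * norm y"] exI[of _ 0]) auto
qed

lemma kernel_swap: "kernel (- y) x = kernel (- x) y"
  by (simp add: kernel_uminus kernel_commute[of y])

lemma of_real_weight_measurable [measurable]: "(\<lambda>x. of_real (w x) :: complex) \<in> borel_measurable borel"
  by (rule measurable_compose[OF weight_measurable borel_measurable_of_real])

lemma rapid_weighted:
  fixes f g :: "real ^ 'n \<Rightarrow> complex"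
  assumes "rapid f" "poly_bounded g"
  shows "rapid (\<lambda>x. f x * g x * of_real (w x))"
  by (intro rapid_mult assms poly_bounded_of_real weight_poly_bounded)

lemma integrable_weighted:
  fixes f g :: "real ^ 'n \<Rightarrow> complex"
  assumes "rapid f" "poly_bounded g" "f \<in> borel_measurable borel" "g \<in> borel_measurable borel"
  shows "integrable lborel (\<lambda>x. f x * g x * of_real (w x))"
  by (intro integrable_rapid rapid_weighted assms(1,2) borel_measurable_times assms(3,4) of_real_weight_measurable)

text \<open>The Dunkl transform without its normalising constant, which
  \<open>dunkl_transform_eq\<close> restores.\<close>

definition hat :: "(real ^ 'n \<Rightarrow> complex) \<Rightarrow> real ^ 'n \<Rightarrow> complex" where
  "hat u \<xi> = (LINT x|lborel. u x * kernel (- \<xi>) x * of_real (w x))"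

abbreviation "c\<^sub>k \<equiv> dunkl_const Rp k"

lemma dunkl_transform_eq: "dunkl_transform Rp k u \<xi> = hat u \<xi> / of_real c\<^sub>k"
  by (simp add: dunkl_transform_def hat_def dunkl_kernel_eq_uminus)

lemma inv_dunkl_transform_eq:
  "inv_dunkl_transform Rp k g x = (LINT \<xi>|lborel. g \<xi> * kernel x \<xi> * of_real (w \<xi>)) / of_real c\<^sub>k"
  by (simp add: inv_dunkl_transform_def dunkl_kernel_eq)

lemma T_antisymmetric_rapid:
  assumes f: "moderate f" "rapid f" "rapid (T a f)" and g: "moderate g" "poly_bounded (T a g)"
  shows "(LINT x|lborel. T a f x * g x * of_real (w x)) = - (LINT x|lborel. f x * T a g x * of_real (w x))"
proof (rule T_antisymmetric[OF f(1) g(1)])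
  note [measurable] = moderate_measurable[OF f(1)] moderate_measurable[OF g(1)] T_measurable[OF f(1)] T_measurable[OF g(1)]
  show "integrable lborel (\<lambda>x. T a f x * g x * of_real (w x))"
    by (intro integrable_weighted f g moderate_poly_bounded) measurable
  show "integrable lborel (\<lambda>x. f x * T a g x * of_real (w x))"
    by (intro integrable_weighted f g) measurable
  have "integrable lborel (\<lambda>x. (of_real (a \<bullet> x) * f x) * g x * of_real (w x))"
    by (intro integrable_weighted rapid_mult' poly_bounded_of_real poly_bounded_inner f g moderate_poly_bounded) measurable
  then show "integrable lborel (\<lambda>x. of_real (a \<bullet> x) * (f x * g x * of_real (w x)))"
    by (simp add: mult.assoc)
qed

text \<open>Antisymmetry moves the operator onto the kernel with parameter -\<xi>, where it acts as
  the scalar -i<a, \<xi>>.\<close>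

lemma hat_T:
  assumes "moderate u" "rapid u" "rapid (T a u)"
  shows "hat (T a u) \<xi> = \<i> * of_real (a \<bullet> \<xi>) * hat u \<xi>"
proof -
  have Tk: "T a (kernel (- \<xi>)) = (\<lambda>x. - (\<i> * of_real (a \<bullet> \<xi>)) * kernel (- \<xi>) x)"
    by (simp add: T_kernel fun_eq_iff inner_commute)
  have "poly_bounded (T a (kernel (- \<xi>)))"
    by (rule T_poly_bounded[OF moderate_kernel])
  from T_antisymmetric_rapid[OF assms moderate_kernel this]
  have "hat (T a u) \<xi> = - (LINT x|lborel. u x * (- (\<i> * of_real (a \<bullet> \<xi>)) * kernel (- \<xi>) x) * of_real (w x))"
    by (simp add: hat_def Tk)
  also have "\<dots> = (LINT x|lborel. \<i> * of_real (a \<bullet> \<xi>) * (u x * kernel (- \<xi>) x * of_real (w x)))"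
    unfolding Bochner_Integration.integral_minus[symmetric] by (simp add: mult_ac)
  also have "\<dots> = \<i> * of_real (a \<bullet> \<xi>) * hat u \<xi>"
    unfolding hat_def by (rule Bochner_Integration.integral_mult_right_zero)
  finally show ?thesis .
qed

text \<open>Differentiation under the integral sign. The kernel is Lipschitz in \<xi> with a
  constant proportional to |x|, so the integrability of |x| m(x) dominates the difference quotients
  together with their limits.\<close>

lemma kernel_integral:
  fixes m :: "real ^ 'n \<Rightarrow> complex"
  assumes m: "integrable lborel m" and mx: "integrable lborel (\<lambda>x. norm x *\<^sub>R m x)"
  defines "H \<equiv> \<lambda>\<xi>. LINT x|lborel. m x * kernel (- x) \<xi>"
  shows kernel_integral_moderate: "moderate H"
    and kernel_integral_T: "T a H \<xi> = (LINT x|lborel. m x * T a (kernel (- x)) \<xi>)"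
proof -
  note [measurable] = borel_measurable_integrable[OF m]
  have km[measurable]: "(\<lambda>x. kernel (- x) \<xi>) \<in> borel_measurable borel" for \<xi>
    using kernel_measurable[of "- \<xi>"] kernel_swap[of _ \<xi>] by simp
  have dm[measurable]: "(\<lambda>x. dir_deriv a (kernel (- x)) \<xi>) \<in> borel_measurable borel" for a \<xi>
    by (rule borel_measurable_LIMSEQ_metric[OF _ dir_deriv_LIMSEQ[OF differentiable_kernel]]) measurable
  define M where "M = (LINT x|lborel. norm (m x))"
  define M1 where "M1 = (LINT x|lborel. norm x * norm (m x))"
  have i1: "integrable lborel (\<lambda>x. m x * kernel (- x) \<xi>)" for \<xi>
  proof (rule Bochner_Integration.integrable_bound[OF integrable_mult_right[OF integrable_norm[OF m], of kernel_bound]])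
    show "AE x in lborel. norm (m x * kernel (- x) \<xi>) \<le> norm (kernel_bound * norm (m x))"
      using kernel_bound_ge_1 by (auto simp: norm_mult mult.commute[of "norm (m _)"] intro!: mult_right_mono norm_kernel_le)
  qed measurable
  have mx': "integrable lborel (\<lambda>x. norm x * norm (m x))"
    using integrable_norm[OF mx] by simp
  have i2: "integrable lborel (\<lambda>x. m x * dir_deriv a (kernel (- x)) \<xi>)" for a \<xi>
  proof (rule Bochner_Integration.integrable_bound[OF integrable_mult_right[OF mx', of "kernel_bound\<^sup>2 * norm a"]])
    show "AE x in lborel. norm (m x * dir_deriv a (kernel (- x)) \<xi>) \<le> norm (kernel_bound\<^sup>2 * norm a * (norm x * norm (m x)))"
    proof (rule AE_I2)
      fix x
      have "norm (m x) * norm (dir_deriv a (kernel (- x)) \<xi>) \<le> norm (m x) * (kernel_bound\<^sup>2 * norm x * norm a)"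
        using norm_dir_deriv_kernel[of a "- x" \<xi>] by (intro mult_left_mono) auto
      then show "norm (m x * dir_deriv a (kernel (- x)) \<xi>) \<le> norm (kernel_bound\<^sup>2 * norm a * (norm x * norm (m x)))"
        by (simp add: norm_mult mult_ac)
    qed
  qed measurable
  define D where "D \<xi> a = (LINT x|lborel. m x * dir_deriv a (kernel (- x)) \<xi>)" for \<xi> a
  have norm_D: "norm (D \<xi> a) \<le> (kernel_bound\<^sup>2 * M1) * norm a" for \<xi> a
  proof -
    have "norm (D \<xi> a) \<le> (LINT x|lborel. kernel_bound\<^sup>2 * norm a * (norm x * norm (m x)))"
      unfolding D_def
    proof (rule Bochner_Integration.integral_norm_bound_integral[OF i2 integrable_mult_right[OF mx']])
      fix x
      have "norm (m x) * norm (dir_deriv a (kernel (- x)) \<xi>) \<le> norm (m x) * (kernel_bound\<^sup>2 * norm x * norm a)"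
        using norm_dir_deriv_kernel[of a "- x" \<xi>] by (intro mult_left_mono) auto
      then show "norm (m x * dir_deriv a (kernel (- x)) \<xi>) \<le> kernel_bound\<^sup>2 * norm a * (norm x * norm (m x))"
        by (simp add: norm_mult mult_ac)
    qed
    also have "\<dots> = (kernel_bound\<^sup>2 * M1) * norm a"
      unfolding M1_def Bochner_Integration.integral_mult_right_zero by simp
    finally show ?thesis .
  qed
  have bl: "bounded_linear (D \<xi>)" for \<xi>
  proof (rule bounded_linear_intro[where K = "kernel_bound\<^sup>2 * M1"])
    note lin = linear_dir_deriv[OF differentiable_kernel]
    show "D \<xi> (a + b) = D \<xi> a + D \<xi> b" for a b
      unfolding D_def linear_add[OF lin] distrib_left by (rule Bochner_Integration.integral_add[OF i2 i2])
    show "D \<xi> (r *\<^sub>R a) = r *\<^sub>R D \<xi> a" for r a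
      unfolding D_def linear_cmul[OF lin] mult_scaleR_right by (rule Bochner_Integration.integral_scaleR_right)
    show "norm (D \<xi> a) \<le> norm a * (kernel_bound\<^sup>2 * M1)" for a
      using norm_D[of \<xi> a] by (simp add: mult.commute)
  qed
  have der: "(H has_derivative D \<xi>) (at \<xi>)" for \<xi>
    unfolding has_derivative_iff_norm tendsto_at_iff_sequentially
  proof (intro conjI bl allI impI)
    fix X :: "nat \<Rightarrow> real ^ 'n" assume X: "\<forall>i. X i \<in> UNIV - {\<xi>}" "X \<longlonglongrightarrow> \<xi>"
    \<comment> \<open>The normalised remainder of the first-order expansion. It tends to 0
      pointwise, and the Lipschitz and the gradient bound each contribute
      \<open>kernel_bound\<^sup>2\<close> times |x| to its majorant.\<close>
    define r where "r n x = (kernel (- x) (X n) - kernel (- x) \<xi> - dir_deriv (X n - \<xi>) (kernel (- x)) \<xi>) /\<^sub>R norm (X n - \<xi>)" for n x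
    have "(\<lambda>n. LINT x|lborel. m x * r n x) \<longlonglongrightarrow> (LINT x|lborel. m x * 0)"
    proof (rule integral_dominated_convergence[where w = "\<lambda>x. (2 * kernel_bound\<^sup>2) * (norm x * norm (m x))"])
      show "integrable lborel (\<lambda>x. (2 * kernel_bound\<^sup>2) * (norm x * norm (m x)))"
        by (rule integrable_mult_right[OF mx'])
      show "AE x in lborel. (\<lambda>n. m x * r n x) \<longlonglongrightarrow> m x * 0"
      proof (intro AE_I2 tendsto_mult tendsto_const)
        fix x
        have "((\<lambda>\<eta>. norm (kernel (- x) \<eta> - kernel (- x) \<xi> - dir_deriv (\<eta> - \<xi>) (kernel (- x)) \<xi>) / norm (\<eta> - \<xi>)) \<longlongrightarrow> 0) (at \<xi>)"
          using has_derivative_dir_deriv[OF differentiable_kernel] by (simp add: has_derivative_iff_norm)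
        then have "(\<lambda>n. norm (kernel (- x) (X n) - kernel (- x) \<xi> - dir_deriv (X n - \<xi>) (kernel (- x)) \<xi>) / norm (X n - \<xi>)) \<longlonglongrightarrow> 0"
          using X by (simp add: tendsto_at_iff_sequentially o_def)
        then have "(\<lambda>n. norm (r n x)) \<longlonglongrightarrow> 0"
          by (simp add: r_def divide_inverse mult.commute)
        then show "(\<lambda>n. r n x) \<longlonglongrightarrow> 0" by (rule tendsto_norm_zero_cancel)
      qed
      fix n
      show "AE x in lborel. norm (m x * r n x) \<le> (2 * kernel_bound\<^sup>2) * (norm x * norm (m x))"
      proof (rule AE_I2)
        fix x
        have pos: "norm (X n - \<xi>) > 0" using X(1) by auto
        have "norm (kernel (- x) (X n) - kernel (- x) \<xi> - dir_deriv (X n - \<xi>) (kernel (- x)) \<xi>)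
            \<le> kernel_bound\<^sup>2 * norm (X n - \<xi>) * norm x + kernel_bound\<^sup>2 * norm x * norm (X n - \<xi>)"
          using kernel_lipschitz'[of "- x" "X n" \<xi>] norm_dir_deriv_kernel[of "X n - \<xi>" "- x" \<xi>]
            norm_triangle_ineq4[of "kernel (- x) (X n) - kernel (- x) \<xi>" "dir_deriv (X n - \<xi>) (kernel (- x)) \<xi>"]
          unfolding norm_minus_cancel by linarith
        then have "inverse (norm (X n - \<xi>)) * norm (kernel (- x) (X n) - kernel (- x) \<xi> - dir_deriv (X n - \<xi>) (kernel (- x)) \<xi>)
            \<le> inverse (norm (X n - \<xi>)) * (norm (X n - \<xi>) * (2 * kernel_bound\<^sup>2 * norm x))"
          by (intro mult_left_mono) (simp_all add: mult_ac)
        also have "\<dots> = 2 * kernel_bound\<^sup>2 * norm x" using pos by (simp add: mult.assoc[symmetric])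
        finally have "norm (r n x) \<le> 2 * kernel_bound\<^sup>2 * norm x"
          by (simp add: r_def)
        then have "norm (m x) * norm (r n x) \<le> norm (m x) * (2 * kernel_bound\<^sup>2 * norm x)"
          by (rule mult_left_mono) simp
        then show "norm (m x * r n x) \<le> (2 * kernel_bound\<^sup>2) * (norm x * norm (m x))"
          by (simp add: norm_mult mult_ac)
      qed
    qed (auto simp: r_def)
    then have lim: "(\<lambda>n. norm (LINT x|lborel. m x * r n x)) \<longlonglongrightarrow> 0"
      using tendsto_norm_zero by fastforce
    have "norm (LINT x|lborel. m x * r n x) = norm (H (X n) - H \<xi> - D \<xi> (X n - \<xi>)) / norm (X n - \<xi>)" for n
    proof -
      have "(LINT x|lborel. m x * r n x) = (LINT x|lborel. (m x * kernel (- x) (X n) - m x * kernel (- x) \<xi>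
          - m x * dir_deriv (X n - \<xi>) (kernel (- x)) \<xi>) /\<^sub>R norm (X n - \<xi>))"
        by (simp add: r_def right_diff_distrib)
      also have "\<dots> = (H (X n) - H \<xi> - D \<xi> (X n - \<xi>)) /\<^sub>R norm (X n - \<xi>)"
        unfolding H_def D_def
        by (simp add: Bochner_Integration.integral_diff[OF Bochner_Integration.integrable_diff[OF i1 i1] i2]
            Bochner_Integration.integral_diff[OF i1 i1])
      finally show ?thesis by (simp add: divide_inverse mult.commute)
    qed
    with lim show "((\<lambda>y. norm (H y - H \<xi> - D \<xi> (y - \<xi>)) / norm (y - \<xi>)) \<circ> X) \<longlonglongrightarrow> 0"
      by (simp add: o_def)
  qed
  have dd: "dir_deriv a H \<xi> = (LINT x|lborel. m x * dir_deriv a (kernel (- x)) \<xi>)" for a \<xi>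
    unfolding dir_deriv_eq[OF der] D_def ..
  have H_diff: "H differentiable (at \<xi>)" for \<xi> using der by (auto simp: differentiable_def)
  show "moderate H"
    unfolding moderate_def
  proof (intro conjI allI H_diff)
    show "poly_bounded H"
    proof (rule poly_boundedI)
      fix \<xi>
      have "norm (H \<xi>) \<le> (LINT x|lborel. kernel_bound * norm (m x))"
        unfolding H_def
        by (rule Bochner_Integration.integral_norm_bound_integral[OF i1 integrable_mult_right[OF integrable_norm[OF m]]])
          (auto simp: norm_mult mult.commute[of "norm (m _)"] intro!: mult_right_mono norm_kernel_le)
      then show "norm (H \<xi>) \<le> (kernel_bound * M) * (1 + norm \<xi>) ^ 0" by (simp add: M_def)
    qed
    show "\<exists>C K. \<forall>a x. norm (dir_deriv a H x) \<le> C * norm a * (1 + norm x) ^ K"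
      using norm_D by (intro exI[of _ "kernel_bound\<^sup>2 * M1"] exI[of _ 0]) (simp add: dir_deriv_eq[OF der])
  qed
  \<comment> \<open>The quotient is a directional derivative on the hyperplane and a difference off
    it; the integral passes through in either case.\<close>
  have iq: "integrable lborel (\<lambda>x. m x * dunkl_quotient v (kernel (- x)) \<xi>) \<and>
      dunkl_quotient v H \<xi> = (LINT x|lborel. m x * dunkl_quotient v (kernel (- x)) \<xi>)" for v \<xi>
  proof (cases "v \<bullet> \<xi> = 0")
    case True
    have eq: "m x * dunkl_quotient v (kernel (- x)) \<xi> = of_real (2 / (norm v)\<^sup>2) * (m x * dir_deriv v (kernel (- x)) \<xi>)" for x
      using True by (simp add: dunkl_quotient_def)
    have "dunkl_quotient v H \<xi> = of_real (2 / (norm v)\<^sup>2) * (LINT x|lborel. m x * dir_deriv v (kernel (- x)) \<xi>)"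
      using True by (simp add: dunkl_quotient_def dd)
    then show ?thesis
      unfolding eq Bochner_Integration.integral_mult_right_zero using integrable_mult_right[OF i2] by blast
  next
    case False
    have eq: "m x * dunkl_quotient v (kernel (- x)) \<xi> =
        (m x * kernel (- x) \<xi> - m x * kernel (- x) (reflect_along v \<xi>)) / of_real (v \<bullet> \<xi>)" for x
      using False by (simp add: dunkl_quotient_def right_diff_distrib)
    have "dunkl_quotient v H \<xi> = (LINT x|lborel. m x * kernel (- x) \<xi> - m x * kernel (- x) (reflect_along v \<xi>)) / of_real (v \<bullet> \<xi>)"
      using False by (simp add: dunkl_quotient_def H_def Bochner_Integration.integral_diff[OF i1 i1])
    then show ?thesis
      unfolding eq using Bochner_Integration.integrable_diff[OF i1 i1] by simp
  qed
  have "(LINT x|lborel. m x * T a (kernel (- x)) \<xi>) = (LINT x|lborel. m x * dir_deriv a (kernel (- x)) \<xi> +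
      (\<Sum>v\<in>Rp. of_real (k v * (v \<bullet> a)) * (m x * dunkl_quotient v (kernel (- x)) \<xi>)))"
    unfolding T_def by (simp add: distrib_left sum_distrib_left mult_ac)
  also have "\<dots> = dir_deriv a H \<xi> + (\<Sum>v\<in>Rp. of_real (k v * (v \<bullet> a)) * dunkl_quotient v H \<xi>)"
    using iq i2 by (subst Bochner_Integration.integral_add) (auto simp: dd Bochner_Integration.integral_sum)
  finally show "T a H \<xi> = (LINT x|lborel. m x * T a (kernel (- x)) \<xi>)"
    by (simp add: T_def)
qed

text \<open>By symmetry of the kernel \<xi> becomes the variable of differentiation and -x the
  parameter, so \<open>kernel_integral\<close> applies to \<open>u\<close> times the weight. The
  eigenvalue -i<x, a> then moves into the integrand.\<close>

lemma hat_moderate_T: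
  assumes u: "rapid u" "u \<in> borel_measurable borel"
  shows hat_moderate: "moderate (hat u)"
    and T_hat: "T a (hat u) \<xi> = - \<i> * hat (\<lambda>x. of_real (a \<bullet> x) * u x) \<xi>"
proof -
  note [measurable] = u(2)
  define m where "m x = u x * of_real (w x)" for x
  have hat: "hat u = (\<lambda>\<xi>. LINT x|lborel. m x * kernel (- x) \<xi>)"
    unfolding hat_def m_def by (intro ext Bochner_Integration.integral_cong) (simp_all add: kernel_swap mult_ac)
  have rm: "rapid m"
    unfolding m_def[abs_def] by (intro rapid_mult u poly_bounded_of_real weight_poly_bounded)
  have i: "integrable lborel m"
    by (rule integrable_rapid[OF rm]) (simp add: m_def[abs_def])
  have "poly_bounded (\<lambda>x :: real ^ 'n. norm x)" by (rule poly_boundedI[of _ 1 1]) simp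
  then have "rapid (\<lambda>x. norm x *\<^sub>R m x)" by (intro rapid_mult_le[OF rm]) (auto simp: mult.commute)
  then have i': "integrable lborel (\<lambda>x. norm x *\<^sub>R m x)"
    by (rule integrable_rapid) (simp add: m_def[abs_def])
  show "moderate (hat u)" unfolding hat by (rule kernel_integral_moderate[OF i i'])
  have "T a (hat u) \<xi> = (LINT x|lborel. m x * T a (kernel (- x)) \<xi>)"
    unfolding hat by (rule kernel_integral_T[OF i i'])
  also have "\<dots> = (LINT x|lborel. - \<i> * (of_real (a \<bullet> x) * u x * kernel (- \<xi>) x * of_real (w x)))"
    by (intro Bochner_Integration.integral_cong) (simp_all add: T_kernel m_def kernel_swap[of _ \<xi>] inner_commute mult_ac)
  also have "\<dots> = - \<i> * hat (\<lambda>x. of_real (a \<bullet> x) * u x) \<xi>"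
    unfolding hat_def by (rule Bochner_Integration.integral_mult_right_zero)
  finally show "T a (hat u) \<xi> = - \<i> * hat (\<lambda>x. of_real (a \<bullet> x) * u x) \<xi>" .
qed

lemma schwartz_measurable: "u \<in> schwartz_space \<Longrightarrow> u \<in> borel_measurable borel"
  by (rule moderate_measurable[OF schwartz_moderate])

text \<open>Induction on the power, with boundedness of the kernel as base case. |\<xi>| is at most
  the sum of its |\<xi>_j|, and each |\<xi>_j| is absorbed by applying a Dunkl operator to
  \<open>u\<close>, which is again a Schwartz function.\<close>

lemma hat_schwartz_rapid:
  assumes "u \<in> schwartz_space"
  shows "rapid (hat u)"
  unfolding rapid_def
proof
  fix m
  show "\<exists>C. \<forall>\<xi>. norm (hat u \<xi>) * (1 + norm \<xi>) ^ m \<le> C"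
    using assms
  proof (induction m arbitrary: u)
    case 0
    have "norm (hat u \<xi>) \<le> (LINT x|lborel. norm (u x * of_real kernel_bound * of_real (w x)))" for \<xi>
      unfolding hat_def
    proof (rule Bochner_Integration.integral_norm_bound_integral)
      show "integrable lborel (\<lambda>x. u x * kernel (- \<xi>) x * of_real (w x))"
        by (intro integrable_weighted schwartz_rapid[OF 0] moderate_poly_bounded[OF moderate_kernel] schwartz_measurable[OF 0]) measurable
      show "integrable lborel (\<lambda>x. norm (u x * of_real kernel_bound * of_real (w x)))"
        by (intro integrable_norm integrable_weighted schwartz_rapid[OF 0] poly_bounded_const schwartz_measurable[OF 0]) measurable
      fix x
      show "norm (u x * kernel (- \<xi>) x * of_real (w x)) \<le> norm (u x * of_real kernel_bound * of_real (w x))"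
        using norm_kernel_le[of "- \<xi>" x] kernel_bound_ge_1
        by (simp add: norm_mult mult_right_mono mult_left_mono)
    qed
    then show ?case by auto
  next
    case (Suc m)
    note u = Suc.prems
    have eq: "\<bar>\<xi> $ j\<bar> * norm (hat u \<xi>) = norm (hat (T (axis j 1) u) \<xi>)" for j \<xi>
      using hat_T[OF schwartz_moderate[OF u] schwartz_rapid[OF u] schwartz_rapid[OF schwartz_T[OF u]], of "axis j 1" \<xi>]
      by (simp add: norm_mult inner_axis')
    obtain C where C: "\<And>\<xi>. norm (hat u \<xi>) * (1 + norm \<xi>) ^ m \<le> C" using Suc.IH[OF u] by blast
    have "\<exists>C. \<forall>\<xi>. norm (hat (T (axis j 1) u) \<xi>) * (1 + norm \<xi>) ^ m \<le> C" for j
      by (rule Suc.IH[OF schwartz_T[OF u]])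
    then obtain D where D: "\<And>j \<xi>. norm (hat (T (axis j 1) u) \<xi>) * (1 + norm \<xi>) ^ m \<le> D j" by metis
    have "norm (hat u \<xi>) * (1 + norm \<xi>) ^ Suc m \<le> C + (\<Sum>j\<in>UNIV. D j)" for \<xi>
    proof -
      have "norm (hat u \<xi>) * (1 + norm \<xi>) ^ Suc m = norm (hat u \<xi>) * (1 + norm \<xi>) ^ m + norm \<xi> * (norm (hat u \<xi>) * (1 + norm \<xi>) ^ m)"
        by (simp add: algebra_simps)
      also have "\<dots> \<le> C + (\<Sum>j\<in>UNIV. \<bar>\<xi> $ j\<bar>) * (norm (hat u \<xi>) * (1 + norm \<xi>) ^ m)"
        by (intro add_mono C mult_right_mono norm_le_l1_cart) auto
      also have "(\<Sum>j\<in>UNIV. \<bar>\<xi> $ j\<bar>) * (norm (hat u \<xi>) * (1 + norm \<xi>) ^ m) = (\<Sum>j\<in>UNIV. norm (hat (T (axis j 1) u) \<xi>) * (1 + norm \<xi>) ^ m)"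
        by (simp only: sum_distrib_right mult.assoc[symmetric] eq)
      also have "C + \<dots> \<le> C + (\<Sum>j\<in>UNIV. D j)"
        by (intro add_left_mono sum_mono D)
      finally show ?thesis .
    qed
    then show ?case by blast
  qed
qed

section \<open>The Gaussian and its Dunkl transform\<close>

definition gaussian :: "real ^ 'n \<Rightarrow> complex" where
  "gaussian x = of_real (exp (- (norm x)\<^sup>2 / 2))"

lemma gaussian_has_derivative:
  "((\<lambda>x. complex_of_real (exp (s * (norm x)\<^sup>2 / 2))) has_derivative (\<lambda>h. of_real (exp (s * (norm x)\<^sup>2 / 2) * (s * (x \<bullet> h))))) (at x)"
proof -
  have "((\<lambda>x. (s / 2) * (x \<bullet> x)) has_derivative (\<lambda>h. (s / 2) * (x \<bullet> h + h \<bullet> x))) (at x)"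
    by (intro has_derivative_mult_right has_derivative_inner has_derivative_ident)
  from has_derivative_of_real[OF has_derivative_exp[OF this]]
  show ?thesis
    by (simp add: power2_norm_eq_inner inner_commute mult_ac)
qed

lemma gaussian_eq: "gaussian = (\<lambda>x. of_real (exp ((- 1) * (norm x)\<^sup>2 / 2)))"
  by (simp add: gaussian_def fun_eq_iff)

lemma gaussian_differentiable: "gaussian differentiable (at x)"
  unfolding gaussian_eq using gaussian_has_derivative differentiable_def by blast

lemma gaussian_measurable [measurable]: "gaussian \<in> borel_measurable borel"
  by (rule differentiable_borel_measurable[OF gaussian_differentiable])

lemma gaussian_rapid: "rapid gaussian"
  by (rule rapid_le[OF rapid_gaussian[of "1 / 2"]]) (auto simp: gaussian_def)

text \<open>A radial factor is invariant under all reflections, so its quotients vanish and only its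
  gradient enters, as in the classical product rule.\<close>

lemma T_mult_radial:
  assumes f: "f differentiable (at x)"
  shows "T a (\<lambda>x. of_real (exp (s * (norm x)\<^sup>2 / 2)) * f x) x =
    of_real (exp (s * (norm x)\<^sup>2 / 2)) * (T a f x + of_real (s * (a \<bullet> x)) * f x)"
proof -
  let ?\<phi> = "\<lambda>x :: real ^ 'n. complex_of_real (exp (s * (norm x)\<^sup>2 / 2))"
  have d: "?\<phi> differentiable (at x)" using gaussian_has_derivative differentiable_def by blast
  have q0: "dunkl_quotient v ?\<phi> x = 0" for v
    by (simp add: dunkl_quotient_def dir_deriv_eq[OF gaussian_has_derivative] inner_commute)
  have q: "dunkl_quotient v (\<lambda>x. ?\<phi> x * f x) x = ?\<phi> x * dunkl_quotient v f x" for v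
    by (subst dunkl_quotient_mult[OF d f]) (simp only: q0, simp)
  have "dir_deriv a (\<lambda>x. ?\<phi> x * f x) x = ?\<phi> x * dir_deriv a f x + of_real (exp (s * (norm x)\<^sup>2 / 2) * (s * (x \<bullet> a))) * f x"
    by (rule dir_deriv_eq[OF has_derivative_mult[OF gaussian_has_derivative has_derivative_dir_deriv[OF f]]])
  then show ?thesis
    unfolding T_def q by (simp add: sum_distrib_left inner_commute algebra_simps)
qed

lemma T_gaussian: "T a gaussian x = - of_real (a \<bullet> x) * gaussian x"
  using T_mult_radial[of "\<lambda>_. 1" x a "- 1"] by (simp add: gaussian_eq T_const)

lemma gaussian_moderate: "moderate gaussian"
  unfolding moderate_def
proof (intro conjI allI gaussian_differentiable rapid_poly_bounded[OF gaussian_rapid])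
  show "\<exists>C K. \<forall>a x. norm (dir_deriv a gaussian x) \<le> C * norm a * (1 + norm x) ^ K"
  proof (rule exI[of _ 1], rule exI[of _ 1], intro allI)
    fix a x :: "real ^ 'n"
    have "norm (dir_deriv a gaussian x) = exp (- (norm x)\<^sup>2 / 2) * \<bar>x \<bullet> a\<bar>"
      unfolding gaussian_eq dir_deriv_eq[OF gaussian_has_derivative] by (simp only: norm_of_real) (simp add: abs_mult)
    also have "\<dots> \<le> 1 * (norm x * norm a)"
      by (intro mult_mono Cauchy_Schwarz_ineq2) auto
    also have "\<dots> \<le> 1 * norm a * (1 + norm x) ^ 1"
      by (simp add: algebra_simps)
    finally show "norm (dir_deriv a gaussian x) \<le> 1 * norm a * (1 + norm x) ^ 1" .
  qed
qed

lemma dunkl_const_hat: "hat gaussian 0 = of_real c\<^sub>k"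
  unfolding hat_def dunkl_const_def integral_complex_of_real[symmetric]
  by (intro Bochner_Integration.integral_cong) (simp_all add: gaussian_def)

text \<open>The Gaussian and its transform satisfy the same equations T_a f = -<a, .> f. Hence their
  quotient is annihilated by every T_a, and uniqueness for the spectral parameter 0 makes it
  constant; its value at 0 is \<open>c\<^sub>k\<close>.\<close>

lemma hat_gaussian: "hat gaussian \<xi> = of_real c\<^sub>k * gaussian \<xi>"
proof -
  have Tg: "T a gaussian = (\<lambda>x. - 1 * (of_real (a \<bullet> x) * gaussian x))" for a
    by (simp add: T_gaussian fun_eq_iff)
  have rTg: "rapid (T a gaussian)" for a
    unfolding Tg by (intro rapid_cmult rapid_mult' poly_bounded_of_real poly_bounded_inner gaussian_rapid)
  have hd: "hat gaussian differentiable (at \<xi>)" for \<xi>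
    by (rule moderate_differentiable[OF hat_moderate[OF gaussian_rapid gaussian_measurable]])
  have Th: "T a (hat gaussian) \<xi> = - of_real (a \<bullet> \<xi>) * hat gaussian \<xi>" for a \<xi>
  proof -
    have "hat (\<lambda>x. of_real (a \<bullet> x) * gaussian x) \<xi> = - hat (T a gaussian) \<xi>"
      unfolding hat_def Tg Bochner_Integration.integral_minus[symmetric] by simp
    also have "\<dots> = - (\<i> * of_real (a \<bullet> \<xi>) * hat gaussian \<xi>)"
      by (simp only: hat_T[OF gaussian_moderate gaussian_rapid rTg])
    finally have "T a (hat gaussian) \<xi> = \<i> * \<i> * (of_real (a \<bullet> \<xi>) * hat gaussian \<xi>)"
      by (simp only: T_hat[OF gaussian_rapid gaussian_measurable]) (simp only: mult_minus_left mult_minus_right minus_minus mult.assoc)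
    then show ?thesis by simp
  qed
  let ?\<phi> = "\<lambda>x :: real ^ 'n. complex_of_real (exp (1 * (norm x)\<^sup>2 / 2))"
  define q where "q \<xi> = ?\<phi> \<xi> * hat gaussian \<xi>" for \<xi>
  have qd: "q differentiable (at \<xi>)" for \<xi>
    unfolding q_def[abs_def]
    using has_derivative_mult[OF gaussian_has_derivative has_derivative_dir_deriv[OF hd]] differentiable_def by blast
  have Tq: "T a q \<xi> = 0" for a \<xi>
    unfolding q_def[abs_def] T_mult_radial[OF hd] Th by simp
  have "q \<xi> - q 0 = 0"
  proof (rule T_eigenfunction_unique[where h = "\<lambda>\<xi>. q \<xi> - q 0" and y = 0])
    show "(\<lambda>\<xi>. q \<xi> - q 0) differentiable at \<xi>" for \<xi>
      by (intro differentiable_diff qd differentiable_const)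
    show "T a (\<lambda>\<xi>. q \<xi> - q 0) x = \<i> * of_real (0 \<bullet> a) * (q x - q 0)" for x a
      by (simp add: T_diff[OF qd differentiable_const] Tq T_const)
  qed simp
  then have q: "?\<phi> \<xi> * hat gaussian \<xi> = of_real c\<^sub>k"
    by (simp add: q_def dunkl_const_hat)
  have "gaussian \<xi> * ?\<phi> \<xi> = 1"
    by (simp add: gaussian_def of_real_mult[symmetric] exp_add[symmetric] del: of_real_mult)
  then have "hat gaussian \<xi> = gaussian \<xi> * (?\<phi> \<xi> * hat gaussian \<xi>)"
    by (simp only: mult.assoc[symmetric] mult_1_left)
  also have "\<dots> = of_real c\<^sub>k * gaussian \<xi>" unfolding q by (rule mult.commute)
  finally show ?thesis .
qed

text \<open>The weight is nonzero off finitely many hyperplanes. The vector \<open>b\<close> that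
  defines the positive subsystem lies on none of them, so the integrand is nonzero on a nonempty
  open set.\<close>

lemma dunkl_const_pos: "c\<^sub>k > 0"
proof -
  let ?f = "\<lambda>x. exp (- (norm x)\<^sup>2 / 2) * w x"
  have "rapid (\<lambda>x. exp (- (1 / 2) * (norm x)\<^sup>2) * w x)"
    by (intro rapid_mult rapid_gaussian weight_poly_bounded) simp
  then have int: "integrable lborel ?f" by (intro integrable_rapid) simp_all
  have nn: "0 \<le> ?f x" for x using weight_nonneg by simp
  have "c\<^sub>k \<noteq> 0"
  proof
    assume "c\<^sub>k = 0"
    then have "AE x in lborel. ?f x = 0"
      using integral_nonneg_eq_0_iff_AE[OF int] nn by (simp add: dunkl_const_def)
    moreover obtain b where b: "\<And>v. v \<in> R \<Longrightarrow> v \<bullet> b \<noteq> 0"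
      using pos by (auto simp: positive_subsystem_def)
    define U where "U = (\<Inter>v\<in>Rp. {x. v \<bullet> x \<noteq> 0})"
    have "open U" unfolding U_def
      by (intro open_INT finite_Rp ballI open_Collect_neq continuous_intros)
    have "b \<in> U" using b Rp_in_R by (auto simp: U_def)
    have "?f x \<noteq> 0" if "x \<in> U" for x
      using that finite_Rp by (auto simp: U_def dunkl_weight_def inner_commute)
    then have "AE x in lborel. x \<notin> U"
      using \<open>AE x in lborel. ?f x = 0\<close> by (auto elim!: eventually_mono)
    then have "U \<in> null_sets lborel"
      using \<open>open U\<close> by (subst AE_iff_null_sets) auto
    then show False
      using \<open>open U\<close> \<open>b \<in> U\<close> open_not_negligible[of U] null_sets_completionI negligible_iff_null_sets by blast
  qed
  moreover have "c\<^sub>k \<ge> 0"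
    unfolding dunkl_const_def using nn by (intro Bochner_Integration.integral_nonneg) auto
  ultimately show ?thesis by simp
qed

text \<open>The composition of the transform with the inverse formula commutes with multiplication by each
  coordinate, and Hadamard's lemma writes \<open>u\<close> as a multiple of the Gaussian plus terms
  \<open>(x\<^sub>j - x0\<^sub>j) u\<^sub>j\<close>, which therefore do not contribute at \<open>x0\<close>.\<close>

theorem dunkl_inversion:
  assumes u: "u \<in> schwartz_space"
  shows "(LINT \<xi>|lborel. hat u \<xi> * kernel x0 \<xi> * of_real (w \<xi>)) = of_real (c\<^sub>k\<^sup>2) * u x0"
proof -
  let ?I = "\<lambda>g. LINT \<xi>|lborel. g \<xi> * kernel x0 \<xi> * of_real (w \<xi>)"
  obtain U where U: "\<And>j. U j \<in> schwartz_space"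
    and dec: "\<And>x. u x = of_real (exp (((norm x0)\<^sup>2 - (norm x)\<^sup>2) / 2)) * u x0 + (\<Sum>j\<in>UNIV. of_real (x $ j - x0 $ j) * U j x)"
    using schwartz_hadamard[OF u] by blast
  \<comment> \<open>The Gaussian in the decomposition is recentred at 0; \<kappa> collects
    \<open>u x0\<close> and the factor that depends on \<open>x0\<close> alone.\<close>
  define \<kappa> where "\<kappa> = of_real (exp ((norm x0)\<^sup>2 / 2)) * u x0"
  have dec': "u x = \<kappa> * gaussian x + (\<Sum>j\<in>UNIV. of_real (x $ j) * U j x - of_real (x0 $ j) * U j x)" for x
  proof -
    have "exp (((norm x0)\<^sup>2 - (norm x)\<^sup>2) / 2) = exp ((norm x0)\<^sup>2 / 2) * exp (- (norm x)\<^sup>2 / 2)"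
      by (simp add: exp_add[symmetric] diff_divide_distrib)
    then show ?thesis
      using dec[of x] by (simp add: \<kappa>_def gaussian_def left_diff_distrib)
  qed
  define xU where "xU j x = of_real (x $ j) * U j x" for j x
  have xU: "xU j \<in> schwartz_space" for j
    unfolding xU_def[abs_def] by (rule schwartz_coordinate[OF U])
  have int_hat: "integrable lborel (\<lambda>x. f x * kernel (- \<xi>) x * of_real (w x))"
    if "rapid f" "f \<in> borel_measurable borel" for f \<xi>
    by (intro integrable_weighted that moderate_poly_bounded[OF moderate_kernel]) measurable
  have int_S: "integrable lborel (\<lambda>x. f x * kernel (- \<xi>) x * of_real (w x))" if "f \<in> schwartz_space" for f \<xi>
    by (rule int_hat[OF schwartz_rapid[OF that] schwartz_measurable[OF that]])
  have hat_u: "hat u \<xi> = \<kappa> * hat gaussian \<xi> + (\<Sum>j\<in>UNIV. hat (xU j) \<xi> - of_real (x0 $ j) * hat (U j) \<xi>)" for \<xi>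
  proof -
    have "hat u \<xi> = (LINT x|lborel. \<kappa> * (gaussian x * kernel (- \<xi>) x * of_real (w x)) +
       (\<Sum>j\<in>UNIV. xU j x * kernel (- \<xi>) x * of_real (w x) - of_real (x0 $ j) * (U j x * kernel (- \<xi>) x * of_real (w x))))"
      unfolding hat_def
      by (intro Bochner_Integration.integral_cong HOL.refl, subst dec')
        (simp only: xU_def distrib_right sum_distrib_right left_diff_distrib mult.assoc)
    also have "\<dots> = \<kappa> * hat gaussian \<xi> + (\<Sum>j\<in>UNIV. hat (xU j) \<xi> - of_real (x0 $ j) * hat (U j) \<xi>)"
      unfolding hat_def
      using int_hat[OF gaussian_rapid gaussian_measurable] int_S[OF xU] int_S[OF U]
      by (subst Bochner_Integration.integral_add) (auto simp: Bochner_Integration.integral_sum)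
    finally show ?thesis .
  qed
  have hm: "moderate (hat f)" "hat f \<in> borel_measurable borel" if "f \<in> schwartz_space" for f
    using hat_moderate[OF schwartz_rapid[OF that] schwartz_measurable[OF that]] moderate_measurable by blast+
  have int_I: "integrable lborel (\<lambda>\<xi>. hat f \<xi> * kernel x0 \<xi> * of_real (w \<xi>))" if "f \<in> schwartz_space" for f
    by (intro integrable_weighted hat_schwartz_rapid that hm moderate_poly_bounded[OF moderate_kernel]) measurable
  \<comment> \<open>A coordinate factor becomes a Dunkl operator on the transform, antisymmetry
    carries it to \<open>kernel x0\<close>, and the eigenvalue there returns the coordinate of
    \<open>x0\<close>; the signs and the factors i cancel.\<close>
  have zero: "?I (hat (xU j)) = of_real (x0 $ j) * ?I (hat (U j))" for j
  proof -
    let ?a = "axis j 1 :: real ^ 'n"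
    have Th: "T ?a (hat (U j)) = (\<lambda>\<xi>. - \<i> * hat (xU j) \<xi>)"
      using T_hat[OF schwartz_rapid[OF U] schwartz_measurable[OF U], of ?a j] by (simp add: fun_eq_iff inner_axis' xU_def[abs_def])
    have rTh: "rapid (T ?a (hat (U j)))"
      unfolding Th by (rule rapid_cmult[OF hat_schwartz_rapid[OF xU]])
    have "- \<i> * ?I (hat (xU j)) = ?I (T ?a (hat (U j)))"
      unfolding Th Bochner_Integration.integral_mult_right_zero[symmetric] by (simp add: mult.assoc)
    also have "\<dots> = - (LINT \<xi>|lborel. hat (U j) \<xi> * T ?a (kernel x0) \<xi> * of_real (w \<xi>))"
      by (rule T_antisymmetric_rapid[OF hm(1)[OF U] hat_schwartz_rapid[OF U] rTh moderate_kernel T_poly_bounded[OF moderate_kernel]])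
    also have "\<dots> = - (\<i> * of_real (x0 $ j) * ?I (hat (U j)))"
      unfolding Bochner_Integration.integral_mult_right_zero[symmetric] by (simp add: T_kernel inner_axis mult_ac)
    finally have "\<i> * ?I (hat (xU j)) = \<i> * (of_real (x0 $ j) * ?I (hat (U j)))" by simp
    then show ?thesis by simp
  qed
  have int_G: "integrable lborel (\<lambda>\<xi>. gaussian \<xi> * kernel x0 \<xi> * of_real (w \<xi>))"
    by (intro integrable_weighted gaussian_rapid moderate_poly_bounded[OF moderate_kernel]) measurable
  \<comment> \<open>The inverse formula at \<open>x0\<close> is the transform at -x0, and the
    Gaussian is even.\<close>
  have I_gauss: "?I gaussian = of_real c\<^sub>k * gaussian x0"
    using hat_gaussian[of "- x0"] by (simp add: hat_def gaussian_def)
  have "?I (hat u) = (LINT \<xi>|lborel. \<kappa> * of_real c\<^sub>k * (gaussian \<xi> * kernel x0 \<xi> * of_real (w \<xi>)) +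
     (\<Sum>j\<in>UNIV. hat (xU j) \<xi> * kernel x0 \<xi> * of_real (w \<xi>) - of_real (x0 $ j) * (hat (U j) \<xi> * kernel x0 \<xi> * of_real (w \<xi>))))"
    unfolding hat_u hat_gaussian
    by (simp only: distrib_right sum_distrib_right left_diff_distrib mult.assoc)
  also have "\<dots> = \<kappa> * of_real c\<^sub>k * ?I gaussian + (\<Sum>j\<in>UNIV. ?I (hat (xU j)) - of_real (x0 $ j) * ?I (hat (U j)))"
    using int_G int_I[OF xU] int_I[OF U]
    by (subst Bochner_Integration.integral_add) (auto simp: Bochner_Integration.integral_sum)
  also have "\<dots> = \<kappa> * of_real c\<^sub>k * (of_real c\<^sub>k * gaussian x0)"
    unfolding zero I_gauss by simp
  also have "\<dots> = of_real (c\<^sub>k\<^sup>2) * (of_real (exp ((norm x0)\<^sup>2 / 2)) * gaussian x0) * u x0"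
    by (simp add: \<kappa>_def power2_eq_square)
  also have "of_real (exp ((norm x0)\<^sup>2 / 2)) * gaussian x0 = 1"
    by (simp add: gaussian_def of_real_mult[symmetric] exp_add[symmetric] del: of_real_mult)
  finally show ?thesis by simp
qed

end

section \<open>Bochner's formula\<close>

text \<open>The substitution t -> s t in Euler's integral. Passing from the closed to the open
  half-line is exact, since \<open>powr\<close> with base 0 is 0.\<close>

lemma Gamma_scaled_nn_integral:
  fixes a s :: real
  assumes a: "0 < a" and s: "s > 0"
  shows "(\<integral>\<^sup>+t. ennreal (indicator {0<..} t * (t powr (a - 1) * exp (- t * s))) \<partial>lborel) = ennreal (Gamma a * s powr (- a))"
proof -
  let ?f = "\<lambda>t. ennreal (indicator {0..} t * t powr (a - 1) / exp t)"
  have "ennreal (Gamma a) = (\<integral>\<^sup>+t. ?f t \<partial>lborel)"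
    by (rule Gamma_conv_nn_integral_real[OF a])
  also have "\<dots> = ennreal \<bar>s\<bar> * (\<integral>\<^sup>+t. ?f (0 + s * t) \<partial>lborel)"
    using s by (intro nn_integral_real_affine) auto
  also have "(\<integral>\<^sup>+t. ?f (0 + s * t) \<partial>lborel) =
      (\<integral>\<^sup>+t. ennreal (s powr (a - 1)) * ennreal (indicator {0<..} t * (t powr (a - 1) * exp (- t * s))) \<partial>lborel)"
  proof (rule nn_integral_cong)
    fix t :: real
    have "indicator {0..} (s * t) * (s * t) powr (a - 1) / exp (s * t) =
        s powr (a - 1) * (indicator {0<..} t * (t powr (a - 1) * exp (- t * s)))"
    proof (cases "t > 0")
      case True
      then show ?thesis using s by (simp add: powr_mult exp_minus divide_inverse mult_ac)
    next
      case False
      then show ?thesis using s by (cases "t = 0") (auto simp: indicator_def mult_le_0_iff zero_le_mult_iff)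
    qed
    then show "?f (0 + s * t) = ennreal (s powr (a - 1)) * ennreal (indicator {0<..} t * (t powr (a - 1) * exp (- t * s)))"
      by (simp add: ennreal_mult')
  qed
  also have "\<dots> = ennreal (s powr (a - 1)) * (\<integral>\<^sup>+t. ennreal (indicator {0<..} t * (t powr (a - 1) * exp (- t * s))) \<partial>lborel)"
    by (rule nn_integral_cmult) measurable
  finally have "ennreal (s powr (- a)) * ennreal (Gamma a) = (ennreal (s powr (- a)) * (ennreal \<bar>s\<bar> * ennreal (s powr (a - 1)))) *
      (\<integral>\<^sup>+t. ennreal (indicator {0<..} t * (t powr (a - 1) * exp (- t * s))) \<partial>lborel)"
    by (simp add: mult.assoc)
  also have "ennreal (s powr (- a)) * (ennreal \<bar>s\<bar> * ennreal (s powr (a - 1))) = ennreal (s powr (- a) * (s * s powr (a - 1)))"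
    using s by (simp add: ennreal_mult'[symmetric])
  also have "s powr (- a) * (s * s powr (a - 1)) = 1"
  proof -
    have "s * s powr (a - 1) = s powr a" using s powr_mult_base[of s "a - 1"] by simp
    then show ?thesis using s by (simp add: powr_add[symmetric])
  qed
  finally show ?thesis
    using a s by (simp add: ennreal_mult'[symmetric] Gamma_real_pos less_imp_le mult.commute)
qed

lemma uminus_notin_nonpos_Ints:
  fixes a :: real
  assumes "0 < a" "a < 1"
  shows "- a \<notin> \<int>\<^sub>\<le>\<^sub>0"
proof
  assume "- a \<in> \<int>\<^sub>\<le>\<^sub>0"
  then obtain n where "- a = of_int n" by (auto elim!: nonpos_Ints_cases)
  with assms have "real_of_int n < of_int 0" "of_int (- 1) < real_of_int n" by simp_all
  then show False by (simp only: of_int_less_iff)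
qed

text \<open>Write (1 - exp (-t l)) / t as the integral of exp (-t s) over s in [0, l] and use
  Tonelli. The integral over t is Gamma (1 - a) s^(a - 1), the one over s then gives l^a / a, and
  Gamma (1 - a) / a = |Gamma (-a)| by the functional equation.\<close>

lemma fractional_power_nn_integral:
  fixes a l :: real
  assumes a: "0 < a" "a < 1" and l: "l \<ge> 0"
  shows "(\<integral>\<^sup>+t. ennreal (indicator {0<..} t * ((1 - exp (- t * l)) / t powr (1 + a))) \<partial>lborel) =
    ennreal (\<bar>Gamma (- a)\<bar> * l powr a)"
proof -
  define h where "h = (\<lambda>(t :: real, s :: real). ennreal (indicator {0<..} t * indicator {0..l} s * (t powr (- a) * exp (- t * s))))"
  have [measurable]: "h \<in> borel_measurable (borel \<Otimes>\<^sub>M borel)"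
    unfolding h_def by measurable
  have "(\<integral>\<^sup>+t. ennreal (indicator {0<..} t * ((1 - exp (- t * l)) / t powr (1 + a))) \<partial>lborel) =
      (\<integral>\<^sup>+t. (\<integral>\<^sup>+s. h (t, s) \<partial>lborel) \<partial>lborel)"
  proof (rule nn_integral_cong)
    fix t :: real
    show "ennreal (indicator {0<..} t * ((1 - exp (- t * l)) / t powr (1 + a))) = (\<integral>\<^sup>+s. h (t, s) \<partial>lborel)"
    proof (cases "t > 0")
      case True
      have "(\<integral>\<^sup>+s. h (t, s) \<partial>lborel) = (\<integral>\<^sup>+s. ennreal (t powr (- a)) * (ennreal (exp (- t * s)) * indicator {0..l} s) \<partial>lborel)"
        using True by (intro nn_integral_cong) (auto simp: h_def indicator_def ennreal_mult')
      also have "\<dots> = ennreal (t powr (- a)) * (\<integral>\<^sup>+s. ennreal (exp (- t * s)) * indicator {0..l} s \<partial>lborel)"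
        by (rule nn_integral_cmult) measurable
      also have "(\<integral>\<^sup>+s. ennreal (exp (- t * s)) * indicator {0..l} s \<partial>lborel) = ennreal (- exp (- t * l) / t - (- exp (- t * 0) / t))"
        using True by (intro nn_integral_FTC_Icc l) (auto intro!: derivative_eq_intros)
      also have "ennreal (t powr (- a)) * \<dots> = ennreal (t powr (- a) * ((1 - exp (- t * l)) / t))"
        using True by (simp add: ennreal_mult'[symmetric] diff_divide_distrib)
      also have "t powr (- a) * ((1 - exp (- t * l)) / t) = (1 - exp (- t * l)) / t powr (1 + a)"
        using True by (simp add: powr_add powr_minus field_simps)
      finally show ?thesis using True by simp
    next
      case False
      then show ?thesis by (simp add: h_def)
    qed
  qed
  also have "\<dots> = (\<integral>\<^sup>+s. (\<integral>\<^sup>+t. h (t, s) \<partial>lborel) \<partial>lborel)"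
    by (rule lborel_pair.Fubini') simp
  also have "\<dots> = (\<integral>\<^sup>+s. ennreal (Gamma (1 - a)) * ennreal (if s \<in> {0..l} then s powr (a - 1) else 0) \<partial>lborel)"
  proof (rule nn_integral_cong_AE)
    \<comment> \<open>At s = 0 the integral over t is infinite, whereas the right-hand side is 0 by
      the convention for \<open>powr\<close>; the point is discarded as a null set.\<close>
    have "AE s in lborel. s \<noteq> (0 :: real)" by (rule AE_lborel_singleton)
    then show "AE s in lborel. (\<integral>\<^sup>+t. h (t, s) \<partial>lborel) = ennreal (Gamma (1 - a)) * ennreal (if s \<in> {0..l} then s powr (a - 1) else 0)"
    proof eventually_elim
      case (elim s)
      show ?case
      proof (cases "s \<in> {0..l}")
        case True
        then have "s > 0" using elim by simp
        from Gamma_scaled_nn_integral[of "1 - a", OF _ this] a True show ?thesis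
          by (simp add: h_def ennreal_mult'[symmetric] Gamma_real_pos less_imp_le)
      next
        case False
        then show ?thesis by (simp add: h_def del: atLeastAtMost_iff)
      qed
    qed
  qed
  also have "\<dots> = ennreal (Gamma (1 - a)) * (\<integral>\<^sup>+s. ennreal (if s \<in> {0..l} then s powr (a - 1) else 0) \<partial>lborel)"
    by (rule nn_integral_cmult) measurable
  also have "(\<integral>\<^sup>+s. ennreal (if s \<in> {0..l} then s powr (a - 1) else 0) \<partial>lborel) = ennreal (l powr a / a)"
  proof (rule nn_integral_has_integral_lborel)
    have "((\<lambda>s. s powr (a - 1)) has_integral (l powr (a - 1 + 1) / (a - 1 + 1))) {0..l}"
      using a l by (intro has_integral_powr_from_0) auto
    then show "((\<lambda>s. if s \<in> {0..l} then s powr (a - 1) else 0) has_integral l powr a / a) UNIV"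
      by (subst has_integral_restrict_UNIV) simp
  qed auto
  also have "ennreal (Gamma (1 - a)) * ennreal (l powr a / a) = ennreal (Gamma (1 - a) / a * l powr a)"
    using a by (simp add: ennreal_mult'[symmetric] Gamma_real_pos less_imp_le)
  also have "Gamma (1 - a) / a = \<bar>Gamma (- a)\<bar>"
  proof -
    have "- a \<notin> \<int>\<^sub>\<le>\<^sub>0" by (rule uminus_notin_nonpos_Ints[OF a])
    then have "Gamma (1 - a) = - a * Gamma (- a)"
      using Gamma_plus1[of "- a"] by (simp add: add.commute)
    moreover have "Gamma (1 - a) > 0" using a by (intro Gamma_real_pos) simp
    ultimately have "Gamma (1 - a) = a * \<bar>Gamma (- a)\<bar>"
      using a by (metis abs_mult abs_minus_cancel abs_of_pos)
    then show ?thesis using a by simp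
  qed
  finally show ?thesis .
qed

lemma fractional_power_integral:
  fixes a l :: real
  assumes a: "0 < a" "a < 1" and l: "l \<ge> 0"
  defines "f \<equiv> \<lambda>t. indicator {0<..} t * ((1 - exp (- t * l)) / t powr (1 + a))"
  shows "integrable lborel f" and "(LINT t|lborel. f t) = \<bar>Gamma (- a)\<bar> * l powr a"
proof -
  have nn: "0 \<le> f t" for t
    using l by (auto simp: f_def indicator_def)
  have m: "f \<in> borel_measurable lborel" unfolding f_def by measurable
  have I: "(\<integral>\<^sup>+t. ennreal (f t) \<partial>lborel) = ennreal (\<bar>Gamma (- a)\<bar> * l powr a)"
    unfolding f_def by (rule fractional_power_nn_integral[OF a l])
  have "has_bochner_integral lborel f (\<bar>Gamma (- a)\<bar> * l powr a)"
    by (rule has_bochner_integral_nn_integral[OF m _ _ I]) (use nn in auto)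
  then show "integrable lborel f" "(LINT t|lborel. f t) = \<bar>Gamma (- a)\<bar> * l powr a"
    by (simp_all add: has_bochner_integral_iff)
qed

text \<open>Fubini in (\<xi>, t). As the scalar factor \<open>f\<close> is nonnegative, the norm of
  \<Phi> integrates over t exactly to a multiple of |\<xi>|^\<alpha> |g(\<xi>)|, which is integrable
  by rapid decay. The singularity at t = 0 is absorbed in this way.\<close>

lemma bochner_representation:
  fixes g :: "real ^ 'n \<Rightarrow> complex" and \<alpha> :: real
  assumes \<alpha>: "0 < \<alpha>" "\<alpha> < 2" and g: "rapid g" and [measurable]: "g \<in> borel_measurable borel"
  defines "F \<equiv> \<lambda>t. (LINT \<xi>|lborel. g \<xi>) - (LINT \<xi>|lborel. of_real (exp (- t * (norm \<xi>)\<^sup>2)) * g \<xi>)"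
  shows "set_integrable lborel {0<..} (\<lambda>t. F t / of_real (t powr (1 + \<alpha> / 2)))"
    and "(LINT t:{0<..}|lborel. F t / of_real (t powr (1 + \<alpha> / 2))) =
      of_real \<bar>Gamma (- \<alpha> / 2)\<bar> * (LINT \<xi>|lborel. of_real (norm \<xi> powr \<alpha>) * g \<xi>)"
proof -
  define a where "a = \<alpha> / 2"
  have a: "0 < a" "a < 1" using \<alpha> by (auto simp: a_def)
  define f where "f \<xi> t = indicator {0<..} t * ((1 - exp (- t * (norm \<xi>)\<^sup>2)) / t powr (1 + a))" for \<xi> :: "real ^ 'n" and t
  define \<Phi> where "\<Phi> \<xi> t = of_real (f \<xi> t) * g \<xi>" for \<xi> t
  have f_int: "integrable lborel (f \<xi>)" "(LINT t|lborel. f \<xi> t) = \<bar>Gamma (- a)\<bar> * norm \<xi> powr \<alpha>" for \<xi>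
  proof -
    have "((norm \<xi>)\<^sup>2) powr a = norm \<xi> powr \<alpha>"
      by (cases "\<xi> = 0") (auto simp: a_def powr_powr simp flip: powr_numeral)
    then show "integrable lborel (f \<xi>)" "(LINT t|lborel. f \<xi> t) = \<bar>Gamma (- a)\<bar> * norm \<xi> powr \<alpha>"
      using fractional_power_integral[OF a, of "(norm \<xi>)\<^sup>2"] by (simp_all add: f_def[abs_def])
  qed
  have f_nn: "0 \<le> f \<xi> t" for \<xi> t by (auto simp: f_def indicator_def)
  have gi: "integrable lborel g" by (rule integrable_rapid[OF g]) measurable
  have "rapid (\<lambda>\<xi>. of_real (norm \<xi> powr \<alpha>) * g \<xi>)"
  proof (rule rapid_mult_le[OF g, of "\<lambda>\<xi>. (1 + norm \<xi>)\<^sup>2"])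
    show "poly_bounded (\<lambda>\<xi> :: real ^ 'n. (1 + norm \<xi>)\<^sup>2)"
      by (rule poly_boundedI[of _ 1 2]) simp
    fix \<xi> :: "real ^ 'n"
    have "norm \<xi> powr \<alpha> \<le> (1 + norm \<xi>) powr \<alpha>" using \<alpha> by (intro powr_mono2) auto
    also have "\<dots> \<le> (1 + norm \<xi>) powr 2" using \<alpha> by (intro powr_mono) auto
    also have "\<dots> = (1 + norm \<xi>)\<^sup>2" by (simp add: add_pos_nonneg)
    finally show "norm (of_real (norm \<xi> powr \<alpha>) * g \<xi>) \<le> norm (g \<xi>) * norm ((1 + norm \<xi>)\<^sup>2)"
      by (simp add: norm_mult mult.commute mult_left_mono)
  qed
  then have gi': "integrable lborel (\<lambda>\<xi>. of_real (norm \<xi> powr \<alpha>) * g \<xi>)"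
    by (rule integrable_rapid) measurable
  have [measurable]: "case_prod f \<in> borel_measurable (borel \<Otimes>\<^sub>M borel)"
    unfolding f_def by measurable
  have "case_prod \<Phi> \<in> borel_measurable (borel \<Otimes>\<^sub>M borel)"
    unfolding \<Phi>_def f_def by measurable
  then have \<Phi>_meas: "case_prod \<Phi> \<in> borel_measurable (lborel \<Otimes>\<^sub>M lborel)" by simp
  have \<Phi>_int: "integrable (lborel \<Otimes>\<^sub>M lborel) (case_prod \<Phi>)"
  proof (rule lborel_pair.Fubini_integrable[OF \<Phi>_meas])
    have "(LINT t|lborel. norm (\<Phi> \<xi> t)) = \<bar>Gamma (- a)\<bar> * norm (of_real (norm \<xi> powr \<alpha>) * g \<xi>)" for \<xi>
    proof -
      have "(LINT t|lborel. norm (\<Phi> \<xi> t)) = (LINT t|lborel. f \<xi> t * norm (g \<xi>))"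
        by (simp add: \<Phi>_def norm_mult f_nn)
      also have "\<dots> = (LINT t|lborel. f \<xi> t) * norm (g \<xi>)"
        by (rule Bochner_Integration.integral_mult_left_zero)
      finally show ?thesis by (simp add: f_int norm_mult)
    qed
    then show "integrable lborel (\<lambda>\<xi>. LINT t|lborel. norm (case_prod \<Phi> (\<xi>, t)))"
      using gi' by simp
    show "AE \<xi> in lborel. integrable lborel (\<lambda>t. case_prod \<Phi> (\<xi>, t))"
      unfolding \<Phi>_def using f_int(1) by (intro AE_I2) (auto intro!: integrable_mult_left integrable_of_real)
  qed
  have inner: "(LINT \<xi>|lborel. \<Phi> \<xi> t) = indicator {0<..} t *\<^sub>R (F t / of_real (t powr (1 + a)))" for t
  proof (cases "t > 0")
    case True
    have "integrable lborel (\<lambda>\<xi>. of_real (exp (- t * (norm \<xi>)\<^sup>2)) * g \<xi>)"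
    proof (rule Bochner_Integration.integrable_bound[OF gi])
      show "AE \<xi> in lborel. norm (of_real (exp (- t * (norm \<xi>)\<^sup>2)) * g \<xi>) \<le> norm (g \<xi>)"
        using True by (intro AE_I2) (simp add: norm_mult mult_left_le_one_le)
    qed measurable
    note hi = this
    have "(LINT \<xi>|lborel. \<Phi> \<xi> t) = (LINT \<xi>|lborel. (g \<xi> - of_real (exp (- t * (norm \<xi>)\<^sup>2)) * g \<xi>) / of_real (t powr (1 + a)))"
      using True by (intro Bochner_Integration.integral_cong) (simp_all add: \<Phi>_def f_def left_diff_distrib)
    also have "\<dots> = F t / of_real (t powr (1 + a))"
      unfolding F_def Bochner_Integration.integral_divide_zero Bochner_Integration.integral_diff[OF gi hi] ..
    finally show ?thesis using True by simp
  next
    case False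
    then show ?thesis by (simp add: \<Phi>_def f_def)
  qed
  show "set_integrable lborel {0<..} (\<lambda>t. F t / of_real (t powr (1 + \<alpha> / 2)))"
    using lborel_pair.integrable_snd[OF \<Phi>_int] unfolding set_integrable_def inner by (simp add: a_def)
  have "(LINT t:{0<..}|lborel. F t / of_real (t powr (1 + \<alpha> / 2))) = (LINT t|lborel. LINT \<xi>|lborel. \<Phi> \<xi> t)"
    unfolding set_lebesgue_integral_def inner by (simp add: a_def)
  also have "\<dots> = (LINT \<xi>|lborel. LINT t|lborel. \<Phi> \<xi> t)"
    by (rule lborel_pair.Fubini_integral[OF \<Phi>_int])
  also have "\<dots> = (LINT \<xi>|lborel. of_real \<bar>Gamma (- a)\<bar> * (of_real (norm \<xi> powr \<alpha>) * g \<xi>))"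
  proof (intro Bochner_Integration.integral_cong HOL.refl)
    fix \<xi>
    have "(LINT t|lborel. \<Phi> \<xi> t) = (LINT t|lborel. of_real (f \<xi> t)) * g \<xi>"
      unfolding \<Phi>_def by (rule Bochner_Integration.integral_mult_left_zero)
    also have "(LINT t|lborel. complex_of_real (f \<xi> t)) = of_real (LINT t|lborel. f \<xi> t)"
      by (rule integral_complex_of_real)
    finally show "(LINT t|lborel. \<Phi> \<xi> t) = of_real \<bar>Gamma (- a)\<bar> * (of_real (norm \<xi> powr \<alpha>) * g \<xi>)"
      by (simp add: f_int)
  qed
  also have "\<dots> = of_real \<bar>Gamma (- \<alpha> / 2)\<bar> * (LINT \<xi>|lborel. of_real (norm \<xi> powr \<alpha>) * g \<xi>)"
    by (simp add: a_def)
  finally show "(LINT t:{0<..}|lborel. F t / of_real (t powr (1 + \<alpha> / 2))) =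
      of_real \<bar>Gamma (- \<alpha> / 2)\<bar> * (LINT \<xi>|lborel. of_real (norm \<xi> powr \<alpha>) * g \<xi>)" .
qed

text \<open>The integrability clause gives the formula its content, since the integral of a function
  that is not integrable is 0 by convention.\<close>

theorem proposition4p10:
  fixes R Rp :: "(real ^ 'n) set" and k :: "real ^ 'n \<Rightarrow> real"
    and \<alpha> :: real and u :: "real ^ 'n \<Rightarrow> complex" and x :: "real ^ 'n"
  assumes "reduced_root_system R"
    and "positive_subsystem R Rp"
    and "multiplicity_function R k"
    and "0 < \<alpha>" and "\<alpha> < 2"
    and "u \<in> schwartz_space"
  shows "set_integrable lborel {0<..}
           (\<lambda>t::real. (u x - dunkl_heat Rp k t u x) / of_real (t powr (1 + \<alpha> / 2))) \<and>
         frac_dunkl_laplacian Rp k \<alpha> u x =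
           of_real (1 / \<bar>Gamma (- \<alpha> / 2)\<bar>) *
           (LINT t:{0<..}|lborel. (u x - dunkl_heat Rp k t u x) / of_real (t powr (1 + \<alpha> / 2)))"
proof -
  interpret dunkl R Rp k by unfold_locales fact+
  note u = \<open>u \<in> schwartz_space\<close>
  \<comment> \<open>The integrand of the inversion formula with both normalising constants. The
    value \<open>u x\<close>, the heat semigroup and the fractional power are the integrals of
    \<open>g\<close> against 1, exp (-t |\<xi>|^2) and |\<xi>|^\<alpha>.\<close>
  define g where "g \<xi> = hat u \<xi> * kernel x \<xi> * of_real (w \<xi>) / of_real (c\<^sub>k\<^sup>2)" for \<xi>
  have c: "c\<^sub>k \<noteq> 0" using dunkl_const_pos by simp
  note hat_meas = moderate_measurable[OF hat_moderate[OF schwartz_rapid[OF u] schwartz_measurable[OF u]]]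
  have "rapid (\<lambda>\<xi>. hat u \<xi> * kernel x \<xi> * of_real (w \<xi>))"
    by (rule rapid_weighted[OF hat_schwartz_rapid[OF u] moderate_poly_bounded[OF moderate_kernel]])
  from rapid_cmult[OF this, of "1 / of_real (c\<^sub>k\<^sup>2)"] have g: "rapid g"
    by (simp add: g_def[abs_def])
  have gm: "g \<in> borel_measurable borel"
    unfolding g_def[abs_def] divide_inverse
    by (intro borel_measurable_times hat_meas kernel_measurable of_real_weight_measurable borel_measurable_const)
  have inv: "inv_dunkl_transform Rp k (\<lambda>\<xi>. of_real (p \<xi>) * dunkl_transform Rp k u \<xi>) x = (LINT \<xi>|lborel. of_real (p \<xi>) * g \<xi>)" for p
  proof -
    have "inv_dunkl_transform Rp k (\<lambda>\<xi>. of_real (p \<xi>) * dunkl_transform Rp k u \<xi>) x =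
        (LINT \<xi>|lborel. of_real (p \<xi>) * (hat u \<xi> / of_real c\<^sub>k) * kernel x \<xi> * of_real (w \<xi>) / of_real c\<^sub>k)"
      unfolding inv_dunkl_transform_eq dunkl_transform_eq by (rule Bochner_Integration.integral_divide_zero[symmetric])
    also have "\<dots> = (LINT \<xi>|lborel. of_real (p \<xi>) * g \<xi>)"
      by (intro Bochner_Integration.integral_cong HOL.refl) (simp add: g_def power2_eq_square)
    finally show ?thesis .
  qed
  have ux: "u x = (LINT \<xi>|lborel. g \<xi>)"
    using c dunkl_inversion[OF u, of x] unfolding g_def Bochner_Integration.integral_divide_zero by simp
  have heat: "dunkl_heat Rp k t u x = (LINT \<xi>|lborel. of_real (exp (- t * (norm \<xi>)\<^sup>2)) * g \<xi>)" for t
    unfolding dunkl_heat_def by (rule inv)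
  have frac: "frac_dunkl_laplacian Rp k \<alpha> u x = (LINT \<xi>|lborel. of_real (norm \<xi> powr \<alpha>) * g \<xi>)"
    unfolding frac_dunkl_laplacian_def by (rule inv)
  \<comment> \<open>\<open>Gamma\<close> takes the value 0 exactly at its poles, by convention, and
    -\<alpha> / 2 lies strictly between -1 and 0.\<close>
  have "Gamma (- \<alpha> / 2) \<noteq> 0"
    using \<open>0 < \<alpha>\<close> \<open>\<alpha> < 2\<close> uminus_notin_nonpos_Ints[of "\<alpha> / 2"] by (simp add: Gamma_eq_zero_iff)
  then show ?thesis
    unfolding ux heat frac
    using bochner_representation[OF \<open>0 < \<alpha>\<close> \<open>\<alpha> < 2\<close> g gm] by simp
qed

end
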